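(* Let $0<d\le n$, $\alpha\in(0,d)$, and $1<p<\frac d\alpha$. Let $\mu$ be a Radon measure on $\mathbb{R}^n$ such that $\sup_Q\frac{\mu(Q)}{l(Q)^d}<\infty$, the supremum being over all cubes $Q\subseteq\mathbb{R}^n$ and $l(Q)$ being the side length of $Q$. For a cube $Q_0\subseteq\mathbb{R}^n$, let $\{\mathcal{D}_j\}_{j=1}^{3^n}$ be an enumeration of the $3^n$ one-third translates of the dyadic lattice generated by $Q_0$. Let $\nu$ be a (nonatomic) Radon measure on $\mathbb{R}^n$ such that $$\sup\frac{\nu(Q)}{\mu(Q)^{1-\frac{\alpha p}{d}}}<\infty,$$ where the supremum extends over all $Q\in\bigcup_{j=1}^{3^n}\mathcal{D}_j$ with $\mu(Q)>0$. If $X(\mathbb{R}^n,\mu)\subseteq(L^p+L^{\frac d\alpha,\infty})(\mathbb{R}^n,\mu)$ and $Y(\mathbb{R}^n,\nu)$ are rearrangement-invariant function spaces such that $\lim_{t\to0^+}\|\chi_{(0,t)}\|_{\bar X(0,\mu(\mathbb{R}^n))}=0$ and $R_{p,\frac d\alpha}$ is bounded from $\bar X(0,\mu(\mathbb{R}^n))$ to $\bar Y(0,\nu(\mathbb{R}^n))$, then $I_\alpha^\mu$ is bounded from $\Lambda_X(\mathbb{R}^n,\mu)$ to $Y^{\langle p\rangle}(\mathbb{R}^n,\nu)$.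
   Context: $I_\alpha^\mu f(x)=\int_{\mathbb{R}^n}\frac{f(y)}{|x-y|^{d-\alpha}}\,d\mu(y)$, $x\in\mathbb{R}^n$. Dyadic lattices: for a (half-open) cube $Q_0$, let $A$ be the similarity of $\mathbb{R}^n$ (rotation, dilation by $l(Q_0)$ and translation) with $A([0,1)^n)=Q_0$. The $3^n$ one-third translates of the dyadic lattice generated by $Q_0$ are, for $a\in\{0,1,2\}^n$, the families $\{A\big(2^{-k}([0,1)^n+m+(-1)^k\tfrac{a}{3})\big):k\in\mathbb{Z},\,m\in\mathbb{Z}^n\}$. Function spaces (over nonatomic $\sigma$-finite measure spaces $(\mathcal R,\mu)$): $f^*_\mu(t)=\inf\{\lambda>0:\mu(\{|f|>\lambda\})\le t\}$, $f^{**}_\mu(t)=\frac1t\int_0^tf^*_\mu(s)\,ds$; on intervals with Lebesgue measure the subscript is omitted. A rearrangement-invariant (r.i.) function norm is a functional $\|\cdot\|_{X(\mathcal{R},\mu)}$ on nonnegative measurable functions with values in $[0,\infty]$ that is a norm, is monotone, has the Fatou property ($f_j\nearrow f$ a.e. implies $\|f_j\|\nearrow\|f\|$), satisfies $\|\chi_E\|<\infty$ and $\int_Ef\,d\mu\le C_E\|f\|$ whenever $\mu(E)<\infty$, and gives equal values to functions with the same distribution function. It is extended by $\|f\|=\|\,|f|\,\|$; $X(\mathcal{R},\mu)=\{f:\|f\|_{X(\mathcal R,\mu)}<\infty\}$ is an r.i. function space. Its representation space $\bar X(0,\mu(\mathcal{R}))$ is the unique r.i. function space over $(0,\mu(\mathcal{R}))$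 with Lebesgue measure such that $\|f\|_{X(\mathcal{R},\mu)}=\|f^*_\mu\|_{\bar X(0,\mu(\mathcal{R}))}$. With $\varphi_X(t)=\|\chi_{(0,t)}\|_{\bar X(0,\mu(\mathcal{R}))}$ (after passing to an equivalent r.i. norm on $X$ it may be assumed concave), $\Lambda_X$ is given by $\|f\|_{\Lambda_X(\mathcal{R},\mu)}=\|f\|_{L^\infty(\mathcal{R},\mu)}\varphi_X(0^+)+\int_0^\infty f^*_\mu(s)\varphi_X'(s)\,ds$ (integrand $0$ for $s\ge\mu(\mathcal R)$). $Y^{\langle p\rangle}(\mathcal{S},\nu)$ is given by $\|f\|_{Y^{\langle p\rangle}(\mathcal{S},\nu)}=\big\|\big((|f|^p)^{**}_\nu\big)^{1/p}\big\|_{\bar Y(0,\nu(\mathcal{S}))}$. $\|f\|_{L^{q,\infty}}=\sup_{t>0}t^{1/q}f^*_\mu(t)$; $(X+Y)$ has norm $\inf_{f=g+h}(\|g\|_X+\|h\|_Y)$; $X\subseteq Z$ means $\|f\|_Z\le C\|f\|_X$ for all measurable $f$. Bounded means $\|Tf\|_Z\le C\|f\|_X$ for all $f\in X$. For $1<p<q$ and $r=\frac{q}{q-p}$, $R_{p,q}g(t)=\big(\frac1t\int_0^{t^r}g^*(s)^p\,ds\big)^{1/p}$, $t\in(0,\infty)$; here $q=\frac d\alpha$. Functions on $(0,\mu(\mathbb R^n))$ are extended by $0$, and $R_{p,q}g$ is restricted to $(0,\nu(\mathbb R^n))$. *)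

theory Defs
  imports "HOL-Analysis.Analysis" "HOL-Probability.Essential_Supremum"
begin

section \<open>Measures\<close>

text \<open>On \<open>\<real>\<^sup>n\<close> every Borel measure that is finite on compact sets is regular and
  \<open>\<sigma>\<close>-finite, so no regularity clause is needed.\<close>

definition radon_measure :: "'a::euclidean_space measure \<Rightarrow> bool" where
  "radon_measure M \<longleftrightarrow> sets M = sets borel \<and> (\<forall>K. compact K \<longrightarrow> emeasure M K < \<infinity>)"

definition nonatomic :: "'a measure \<Rightarrow> bool" where
  "nonatomic M \<longleftrightarrow>
     (\<forall>A\<in>sets M. emeasure M A > 0 \<longrightarrow>
        (\<exists>B\<in>sets M. B \<subseteq> A \<and> 0 < emeasure M B \<and> emeasure M B < emeasure M A))"

text \<open>The interval \<open>(0,b)\<close>, where \<open>b\<close> may be \<open>\<infinity>\<close>, and Lebesgue measure on it.\<close>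

definition ivl :: "ennreal \<Rightarrow> real set" where
  "ivl b = {t. 0 < t \<and> ennreal t < b}"

definition lborel_ivl :: "ennreal \<Rightarrow> real measure" where
  "lborel_ivl b = restrict_space lborel (ivl b)"

section \<open>Cubes and the one-third translates of a dyadic lattice\<close>

definition unit_cube :: "(real ^ 'n) set" where
  "unit_cube = {x. \<forall>i. 0 \<le> x $ i \<and> x $ i < 1}"

text \<open>\<open>l\<close> is the dilation factor, i.e. the side length of the cube \<open>A ` unit_cube\<close>.\<close>

definition similarity :: "(real ^ 'n \<Rightarrow> real ^ 'n) \<Rightarrow> real \<Rightarrow> bool" where
  "similarity A l \<longleftrightarrow>
     l > 0 \<and> (\<exists>R b. rotation_matrix R \<and> A = (\<lambda>x. l *\<^sub>R (R *v x) + b))"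

text \<open>\<open>Q\<close> is a half-open cube, not necessarily parallel to the axes, of side length \<open>l\<close>.\<close>

definition is_cube :: "(real ^ 'n) set \<Rightarrow> real \<Rightarrow> bool" where
  "is_cube Q l \<longleftrightarrow> (\<exists>A. similarity A l \<and> Q = A ` unit_cube)"

definition third_translate ::
    "(real ^ 'n \<Rightarrow> real ^ 'n) \<Rightarrow> real ^ 'n \<Rightarrow> (real ^ 'n) set set" where
  "third_translate A a =
     {A ` ((\<lambda>x. (2 powi (- k)) *\<^sub>R (x + m + ((-1) powi k) *\<^sub>R ((1/3) *\<^sub>R a))) ` unit_cube)
        | k m. \<forall>i. m $ i \<in> \<int>}"

definition third_translates :: "(real ^ 'n \<Rightarrow> real ^ 'n) \<Rightarrow> (real ^ 'n) set set set" where
  "third_translates A = {third_translate A a | a. \<forall>i. a $ i \<in> {0, 1, 2}}"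

section \<open>Rearrangements\<close>

text \<open>Real powers on \<open>[0,\<infinity>]\<close>; only exponents \<open>p > 0\<close> are used.\<close>

definition epowr :: "ennreal \<Rightarrow> real \<Rightarrow> ennreal" where
  "epowr x p = (if x = \<infinity> then \<infinity> else ennreal (enn2real x powr p))"

definition nnabs :: "('a \<Rightarrow> real) \<Rightarrow> 'a \<Rightarrow> ennreal" where
  "nnabs f = (\<lambda>x. ennreal \<bar>f x\<bar>)"

definition dist_fun :: "'a measure \<Rightarrow> ('a \<Rightarrow> ennreal) \<Rightarrow> ennreal \<Rightarrow> ennreal" where
  "dist_fun M f l = emeasure M {x \<in> space M. l < f x}"

definition rearr :: "'a measure \<Rightarrow> ('a \<Rightarrow> ennreal) \<Rightarrow> real \<Rightarrow> ennreal" where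
  "rearr M f t = Inf {l. 0 < l \<and> dist_fun M f l \<le> ennreal t}"

definition max_rearr :: "'a measure \<Rightarrow> ('a \<Rightarrow> ennreal) \<Rightarrow> real \<Rightarrow> ennreal" where
  "max_rearr M f t = ennreal (1 / t) * (\<integral>\<^sup>+ s \<in> {0<..<t}. rearr M f s \<partial>lborel)"

section \<open>Rearrangement-invariant function norms\<close>

text \<open>A function norm is a functional on \<open>[0,\<infinity>]\<close>-valued measurable functions; its values on
  nonmeasurable functions are irrelevant. The norm of a real-valued \<open>f\<close> is \<open>N (nnabs f)\<close>.
  Functions of finite norm are finite almost everywhere, so nothing is lost by taking the elements
  of the spaces to be real-valued.\<close>

definition ri_norm :: "'a measure \<Rightarrow> (('a \<Rightarrow> ennreal) \<Rightarrow> ennreal) \<Rightarrow> bool" where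
  "ri_norm M N \<longleftrightarrow>
     (\<forall>f\<in>borel_measurable M. N f = 0 \<longleftrightarrow> (AE x in M. f x = 0)) \<and>
     (\<forall>f\<in>borel_measurable M. \<forall>c\<ge>0. N (\<lambda>x. ennreal c * f x) = ennreal c * N f) \<and>
     (\<forall>f\<in>borel_measurable M. \<forall>g\<in>borel_measurable M. N (\<lambda>x. f x + g x) \<le> N f + N g) \<and>
     (\<forall>f\<in>borel_measurable M. \<forall>g\<in>borel_measurable M.
        (AE x in M. f x \<le> g x) \<longrightarrow> N f \<le> N g) \<and>
     (\<forall>F. \<forall>f\<in>borel_measurable M.
        (\<forall>j::nat. F j \<in> borel_measurable M) \<and>
        (AE x in M. incseq (\<lambda>j. F j x) \<and> (\<lambda>j. F j x) \<longlonglongrightarrow> f x) \<longrightarrow>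
        incseq (\<lambda>j. N (F j)) \<and> (\<lambda>j. N (F j)) \<longlonglongrightarrow> N f) \<and>
     (\<forall>E\<in>sets M. emeasure M E < \<infinity> \<longrightarrow> N (indicator E) < \<infinity>) \<and>
     (\<forall>E\<in>sets M. emeasure M E < \<infinity> \<longrightarrow>
        (\<exists>C>0. \<forall>f\<in>borel_measurable M. (\<integral>\<^sup>+ x \<in> E. f x \<partial>M) \<le> ennreal C * N f)) \<and>
     (\<forall>f\<in>borel_measurable M. \<forall>g\<in>borel_measurable M.
        dist_fun M f = dist_fun M g \<longrightarrow> N f = N g)"

text \<open>\<open>N\<close> is an r.i. norm over \<open>M\<close> with representation norm \<open>Nbar\<close> over
  \<open>(0, M(space M))\<close>. For nonatomic \<open>\<sigma>\<close>-finite \<open>M\<close> such an \<open>Nbar\<close> exists for every r.i. norm \<open>N\<close>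
  and is uniquely determined on measurable functions.\<close>

definition ri_representation ::
    "'a measure \<Rightarrow> (('a \<Rightarrow> ennreal) \<Rightarrow> ennreal) \<Rightarrow> ((real \<Rightarrow> ennreal) \<Rightarrow> ennreal) \<Rightarrow> bool" where
  "ri_representation M N Nbar \<longleftrightarrow>
     ri_norm M N \<and> ri_norm (lborel_ivl (emeasure M (space M))) Nbar \<and>
     (\<forall>f\<in>borel_measurable M. N f = Nbar (rearr M f))"

definition equivalent_norms ::
    "'a measure \<Rightarrow> (('a \<Rightarrow> ennreal) \<Rightarrow> ennreal) \<Rightarrow> (('a \<Rightarrow> ennreal) \<Rightarrow> ennreal) \<Rightarrow> bool" where
  "equivalent_norms M N N' \<longleftrightarrow>
     (\<exists>C>0. \<forall>f\<in>borel_measurable M. N f \<le> ennreal C * N' f \<and> N' f \<le> ennreal C * N f)"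

definition fundamental :: "((real \<Rightarrow> ennreal) \<Rightarrow> ennreal) \<Rightarrow> real \<Rightarrow> ennreal" where
  "fundamental Nbar t = Nbar (indicator {0<..<t})"

text \<open>To be used with a norm \<open>Nbar\<close> whose fundamental function is concave; the latter is then
  differentiable off a countable set.\<close>

definition Lambda_norm ::
    "'a measure \<Rightarrow> ((real \<Rightarrow> ennreal) \<Rightarrow> ennreal) \<Rightarrow> ('a \<Rightarrow> ennreal) \<Rightarrow> ennreal" where
  "Lambda_norm M Nbar f =
     esssup M f * Lim (at_right 0) (fundamental Nbar) +
     (\<integral>\<^sup>+ s \<in> ivl (emeasure M (space M)).
        (rearr M f s * ennreal (deriv (\<lambda>t. enn2real (fundamental Nbar t)) s)) \<partial>lborel)"

definition angle_norm ::
    "'a measure \<Rightarrow> ((real \<Rightarrow> ennreal) \<Rightarrow> ennreal) \<Rightarrow> real \<Rightarrow> ('a \<Rightarrow> ennreal) \<Rightarrow> ennreal" where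
  "angle_norm M Nbar p f =
     Nbar (\<lambda>t. epowr (max_rearr M (\<lambda>x. epowr (f x) p) t) (1 / p))"

definition Lp_norm :: "'a measure \<Rightarrow> real \<Rightarrow> ('a \<Rightarrow> ennreal) \<Rightarrow> ennreal" where
  "Lp_norm M p f = epowr (\<integral>\<^sup>+ x. epowr (f x) p \<partial>M) (1 / p)"

definition weak_Lq_norm :: "'a measure \<Rightarrow> real \<Rightarrow> ('a \<Rightarrow> ennreal) \<Rightarrow> ennreal" where
  "weak_Lq_norm M q f = (SUP t\<in>{0<..}. ennreal (t powr (1 / q)) * rearr M f t)"

definition sum_norm ::
    "'a measure \<Rightarrow> (('a \<Rightarrow> ennreal) \<Rightarrow> ennreal) \<Rightarrow> (('a \<Rightarrow> ennreal) \<Rightarrow> ennreal)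
      \<Rightarrow> ('a \<Rightarrow> real) \<Rightarrow> ennreal" where
  "sum_norm M N1 N2 f =
     (INF (g, h) \<in> {(g, h). g \<in> borel_measurable M \<and> h \<in> borel_measurable M \<and>
                            (\<forall>x\<in>space M. f x = g x + h x)}.
        N1 (nnabs g) + N2 (nnabs h))"

section \<open>Operators\<close>

text \<open>\<open>T f\<close> stands for the modulus of the image of \<open>f\<close>, on which alone the target norm depends.\<close>

definition bounded_operator ::
    "'a measure \<Rightarrow> (('a \<Rightarrow> ennreal) \<Rightarrow> ennreal) \<Rightarrow> (('b \<Rightarrow> ennreal) \<Rightarrow> ennreal)
      \<Rightarrow> (('a \<Rightarrow> real) \<Rightarrow> 'b \<Rightarrow> ennreal) \<Rightarrow> bool" where
  "bounded_operator M NX NZ T \<longleftrightarrow>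
     (\<exists>C>0. \<forall>f\<in>borel_measurable M. NX (nnabs f) < \<infinity> \<longrightarrow> NZ (T f) \<le> ennreal C * NX (nnabs f))"

definition riesz_integrand ::
    "real \<Rightarrow> real \<Rightarrow> ('a::euclidean_space \<Rightarrow> real) \<Rightarrow> 'a \<Rightarrow> 'a \<Rightarrow> real" where
  "riesz_integrand d \<alpha> f x y = f y / norm (x - y) powr (d - \<alpha>)"

definition riesz_potential ::
    "real \<Rightarrow> real \<Rightarrow> 'a::euclidean_space measure \<Rightarrow> ('a \<Rightarrow> real) \<Rightarrow> 'a \<Rightarrow> real" where
  "riesz_potential d \<alpha> M f x = (\<integral>y. riesz_integrand d \<alpha> f x y \<partial>M)"

text \<open>Boundedness of \<open>riesz_potential d \<alpha> M\<close> as an operator between spaces over \<open>M\<close> and \<open>M'\<close>.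
  The Bochner integral is 0 where the integrand is not integrable; therefore it is required that
  the defining integral converges absolutely almost everywhere on the target space.\<close>

definition riesz_bounded ::
    "real \<Rightarrow> real \<Rightarrow> 'a::euclidean_space measure \<Rightarrow> (('a \<Rightarrow> ennreal) \<Rightarrow> ennreal)
      \<Rightarrow> 'a measure \<Rightarrow> (('a \<Rightarrow> ennreal) \<Rightarrow> ennreal) \<Rightarrow> bool" where
  "riesz_bounded d \<alpha> M NX M' NZ \<longleftrightarrow>
     (\<forall>f\<in>borel_measurable M. NX (nnabs f) < \<infinity> \<longrightarrow>
        (AE x in M'. integrable M (riesz_integrand d \<alpha> f x))) \<and>
     bounded_operator M NX NZ (\<lambda>f. nnabs (riesz_potential d \<alpha> M f))"

definition extend0 :: "real set \<Rightarrow> (real \<Rightarrow> real) \<Rightarrow> real \<Rightarrow> real" where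
  "extend0 S g t = (if t \<in> S then g t else 0)"

definition R_op :: "real \<Rightarrow> real \<Rightarrow> (real \<Rightarrow> real) \<Rightarrow> real \<Rightarrow> ennreal" where
  "R_op p q g t =
     epowr (ennreal (1 / t) *
       (\<integral>\<^sup>+ s \<in> {0<..<t powr (q / (q - p))}. epowr (rearr (lborel_ivl \<infinity>) (nnabs g) s) p \<partial>lborel))
       (1 / p)"

end

theory Submission
  imports Defs "HOL-Library.Nat_Bijection"
begin

text \<open>
  The growth of \<open>\<mu>\<close> bounds the potential \<open>I \<chi>\<^sub>E\<close> pointwise in two ways: by \<open>C \<mu>(E)\<^sup>1\<^sup>/\<^sup>q\<close> with
  \<open>q = d / \<alpha>\<close>, and, writing \<open>\<delta>(x, \<rho>) = \<mu>(E \<inter> B(x, \<rho>)) / \<rho>\<^sup>d\<close>, by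
  \<open>C (sup\<^sub>\<rho> \<rho>\<^sup>\<alpha>\<^sup>p \<delta>(x, \<rho>)\<^sup>\<theta>)\<^sup>1\<^sup>/\<^sup>p\<close> for any \<open>1 < \<theta> < p\<close>. By the one-third trick the hypothesis on \<open>\<nu>\<close>
  gives \<open>\<nu>(B(x, \<rho>)) \<le> C \<rho>\<^sup>d\<^sup>-\<^sup>\<alpha>\<^sup>p\<close> for every ball with \<open>\<mu>(B(x, \<rho>)) > 0\<close>. Splitting the supremum
  into the levels \<open>\<delta> \<approx> 2\<^sup>-\<^sup>i\<close> and selecting disjoint balls by Vitali's lemma on each level, one obtains
  \<open>\<parallel>I \<chi>\<^sub>E\<parallel>\<^sub>L\<^sub>p\<^sub>(\<^sub>\<nu>\<^sub>) \<le> C \<mu>(E)\<^sup>1\<^sup>/\<^sup>p\<close>; the exponent \<open>\<theta> > 1\<close> makes the sum over \<open>i\<close> converge.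

  For general \<open>f\<close> use \<open>\<bar>f\<bar> \<le> \<Sum>\<^sub>k 2\<^sup>k\<^sup>+\<^sup>1 \<chi>\<^sub>E\<^sub>k\<close> with \<open>E\<^sub>k = {\<bar>f\<bar> > 2\<^sup>k}\<close> and \<open>a\<^sub>k = \<mu>(E\<^sub>k)\<close>.
  For each \<open>t\<close> every piece is estimated in the better of \<open>L\<^sup>p(\<nu>)\<close> and \<open>L\<^sup>\<infinity>\<close>, which gives
  \<open>((\<bar>I f\<bar>\<^sup>p)\<^sup>*\<^sup>*(t))\<^sup>1\<^sup>/\<^sup>p \<le> C \<Sum>\<^sub>k 2\<^sup>k min ((a\<^sub>k / t)\<^sup>1\<^sup>/\<^sup>p, a\<^sub>k\<^sup>1\<^sup>/\<^sup>q)\<close>. The minimum coincides with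
  \<open>R \<chi>\<^sub>(\<^sub>0\<^sub>,\<^sub>a\<^sub>)\<close> for \<open>t \<ge> a\<^sup>1\<^sup>/\<^sup>r\<close>, and its constant part on \<open>(0, a\<^sup>1\<^sup>/\<^sup>r)\<close> is equimeasurable with a function
  below \<open>2 R \<chi>\<^sub>(\<^sub>0\<^sub>,\<^sub>a\<^sub>)\<close>, so its norm in \<open>Y\<close> is at most \<open>C \<phi>\<^sub>X(a)\<close>; when \<open>a\<^sup>1\<^sup>/\<^sup>r\<close> exceeds
  \<open>\<nu>(\<real>\<^sup>n) / 2\<close> the inclusion of \<open>X\<close> in \<open>L\<^sup>p + L\<^sup>q\<^sup>,\<^sup>\<infinity>\<close> is used instead. This inclusion also makes
  \<open>\<phi>\<^sub>X\<close> unbounded if \<open>\<mu>(\<real>\<^sup>n) = \<infinity>\<close>, so that all \<open>a\<^sub>k\<close> are finite. Finally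
  \<open>\<Sum>\<^sub>k 2\<^sup>k \<phi>(a\<^sub>k)\<close> is at most twice the norm of \<open>f\<close> in \<open>\<Lambda>\<^sub>X\<close>.
\<close>

section \<open>Cubes, balls and the one-third trick\<close>

lemma similarity_repr:
  assumes "similarity A l"
  obtains R b where "l > 0" "orthogonal_matrix R" "A = (\<lambda>x. l *\<^sub>R (R *v x) + b)"
  using assms by (auto simp: similarity_def rotation_matrix_def)

lemma similarity_dist:
  assumes "similarity A l"
  shows "dist (A x) (A y) = l * dist x y"
proof -
  obtain R b where R: "l > 0" "orthogonal_matrix R" "A = (\<lambda>x. l *\<^sub>R (R *v x) + b)"
    using similarity_repr[OF assms] .
  have "orthogonal_transformation ((*v) R)"
    using R(2) by (simp add: orthogonal_transformation_matrix)
  then have "norm (R *v (x - y)) = norm (x - y)"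
    by (rule orthogonal_transformation_norm)
  then show ?thesis
    using R by (simp add: dist_norm flip: scaleR_diff_right matrix_vector_mult_diff_distrib)
qed

text \<open>The transpose inverts an orthogonal matrix, so the inverse similarity is explicit. Its
  continuity makes cubes, being images of the unit cube, Borel sets.\<close>

lemma similarity_inverse:
  assumes "similarity A l"
  obtains B where "continuous_on UNIV B" "\<And>x. A (B x) = x" "\<And>x. B (A x) = x"
proof -
  obtain R b where R: "l > 0" "orthogonal_matrix R" "A = (\<lambda>x. l *\<^sub>R (R *v x) + b)"
    using similarity_repr[OF assms] .
  show ?thesis
  proof (rule that[of "\<lambda>y. transpose R *v ((1 / l) *\<^sub>R (y - b))"])
    show "continuous_on UNIV (\<lambda>y. transpose R *v ((1 / l) *\<^sub>R (y - b)))"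
      by (intro matrix_vector_mult_linear_continuous_on[THEN continuous_on_compose2[where s=UNIV]] continuous_intros) auto
  qed (use R in \<open>auto simp: orthogonal_matrix_def matrix_vector_mul_assoc scaleR_matrix_vector_assoc[symmetric]
        matrix_vector_mult_scaleR simp del: transpose_matrix_vector\<close>)
qed

lemma sets_unit_cube: "unit_cube \<in> sets borel"
  unfolding unit_cube_def by measurable

lemma sets_cube:
  assumes "is_cube Q s"
  shows "Q \<in> sets borel"
proof -
  obtain A where A: "similarity A s" "Q = A ` unit_cube"
    using assms by (auto simp: is_cube_def)
  obtain B where B: "continuous_on UNIV B" "\<And>x. A (B x) = x" "\<And>x. B (A x) = x"
    using similarity_inverse[OF A(1)] by blast
  have "Q = B -` unit_cube \<inter> space borel"
    using A(2) B(2,3) by (auto simp: image_iff) metis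
  also have "\<dots> \<in> sets borel"
    using measurable_sets[OF borel_measurable_continuous_onI[OF B(1)] sets_unit_cube] by auto
  finally show ?thesis .
qed

text \<open>The maps that carry the unit cube to the members of a third translate are of this form,
  so these members are cubes of known side.\<close>

lemma similarity_scale_translate:
  assumes "similarity A l" "c > 0"
  shows "similarity (\<lambda>x. A (c *\<^sub>R (x + w))) (l * c)"
proof -
  obtain R b where R: "l > 0" "rotation_matrix R" "A = (\<lambda>x. l *\<^sub>R (R *v x) + b)"
    using assms(1) by (auto simp: similarity_def)
  have "(\<lambda>x. A (c *\<^sub>R (x + w))) = (\<lambda>x. (l * c) *\<^sub>R (R *v x) + ((l * c) *\<^sub>R (R *v w) + b))"
    using R(3) by (auto simp: fun_eq_iff matrix_vector_mult_scaleR matrix_vector_right_distrib algebra_simps)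
  then show ?thesis
    using R assms(2) unfolding similarity_def by auto
qed

lemma ball_subset_axis_cube:
  fixes x :: "real ^ 'n"
  assumes "\<rho> > 0"
  obtains Q where "is_cube Q (2 * \<rho>)" "ball x \<rho> \<subseteq> Q"
proof -
  define A where "A y = (2 * \<rho>) *\<^sub>R y + (x - (\<chi> i. \<rho>))" for y :: "real ^ 'n"
  have "similarity A (2 * \<rho>)"
    unfolding similarity_def
    by (intro conjI exI[of _ "mat 1"] exI[of _ "x - (\<chi> i. \<rho>)"])
       (use assms in \<open>auto simp: A_def fun_eq_iff rotation_matrix_def orthogonal_matrix_id\<close>)
  moreover have "ball x \<rho> \<subseteq> A ` unit_cube"
  proof
    fix y assume y: "y \<in> ball x \<rho>"
    define z where "z = (1 / (2 * \<rho>)) *\<^sub>R (y - (x - (\<chi> i. \<rho>)))"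
    have "0 \<le> z $ i \<and> z $ i < 1" for i
    proof -
      have "\<bar>y $ i - x $ i\<bar> < \<rho>"
        using component_le_norm_cart[of "y - x" i] y by (simp add: dist_norm norm_minus_commute)
      moreover have "z $ i = (y $ i - x $ i + \<rho>) / (2 * \<rho>)"
        by (simp add: z_def)
      ultimately show ?thesis
        using assms by (simp add: abs_less_iff)
    qed
    then have "z \<in> unit_cube"
      by (simp add: unit_cube_def)
    moreover have "y = A z"
      using assms by (simp add: A_def z_def)
    ultimately show "y \<in> A ` unit_cube" by blast
  qed
  ultimately show ?thesis
    using that is_cube_def by blast
qed

text \<open>One-dimensional one-third trick. The numbers \<open>m + s * (a / 3)\<close> run through
  all multiples of 1/3, so a unit interval may start at the last multiple not exceeding
  \<open>u\<close>. Less than 1/3 of its length is lost, and only 1/3 is wanted to the right of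
  \<open>u\<close>.\<close>

lemma one_third_shift:
  fixes u s :: real
  assumes "s = 1 \<or> s = - 1"
  obtains a m where "a \<in> {0, 1, 2}" "m \<in> \<int>" "m + s * (a / 3) \<le> u" "u + 1 / 3 < m + s * (a / 3) + 1"
proof -
  define j where "j = \<lfloor>3 * u\<rfloor>"
  obtain s' :: int where s': "s = of_int s'" "s' = 1 \<or> s' = -1"
    using assms by (metis of_int_1 of_int_minus)
  \<comment> \<open>As \<open>s'\<close> is its own inverse, this residue makes
    \<open>s' * a\<close> congruent to \<open>j\<close> modulo 3, and \<open>j / 3\<close> is the
    starting point wanted.\<close>
  define a where "a = (s' * j) mod 3"
  have "a \<in> {0, 1, 2}"
    unfolding a_def by simp presburger
  have "3 dvd j - s' * a"
    using s'(2) unfolding a_def by (elim disjE; simp; presburger)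
  then obtain m where m: "j = 3 * m + s' * a"
    by (metis add.commute diff_add_cancel dvd_def add_diff_cancel)
  have "of_int m + s * (of_int a / 3) = of_int j / 3"
    using m s' by auto
  moreover have "of_int j \<le> 3 * u" "3 * u < of_int j + 1"
    unfolding j_def by linarith+
  ultimately show ?thesis
    by (intro that[of "of_int a" "of_int m"]) (use \<open>a \<in> {0,1,2}\<close> in auto)
qed

text \<open>The scale is chosen so that the bounding box of the ball has at most a third of the side
  of the lattice cubes. Then \<open>one_third_shift\<close> is applied to each coordinate
  separately, after pulling the ball back by the inverse of \<open>A\<close>.\<close>

lemma ball_subset_third_translate:
  fixes x :: "real ^ 'n"
  assumes A: "similarity A l" and "\<rho> > 0"
  obtains Q s where "Q \<in> \<Union> (third_translates A)" "is_cube Q s" "ball x \<rho> \<subseteq> Q" "s \<le> 12 * \<rho>"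
proof -
  have l: "l > 0" using A by (auto simp: similarity_def)
  \<comment> \<open>The side \<open>l * 2 powi (- k)\<close> then lies between
    \<open>6 * \<rho>\<close> and \<open>12 * \<rho>\<close>.\<close>
  define k :: int where "k = \<lfloor>log 2 (l / (6 * \<rho>))\<rfloor>"
  define c :: real where "c = 2 powi (- k)"
  have c: "c > 0" by (simp add: c_def)
  have ck: "c = 2 powr (- of_int k)"
    by (simp add: c_def flip: powr_real_of_int')
  have "of_int k \<le> log 2 (l / (6 * \<rho>))" "log 2 (l / (6 * \<rho>)) < of_int k + 1"
    unfolding k_def by linarith+
  then have "2 powr of_int k \<le> l / (6 * \<rho>)" "l / (6 * \<rho>) < 2 powr (of_int k + 1)"
    using l \<open>\<rho> > 0\<close> by (simp_all add: le_log_iff log_less_iff)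
  then have "1 / c \<le> l / (6 * \<rho>)" "l / (6 * \<rho>) < 2 / c"
    by (simp_all add: ck powr_minus powr_add field_simps)
  then have c6: "6 * \<rho> \<le> l * c" "l * c < 12 * \<rho>"
    using c \<open>\<rho> > 0\<close> by (simp_all add: field_simps)
  obtain B where B: "\<And>x. A (B x) = x" "\<And>x. B (A x) = x"
    using similarity_inverse[OF A] by metis
  define \<sigma> :: real where "\<sigma> = (-1) powi k"
  have \<sigma>: "\<sigma> = 1 \<or> \<sigma> = -1"
    unfolding \<sigma>_def by (cases "even k") simp_all
  \<comment> \<open>The point with coordinates \<open>B x $ i - \<rho> / l\<close> is the lower
    corner of the box around the pulled-back ball; division by \<open>c\<close> normalises the
    lattice cubes to side 1.\<close>
  have "\<exists>a m. a \<in> {0, 1, 2} \<and> m \<in> \<int> \<and> m + \<sigma> * (a / 3) \<le> (B x $ i - \<rho> / l) / c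
      \<and> (B x $ i - \<rho> / l) / c + 1 / 3 < m + \<sigma> * (a / 3) + 1" for i
    using one_third_shift[OF \<sigma>] by metis
  then obtain a m where am: "\<And>i. a i \<in> {0, 1, 2}" "\<And>i. m i \<in> \<int>"
      "\<And>i. m i + \<sigma> * (a i / 3) \<le> (B x $ i - \<rho> / l) / c"
      "\<And>i. (B x $ i - \<rho> / l) / c + 1 / 3 < m i + \<sigma> * (a i / 3) + 1"
    by metis
  define w where "w = (\<chi> i. m i) + \<sigma> *\<^sub>R ((1/3) *\<^sub>R (\<chi> i. a i))"
  define Q where "Q = A ` ((\<lambda>x. c *\<^sub>R (x + w)) ` unit_cube)"
  have "Q \<in> third_translate A (\<chi> i. a i)"
    unfolding third_translate_def Q_def w_def c_def \<sigma>_def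
    by (intro CollectI exI[of _ k] exI[of _ "\<chi> i. m i"]) (simp add: am add.assoc)
  moreover have "third_translate A (\<chi> i. a i) \<in> third_translates A"
    unfolding third_translates_def using am(1) by (intro CollectI exI[of _ "\<chi> i. a i"]) auto
  moreover have "is_cube Q (l * c)"
    unfolding is_cube_def Q_def image_image using similarity_scale_translate[OF A c] by blast
  moreover have "ball x \<rho> \<subseteq> Q"
  proof
    fix y assume y: "y \<in> ball x \<rho>"
    have "dist (A (B x)) (A (B y)) < \<rho>"
      using y by (simp add: B)
    then have d: "dist (B x) (B y) < \<rho> / l"
      using l by (simp add: similarity_dist[OF A] field_simps)
    define z where "z = (1 / c) *\<^sub>R B y - w"
    have "z \<in> unit_cube"
      unfolding unit_cube_def mem_Collect_eq
    proof
      fix i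
      have "\<bar>B y $ i - B x $ i\<bar> < \<rho> / l"
        using component_le_norm_cart[of "B y - B x" i] d by (simp add: dist_norm norm_minus_commute)
      then have "B y $ i \<le> (B x $ i - \<rho> / l) + 2 * (\<rho> / l)" "B x $ i - \<rho> / l \<le> B y $ i"
        by linarith+
      then have "B y $ i / c \<le> ((B x $ i - \<rho> / l) + 2 * (\<rho> / l)) / c" "(B x $ i - \<rho> / l) / c \<le> B y $ i / c"
        using c by (simp_all only: divide_right_mono less_imp_le)
      then have 1: "(B x $ i - \<rho> / l) / c \<le> B y $ i / c" "B y $ i / c \<le> (B x $ i - \<rho> / l) / c + 2 * (\<rho> / l) / c"
        by (simp_all only: add_divide_distrib)
      have "2 * (\<rho> / l) / c \<le> 1 / 3"
        using c6(1) l c by (simp add: field_simps)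
      with 1 am(3,4)[of i] show "0 \<le> z $ i \<and> z $ i < 1"
        unfolding z_def w_def by simp
    qed
    moreover have "y = A (c *\<^sub>R (z + w))"
      using c by (simp add: z_def B)
    ultimately show "y \<in> Q" unfolding Q_def by blast
  qed
  ultimately show ?thesis
    using c6(2) by (intro that) auto
qed

section \<open>The potential of a characteristic function\<close>

lemma epowr_ennreal: "0 \<le> x \<Longrightarrow> epowr (ennreal x) p = ennreal (x powr p)"
  by (simp add: epowr_def)

lemma epowr_top [simp]: "epowr \<infinity> p = \<infinity>" "epowr top p = top"
  by (simp_all add: epowr_def)

lemma epowr_0 [simp]: "epowr 0 p = 0"
  by (simp add: epowr_def)

lemma epowr_1 [simp]: "epowr 1 p = 1"
  by (simp add: epowr_def)

lemma epowr_one [simp]: "epowr x 1 = x"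
  by (cases x) (simp_all add: epowr_ennreal epowr_def)

lemma epowr_mono: "x \<le> y \<Longrightarrow> 0 \<le> p \<Longrightarrow> epowr x p \<le> epowr y p"
  by (cases x; cases y) (auto simp: epowr_def powr_mono2 top_unique)

lemma epowr_epowr: "epowr (epowr x p) r = epowr x (p * r)"
  by (cases x) (auto simp: epowr_def powr_powr)

lemma epowr_mult: "0 < p \<Longrightarrow> epowr (x * y) p = epowr x p * epowr y p"
  by (cases x; cases y)
     (auto simp: epowr_def ennreal_mult[symmetric] powr_mult ennreal_mult_top ennreal_top_mult
        ennreal_mult_eq_top_iff ennreal_eq_0_iff enn2real_mult)

text \<open>The powers with exponents \<open>p\<close> and \<open>1 / p\<close> are mutually inverse
  order isomorphisms of \<open>[0,\<infinity>]\<close>.\<close>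

lemma epowr_le_iff: "0 < p \<Longrightarrow> epowr x p \<le> y \<longleftrightarrow> x \<le> epowr y (1 / p)"
  using epowr_mono[of "epowr x p" y "1 / p"] epowr_mono[of x "epowr y (1 / p)" p]
  by (auto simp: epowr_epowr)

lemma epowr_eq_top_iff [simp]: "epowr x p = top \<longleftrightarrow> x = top"
  by (auto simp: epowr_def)

lemma epowr_max: "0 \<le> p \<Longrightarrow> epowr (max x y) p = max (epowr x p) (epowr y p)"
  by (metis epowr_mono max.absorb1 max.absorb2 linorder_le_cases)

text \<open>The sum is at most twice the larger term. This argument covers all positive exponents,
  so the bound serves for \<open>p\<close> as well as for \<open>1 / p\<close>.\<close>

lemma epowr_add_le:
  assumes "0 < p"
  shows "epowr (x + y) p \<le> ennreal (2 powr p) * (epowr x p + epowr y p)"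
proof -
  have "x + y \<le> 2 * max x y"
    by (metis add_mono max.cobounded1 max.cobounded2 mult_2)
  then have "epowr (x + y) p \<le> epowr (2 * max x y) p"
    using assms by (intro epowr_mono) auto
  also have "\<dots> = ennreal (2 powr p) * max (epowr x p) (epowr y p)"
    using assms epowr_ennreal[of 2 p] by (simp add: epowr_mult epowr_max)
  also have "\<dots> \<le> ennreal (2 powr p) * (epowr x p + epowr y p)"
    by (intro mult_left_mono) (auto simp: max_def)
  finally show ?thesis .
qed

lemma borel_measurable_epowr [measurable]: "(\<lambda>x. epowr x p) \<in> borel_measurable borel"
  unfolding epowr_def by measurable

lemma ex_dyadic_floor:
  fixes x :: real
  assumes "x > 0"
  obtains k :: int where "2 powr of_int k \<le> x" "x < 2 powr (of_int k + 1)"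
proof
  show "2 powr of_int \<lfloor>log 2 x\<rfloor> \<le> x"
    using assms by (simp flip: le_log_iff)
  show "x < 2 powr (of_int \<lfloor>log 2 x\<rfloor> + 1)"
    using assms by (simp flip: log_less_iff)
qed

text \<open>Here the lower inequality is the strict one, to match the level sets on which a function
  strictly exceeds a power of 2.\<close>

lemma ex_dyadic_ceiling:
  fixes x :: real
  assumes "x > 0"
  obtains k :: int where "2 powr of_int k < x" "x \<le> 2 powr (of_int k + 1)"
proof
  show "2 powr of_int (\<lceil>log 2 x\<rceil> - 1) < x"
    using assms by (simp flip: less_log_iff) linarith
  show "x \<le> 2 powr (of_int (\<lceil>log 2 x\<rceil> - 1) + 1)"
    using assms by (simp flip: log_le_iff)
qed

lemma suminf_ennreal_geometric:
  assumes "0 \<le> c" "0 \<le> r" "r < 1"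
  shows "(\<Sum>j. ennreal (c * r ^ j)) = ennreal (c / (1 - r))"
proof (rule suminf_ennreal_eq)
  show "(\<lambda>j. c * r ^ j) sums (c / (1 - r))"
    using sums_mult[OF geometric_sums[of r], of c] assms by simp
qed (use assms in auto)

lemma ennreal_le_suminf: "f i \<le> (\<Sum>j. f j :: ennreal)"
  using sum_le_suminf[of f "{i}"] by simp

text \<open>At \<open>y = x\<close> the kernel has the junk value \<open>1 / 0 = 0\<close>.\<close>

definition kernel :: "real \<Rightarrow> real \<Rightarrow> 'a::euclidean_space \<Rightarrow> 'a \<Rightarrow> ennreal" where
  "kernel d \<alpha> x y = ennreal (1 / norm (x - y) powr (d - \<alpha>))"

text \<open>An integral with values in \<open>[0,\<infinity>]\<close>, free of integrability
  conditions. It dominates the modulus of the Riesz potential, and its finiteness amounts to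
  absolute convergence.\<close>

definition nn_potential ::
    "real \<Rightarrow> real \<Rightarrow> 'a::euclidean_space measure \<Rightarrow> ('a \<Rightarrow> ennreal) \<Rightarrow> 'a \<Rightarrow> ennreal" where
  "nn_potential d \<alpha> M u x = (\<integral>\<^sup>+ y. kernel d \<alpha> x y * u y \<partial>M)"

lemma borel_measurable_kernel [measurable]: "kernel d \<alpha> x \<in> borel_measurable borel"
  unfolding kernel_def by measurable

section \<open>Dyadic decomposition of the kernel\<close>

text \<open>On the annulus where \<open>norm (x - y)\<close> lies between
  \<open>v * 2 powr k\<close> and twice that, the kernel is at most its value at the inner radius.
  The first sum collects the negative \<open>k\<close>, the second the others; the splitting radius
  \<open>v\<close> stays free.\<close>

lemma kernel_le_dyadic:
  assumes "v > 0" "\<alpha> < d"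
  shows "kernel d \<alpha> x y \<le>
    (\<Sum>j. ennreal ((v * 2 powr (- real j - 1)) powr (\<alpha> - d)) * indicator (ball x (v * 2 powr (- real j))) y)
    + (\<Sum>j. ennreal ((v * 2 powr real j) powr (\<alpha> - d)) * indicator (ball x (v * 2 powr (real j + 1))) y)"
    (is "_ \<le> (\<Sum>j. ?a j) + (\<Sum>j. ?b j)")
proof (cases "x = y")
  case False
  define s where "s = norm (x - y) / v"
  have s: "s > 0" "norm (x - y) = v * s"
    using False assms by (auto simp: s_def)
  obtain k :: int where k: "2 powr of_int k \<le> s" "s < 2 powr (of_int k + 1)"
    using ex_dyadic_floor[OF s(1)] .
  have "kernel d \<alpha> x y \<le> ennreal ((v * 2 powr of_int k) powr (\<alpha> - d)) * indicator (ball x (v * 2 powr (of_int k + 1))) y"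
  proof -
    have "norm (x - y) powr (\<alpha> - d) \<le> (v * 2 powr of_int k) powr (\<alpha> - d)"
      unfolding s(2) using assms k(1) by (intro powr_mono2') auto
    moreover have "1 / norm (x - y) powr (d - \<alpha>) = norm (x - y) powr (\<alpha> - d)"
      using powr_minus_divide[of "norm (x - y)" "d - \<alpha>"] by simp
    moreover have "y \<in> ball x (v * 2 powr (of_int k + 1))"
      using k(2) assms s by (simp add: dist_norm)
    ultimately show ?thesis
      by (simp add: kernel_def)
  qed
  also have "\<dots> \<le> (\<Sum>j. ?a j) + (\<Sum>j. ?b j)"
  proof (cases "k \<ge> 0")
    case True
    then have "ennreal ((v * 2 powr of_int k) powr (\<alpha> - d)) * indicator (ball x (v * 2 powr (of_int k + 1))) y = ?b (nat k)"
      by simp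
    also have "\<dots> \<le> (\<Sum>j. ?b j)"
      by (rule ennreal_le_suminf)
    finally show ?thesis
      by (simp add: add_increasing)
  next
    case False
    \<comment> \<open>Index shift: the term \<open>j\<close> of the first sum belongs to
      \<open>k = - j - 1\<close>.\<close>
    then have "- real (nat (- k - 1)) - 1 = of_int k"
      by simp
    then have "ennreal ((v * 2 powr of_int k) powr (\<alpha> - d)) * indicator (ball x (v * 2 powr (of_int k + 1))) y = ?a (nat (- k - 1))"
      by (simp add: algebra_simps)
    also have "\<dots> \<le> (\<Sum>j. ?a j)"
      by (rule ennreal_le_suminf)
    finally show ?thesis
      by (simp add: add_increasing2)
  qed
  finally show ?thesis .
qed (simp add: kernel_def)

lemma nn_integral_le_suminf_emeasure:
  fixes a b :: "nat \<Rightarrow> ennreal"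
  assumes [measurable]: "\<And>j. B j \<in> sets M" "\<And>j. C j \<in> sets M" "E \<in> sets M"
    and "\<And>y. u y \<le> (\<Sum>j. a j * indicator (B j) y) + (\<Sum>j. b j * indicator (C j) y)"
  shows "(\<integral>\<^sup>+ y. u y * indicator E y \<partial>M) \<le> (\<Sum>j. a j * emeasure M (E \<inter> B j)) + (\<Sum>j. b j * emeasure M (E \<inter> C j))"
proof -
  have "(\<integral>\<^sup>+ y. u y * indicator E y \<partial>M)
      \<le> (\<integral>\<^sup>+ y. (\<Sum>j. a j * indicator (E \<inter> B j) y) + (\<Sum>j. b j * indicator (E \<inter> C j) y) \<partial>M)"
    using assms(4) by (intro nn_integral_mono) (auto simp: indicator_inter_arith split: split_indicator)
  also have "\<dots> = (\<Sum>j. a j * emeasure M (E \<inter> B j)) + (\<Sum>j. b j * emeasure M (E \<inter> C j))"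
    by (simp add: nn_integral_add nn_integral_suminf nn_integral_cmult_indicator)
  finally show ?thesis .
qed

text \<open>Insertion of the measure bounds \<open>K * \<rho> powr d\<close> and
  \<open>v powr \<gamma> * \<rho> powr (d - \<gamma>)\<close> into the two dyadic sums leaves
  geometric sequences, both with the factor \<open>v powr \<alpha>\<close>.\<close>

lemma powr_dyadic_products:
  fixes v :: real
  assumes "v > 0"
  shows "(v * 2 powr (- real j - 1)) powr (\<alpha> - d) * (K * (v * 2 powr (- real j)) powr d)
      = (2 powr (d - \<alpha>) * K * v powr \<alpha>) * (2 powr (- \<alpha>)) ^ j"
    and "(v * 2 powr real j) powr (\<alpha> - d) * (v powr \<gamma> * (v * 2 powr (real j + 1)) powr (d - \<gamma>))
      = (2 powr (d - \<gamma>) * v powr \<alpha>) * (2 powr (\<alpha> - \<gamma>)) ^ j"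
proof -
  have 1: "(2 powr c) ^ j = (2::real) powr (real j * c)" for c :: real
    by (simp add: powr_power mult.commute)
  have 2: "(v * 2 powr a) powr b = v powr b * 2 powr (a * b)" for a b
    using assms by (simp add: powr_mult powr_powr)
  have 3: "v powr (\<alpha> - d) * v powr d = v powr \<alpha>" "v powr (\<alpha> - d) * (v powr \<gamma> * v powr (d - \<gamma>)) = v powr \<alpha>"
    by (simp_all flip: powr_add)
  have 6: "2 powr ((- real j - 1) * (\<alpha> - d)) * 2 powr (- real j * d) = (2::real) powr (d - \<alpha>) * 2 powr (real j * - \<alpha>)"
    "2 powr (real j * (\<alpha> - d)) * 2 powr ((real j + 1) * (d - \<gamma>)) = (2::real) powr (d - \<gamma>) * 2 powr (real j * (\<alpha> - \<gamma>))"
    unfolding powr_add[symmetric] by (simp_all add: algebra_simps)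
  have ac: "x * y * (k * (z * w)) = k * (x * z) * (y * w)" "x * y * (k * (z * w)) = (x * (k * z)) * (y * w)" for x y z w k :: real
    by (simp_all only: mult_ac)
  show "(v * 2 powr (- real j - 1)) powr (\<alpha> - d) * (K * (v * 2 powr (- real j)) powr d)
      = (2 powr (d - \<alpha>) * K * v powr \<alpha>) * (2 powr (- \<alpha>)) ^ j"
    unfolding 1 2 ac(1) 3 6 by (simp only: mult_ac)
  show "(v * 2 powr real j) powr (\<alpha> - d) * (v powr \<gamma> * (v * 2 powr (real j + 1)) powr (d - \<gamma>))
      = (2 powr (d - \<gamma>) * v powr \<alpha>) * (2 powr (\<alpha> - \<gamma>)) ^ j"
    unfolding 1 2 ac(2) 3 6 by (simp only: mult_ac)
qed

text \<open>Hedberg's argument: the growth bound with \<open>K\<close> is used on balls up to the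
  radius \<open>v\<close>, the bound with \<open>V\<close> beyond it, and
  \<open>\<alpha> < \<gamma>\<close> lets the outer series converge. It is applied with
  \<open>\<gamma> = d\<close> and \<open>V\<close> the measure of \<open>E\<close>, and with another
  \<open>\<gamma>\<close> in \<open>strong_type_majorant\<close>.\<close>

lemma nn_potential_indicator_le:
  fixes M :: "'a::euclidean_space measure"
  assumes "0 < \<alpha>" "\<alpha> < d" "\<alpha> < \<gamma>" "0 < K" "sets M = sets borel" "E \<in> sets borel" "0 < V"
    and K: "\<And>\<rho>. \<rho> > 0 \<Longrightarrow> emeasure M (E \<inter> ball x \<rho>) \<le> ennreal (K * \<rho> powr d)"
    and V: "\<And>\<rho>. \<rho> > 0 \<Longrightarrow> emeasure M (E \<inter> ball x \<rho>) \<le> ennreal (V * \<rho> powr (d - \<gamma>))"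
  shows "nn_potential d \<alpha> M (indicator E) x
    \<le> ennreal ((2 powr (d - \<alpha>) * K / (1 - 2 powr (- \<alpha>)) + 2 powr (d - \<gamma>) / (1 - 2 powr (\<alpha> - \<gamma>))) * V powr (\<alpha> / \<gamma>))"
proof -
  note [measurable_cong] = assms(5)
  note [measurable] = assms(6)
  \<comment> \<open>This radius balances the two bounds,
    \<open>V * v powr (d - \<gamma>) = v powr d\<close>, and turns both sums into multiples of
    \<open>v powr \<alpha>\<close>.\<close>
  define v where "v = V powr (1 / \<gamma>)"
  have v: "v > 0" "v powr \<alpha> = V powr (\<alpha> / \<gamma>)" "V = v powr \<gamma>"
    using assms by (auto simp: v_def powr_powr)
  let ?a = "\<lambda>j. ennreal ((v * 2 powr (- real j - 1)) powr (\<alpha> - d))"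
  let ?b = "\<lambda>j. ennreal ((v * 2 powr real j) powr (\<alpha> - d))"
  have "nn_potential d \<alpha> M (indicator E) x
      \<le> (\<Sum>j. ?a j * emeasure M (E \<inter> ball x (v * 2 powr (- real j))))
        + (\<Sum>j. ?b j * emeasure M (E \<inter> ball x (v * 2 powr (real j + 1))))"
    unfolding nn_potential_def
    by (rule nn_integral_le_suminf_emeasure) (use v assms(2,5,6) in \<open>auto intro: kernel_le_dyadic\<close>)
  also have "\<dots> \<le> (\<Sum>j. ennreal ((2 powr (d - \<alpha>) * K * v powr \<alpha>) * (2 powr (- \<alpha>)) ^ j))
        + (\<Sum>j. ennreal ((2 powr (d - \<gamma>) * v powr \<alpha>) * (2 powr (\<alpha> - \<gamma>)) ^ j))"
  proof (intro add_mono suminf_le summableI)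
    fix j
    have "?a j * emeasure M (E \<inter> ball x (v * 2 powr (- real j))) \<le> ?a j * ennreal (K * (v * 2 powr (- real j)) powr d)"
      using v by (intro mult_left_mono K) auto
    also have "\<dots> = ennreal ((2 powr (d - \<alpha>) * K * v powr \<alpha>) * (2 powr (- \<alpha>)) ^ j)"
      by (subst ennreal_mult[symmetric]) (use v(1) assms in \<open>simp_all add: powr_dyadic_products(1)\<close>)
    finally show "?a j * emeasure M (E \<inter> ball x (v * 2 powr (- real j))) \<le> \<dots>" .
    have "?b j * emeasure M (E \<inter> ball x (v * 2 powr (real j + 1))) \<le> ?b j * ennreal (V * (v * 2 powr (real j + 1)) powr (d - \<gamma>))"
      using v by (intro mult_left_mono V) auto
    also have "\<dots> = ennreal ((2 powr (d - \<gamma>) * v powr \<alpha>) * (2 powr (\<alpha> - \<gamma>)) ^ j)"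
      unfolding v(3)
      by (subst ennreal_mult[symmetric]) (use v(1) in \<open>simp_all add: powr_dyadic_products(2)\<close>)
    finally show "?b j * emeasure M (E \<inter> ball x (v * 2 powr (real j + 1))) \<le> \<dots>" .
  qed
  also have "\<dots> = ennreal ((2 powr (d - \<alpha>) * K * v powr \<alpha>) / (1 - 2 powr (- \<alpha>)))
        + ennreal ((2 powr (d - \<gamma>) * v powr \<alpha>) / (1 - 2 powr (\<alpha> - \<gamma>)))"
  proof (intro arg_cong2[where f="(+)"] suminf_ennreal_geometric)
    show "2 powr (- \<alpha>) < (1::real)" "2 powr (\<alpha> - \<gamma>) < (1::real)"
      using assms powr_less_mono[of "-\<alpha>" 0 2] powr_less_mono[of "\<alpha> - \<gamma>" 0 2] by auto
  qed (use assms in auto)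
  also have "\<dots> = ennreal ((2 powr (d - \<alpha>) * K / (1 - 2 powr (- \<alpha>)) + 2 powr (d - \<gamma>) / (1 - 2 powr (\<alpha> - \<gamma>))) * V powr (\<alpha> / \<gamma>))"
    using assms powr_less_mono[of "-\<alpha>" 0 2] powr_less_mono[of "\<alpha> - \<gamma>" 0 2]
    by (simp add: v(2)[symmetric] algebra_simps flip: ennreal_plus)
  finally show ?thesis .
qed

section \<open>Growth of the two measures on balls\<close>

lemma le_mult_of_divide_le_ennreal:
  fixes a b c :: ennreal
  assumes "a / b \<le> c" "b \<noteq> 0" "b \<noteq> top"
  shows "a \<le> c * b"
proof -
  have "a = a / b * b"
    using assms by (simp add: ennreal_divide_times less_top)
  also have "\<dots> \<le> c * b"
    using assms by (intro mult_right_mono) auto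
  finally show ?thesis .
qed

lemma cube_growth:
  fixes M :: "(real ^ 'n) measure"
  assumes "(SUP (Q, s) \<in> {(Q, s). is_cube Q s}. emeasure M Q / ennreal (s powr d)) < \<infinity>"
  obtains K where "K > 0" "\<And>Q s. is_cube Q s \<Longrightarrow> emeasure M Q \<le> ennreal (K * s powr d)"
proof -
  define S where "S = (SUP (Q, s) \<in> {(Q, s). is_cube Q s}. emeasure M Q / ennreal (s powr d))"
  obtain S' where S': "S = ennreal S'" "S' \<ge> 0"
    using assms by (metis S_def ennreal_cases infinity_ennreal_def less_irrefl)
  \<comment> \<open>The summand 1 makes the constant positive even when the supremum is 0.\<close>
  have "emeasure M Q \<le> ennreal ((S' + 1) * s powr d)" if "is_cube Q s" for Q s
  proof -
    have "s > 0" using that by (auto simp: is_cube_def similarity_def)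
    have "emeasure M Q / ennreal (s powr d) \<le> S"
      unfolding S_def using that by (intro SUP_upper2[of "(Q, s)"]) auto
    then have "emeasure M Q \<le> S * ennreal (s powr d)"
      using \<open>s > 0\<close> by (intro le_mult_of_divide_le_ennreal) auto
    also have "\<dots> \<le> ennreal ((S' + 1) * s powr d)"
      using S' by (simp add: mult_right_mono flip: ennreal_mult)
    finally show ?thesis .
  qed
  with S'(2) show ?thesis
    by (intro that[of "S' + 1"]) auto
qed

lemma ball_growth:
  fixes M :: "(real ^ 'n) measure"
  assumes "sets M = sets borel" "K > 0" "0 < d" "\<And>Q s. is_cube Q s \<Longrightarrow> emeasure M Q \<le> ennreal (K * s powr d)"
    and "\<rho> > 0"
  shows "emeasure M (ball x \<rho>) \<le> ennreal (K * 2 powr d * \<rho> powr d)"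
proof -
  obtain Q where Q: "is_cube Q (2 * \<rho>)" "ball x \<rho> \<subseteq> Q"
    using ball_subset_axis_cube[OF \<open>\<rho> > 0\<close>] .
  have "emeasure M (ball x \<rho>) \<le> emeasure M Q"
    using Q sets_cube[OF Q(1)] assms(1) by (intro emeasure_mono) auto
  also have "\<dots> \<le> ennreal (K * (2 * \<rho>) powr d)"
    using assms(4)[OF Q(1)] .
  finally show ?thesis
    using \<open>\<rho> > 0\<close> by (simp add: powr_mult mult.assoc)
qed

text \<open>The ball lies in a lattice cube \<open>Q\<close> of side at most
  \<open>12 * \<rho>\<close>. The hypothesis compares \<open>N\<close> with \<open>M\<close> on
  \<open>Q\<close>, and the growth of \<open>M\<close> bounds the latter. Positive measure of the
  ball puts \<open>Q\<close> among the cubes of the supremum.\<close>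

lemma trace_ball_growth:
  fixes M N :: "(real ^ 'n) measure"
  assumes "sets M = sets borel" "sets N = sets borel" "K > 0" "0 < d" "0 < \<theta>"
    and K: "\<And>Q s. is_cube Q s \<Longrightarrow> emeasure M Q \<le> ennreal (K * s powr d)"
    and A: "similarity A l"
    and S: "(SUP Q \<in> {Q \<in> \<Union> (third_translates A). emeasure M Q > 0}.
            emeasure N Q / epowr (emeasure M Q) \<theta>) < \<infinity>"
  obtains K' where "K' > 0"
    "\<And>x \<rho>. \<rho> > 0 \<Longrightarrow> emeasure M (ball x \<rho>) > 0 \<Longrightarrow> emeasure N (ball x \<rho>) \<le> ennreal (K' * \<rho> powr (d * \<theta>))"
proof -
  define S where "S = (SUP Q \<in> {Q \<in> \<Union> (third_translates A). emeasure M Q > 0}.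
            emeasure N Q / epowr (emeasure M Q) \<theta>)"
  obtain S' where S': "S = ennreal S'" "S' \<ge> 0"
    using S by (metis S_def ennreal_cases infinity_ennreal_def less_irrefl)
  define K' where "K' = (S' + 1) * (K powr \<theta> * 12 powr (d * \<theta>))"
  have "emeasure N (ball x \<rho>) \<le> ennreal (K' * \<rho> powr (d * \<theta>))"
    if "\<rho> > 0" and pos: "emeasure M (ball x \<rho>) > 0" for x \<rho>
  proof -
    obtain Q s where Q: "Q \<in> \<Union> (third_translates A)" "is_cube Q s" "ball x \<rho> \<subseteq> Q" "s \<le> 12 * \<rho>"
      using ball_subset_third_translate[OF A \<open>\<rho> > 0\<close>] .
    have sets: "Q \<in> sets M" "Q \<in> sets N"
      using sets_cube[OF Q(2)] assms by auto
    have "s > 0" using Q(2) by (auto simp: is_cube_def similarity_def)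
    have "0 < emeasure M Q"
      using pos emeasure_mono[OF Q(3) sets(1)] by simp
    have "emeasure M Q \<le> ennreal (K * s powr d)"
      using K[OF Q(2)] .
    also have "\<dots> \<le> ennreal (K * (12 * \<rho>) powr d)"
      using \<open>s > 0\<close> Q(4) assms by (intro ennreal_leI mult_left_mono powr_mono2) auto
    finally have MQ: "emeasure M Q \<le> ennreal (K * (12 * \<rho>) powr d)" .
    then have "epowr (emeasure M Q) \<theta> \<le> epowr (ennreal (K * (12 * \<rho>) powr d)) \<theta>"
      using assms by (intro epowr_mono) auto
    also have "\<dots> = ennreal (K powr \<theta> * 12 powr (d * \<theta>) * \<rho> powr (d * \<theta>))"
      using assms \<open>\<rho> > 0\<close> by (simp add: epowr_ennreal powr_mult powr_powr mult.assoc)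
    finally have e: "epowr (emeasure M Q) \<theta> \<le> ennreal (K powr \<theta> * 12 powr (d * \<theta>) * \<rho> powr (d * \<theta>))" .
    have "emeasure N (ball x \<rho>) \<le> emeasure N Q"
      using Q sets by (intro emeasure_mono) auto
    also have "\<dots> \<le> S * epowr (emeasure M Q) \<theta>"
    proof (intro le_mult_of_divide_le_ennreal)
      show "emeasure N Q / epowr (emeasure M Q) \<theta> \<le> S"
        unfolding S_def using Q(1) \<open>0 < emeasure M Q\<close> by (intro SUP_upper2[of Q]) auto
      have "epowr (emeasure M Q) \<theta> \<le> 0 \<longleftrightarrow> emeasure M Q \<le> 0"
        using assms by (subst epowr_le_iff) auto
      then show "epowr (emeasure M Q) \<theta> \<noteq> 0"
        using \<open>0 < emeasure M Q\<close> by simp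
      show "epowr (emeasure M Q) \<theta> \<noteq> top"
        using MQ by (auto simp: top_unique)
    qed
    also have "\<dots> \<le> ennreal (S' + 1) * ennreal (K powr \<theta> * 12 powr (d * \<theta>) * \<rho> powr (d * \<theta>))"
      using S' e by (intro mult_mono) auto
    also have "\<dots> = ennreal (K' * \<rho> powr (d * \<theta>))"
      using S' assms unfolding K'_def by (subst ennreal_mult[symmetric]) (auto simp: mult.assoc)
    finally show ?thesis .
  qed
  moreover have "K' > 0"
    using S' assms by (simp add: K'_def)
  ultimately show ?thesis
    by (intro that) auto
qed

section \<open>Vitali selection and the strong type estimate\<close>

text \<open>Sums over the selected balls are integrals against a counting measure. It is
  sigma-finite because the index set is countable, so measurability of parametrised integrals
  applies.\<close>

lemma borel_measurable_nn_integral_count_space: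
  assumes "countable I" "\<And>i. i \<in> I \<Longrightarrow> f i \<in> borel_measurable M"
  shows "(\<lambda>x. \<integral>\<^sup>+ i. f i x \<partial>count_space I) \<in> borel_measurable M"
proof -
  interpret sigma_finite_measure "count_space I"
    by (rule sigma_finite_measure_count_space_countable) fact
  have "(\<lambda>(i, x). f i x) \<in> borel_measurable (count_space I \<Otimes>\<^sub>M M)"
    using assms by (intro measurable_pair_measure_countable1) auto
  then have "(\<lambda>(x, i). f i x) \<in> borel_measurable (M \<Otimes>\<^sub>M count_space I)"
    using measurable_pair_swap[of "\<lambda>(i, x). f i x" "count_space I" M borel] by (simp add: case_prod_unfold)
  then show ?thesis
    by (rule borel_measurable_nn_integral)
qed

text \<open>Indexing the balls by pairs of centre and radius lets one centre carry many radii, as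
  happens for the balls of large density.\<close>

lemma Vitali_covering_pairs:
  fixes S :: "('a::euclidean_space \<times> real) set"
  assumes "\<forall>i\<in>S. 0 < snd i \<and> snd i \<le> B"
  shows "\<exists>C. countable C \<and> C \<subseteq> S \<and> pairwise (\<lambda>i j. disjnt (cball (fst i) (snd i)) (cball (fst j) (snd j))) C \<and>
     (\<forall>i\<in>S. \<exists>j\<in>C. cball (fst i) (snd i) \<subseteq> ball (fst j) (5 * snd j))"
proof -
  show ?thesis
  proof (rule Vitali_covering_lemma_cballs_balls[of S snd B fst])
    fix i assume "i \<in> S" then show "0 < snd i \<and> snd i \<le> B" using assms by blast
  next
    fix C
    assume a: "countable C" "C \<subseteq> S"
      "pairwise (\<lambda>i j. disjnt (cball (fst i) (snd i)) (cball (fst j) (snd j))) C"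
    assume b: "\<And>i. i \<in> S \<Longrightarrow> \<exists>j. j \<in> C \<and> \<not> disjnt (cball (fst i) (snd i)) (cball (fst j) (snd j)) \<and>
        cball (fst i) (snd i) \<subseteq> ball (fst j) (5 * snd j)"
    then have "\<forall>i\<in>S. \<exists>j\<in>C. cball (fst i) (snd i) \<subseteq> ball (fst j) (5 * snd j)"
      by fast
    with a show ?thesis
      by (intro exI[of _ C] conjI)
  qed
qed

lemma borel_measurable_cmult_indicator_ball:
  fixes c :: ennreal and a :: "'a::euclidean_space"
  assumes "sets M = sets borel"
  shows "(\<lambda>x. c * indicator (ball a r) x) \<in> borel_measurable M"
  unfolding measurable_cong_sets[OF assms refl]
  by (intro borel_measurable_times_ennreal borel_measurable_const borel_measurable_indicator) simp

text \<open>\<open>g\<close> is the sum of \<open>(5 * r) powr \<beta>\<close> over the fivefold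
  enlargements of disjoint balls of density above \<open>t\<close>. The growth of \<open>N\<close>
  bounds each integral by a multiple of \<open>r powr d\<close>, the density bounds this by the mass
  of \<open>E\<close> in the small ball, and by disjointness these masses add up to at most that of
  \<open>E\<close>.\<close>

lemma density_level_majorant:
  fixes M N :: "'a::euclidean_space measure"
  assumes "sets M = sets borel" "sets N = sets borel" "0 < \<beta>" "0 < d" "K > 0" "t > 0"
    and N: "\<And>x \<rho>. \<rho> > 0 \<Longrightarrow> emeasure M (ball x \<rho>) > 0 \<Longrightarrow> emeasure N (ball x \<rho>) \<le> ennreal (K * \<rho> powr (d - \<beta>))"
    and E: "E \<in> sets borel" "emeasure M E < \<infinity>"
  obtains g where "g \<in> borel_measurable borel" "(\<integral>\<^sup>+ x. g x \<partial>N) \<le> ennreal (K * 5 powr d / t) * emeasure M E"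
    "\<And>x \<rho>. \<rho> > 0 \<Longrightarrow> ennreal (t * \<rho> powr d) < emeasure M (E \<inter> ball x \<rho>) \<Longrightarrow> ennreal (\<rho> powr \<beta>) \<le> g x"
proof -
  define S where "S = {(x, \<rho>). \<rho> > 0 \<and> ennreal (t * \<rho> powr d) < emeasure M (E \<inter> ball x \<rho>)}"
  obtain e where e: "emeasure M E = ennreal e" "e \<ge> 0"
    using E(2) by (metis ennreal_cases infinity_ennreal_def less_irrefl)
  \<comment> \<open>Vitali's lemma asks for bounded radii; a density above \<open>t\<close> forces
    \<open>t * \<rho> powr d\<close> below the finite measure of \<open>E\<close>.\<close>
  have S: "\<forall>i\<in>S. 0 < snd i \<and> snd i \<le> (e / t) powr (1 / d)"
  proof
    fix i assume "i \<in> S"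
    then have r: "snd i > 0" "ennreal (t * snd i powr d) < emeasure M (E \<inter> ball (fst i) (snd i))"
      by (auto simp: S_def)
    note r(2)
    also have "emeasure M (E \<inter> ball (fst i) (snd i)) \<le> ennreal e"
      unfolding e(1)[symmetric] using E assms(1) by (intro emeasure_mono) auto
    finally have "snd i powr d \<le> e / t"
      using \<open>t > 0\<close> e(2) by (simp add: field_simps ennreal_less_iff)
    then have "(snd i powr d) powr (1 / d) \<le> (e / t) powr (1 / d)"
      using assms by (intro powr_mono2) auto
    then show "0 < snd i \<and> snd i \<le> (e / t) powr (1 / d)"
      using r(1) assms by (simp add: powr_powr)
  qed
  obtain C where C: "countable C" "C \<subseteq> S"
     "pairwise (\<lambda>i j. disjnt (cball (fst i) (snd i)) (cball (fst j) (snd j))) C"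
     "\<forall>i\<in>S. \<exists>j\<in>C. cball (fst i) (snd i) \<subseteq> ball (fst j) (5 * snd j)"
    using Vitali_covering_pairs[OF S] by (elim exE conjE) (rule that)
  define g where "g x = (\<integral>\<^sup>+ j. ennreal ((5 * snd j) powr \<beta>) * indicator (ball (fst j) (5 * snd j)) x \<partial>count_space C)" for x
  show ?thesis
  proof (rule that[of g])
    show "g \<in> borel_measurable borel"
      unfolding g_def using C(1) by (rule borel_measurable_nn_integral_count_space)
        (rule borel_measurable_cmult_indicator_ball[OF refl])
    have "(\<integral>\<^sup>+ x. g x \<partial>N) = (\<integral>\<^sup>+ j. \<integral>\<^sup>+ x. ennreal ((5 * snd j) powr \<beta>) * indicator (ball (fst j) (5 * snd j)) x \<partial>N \<partial>count_space C)"
      unfolding g_def using C(1) by (rule nn_integral_count_space_nn_integral)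
        (rule borel_measurable_cmult_indicator_ball[OF assms(2)])
    also have "\<dots> \<le> (\<integral>\<^sup>+ j. ennreal (K * 5 powr d / t) * emeasure M (E \<inter> ball (fst j) (snd j)) \<partial>count_space C)"
    proof (intro nn_integral_mono)
      fix j assume "j \<in> space (count_space C)"
      then have "j \<in> S" using C(2) by auto
      then have j: "snd j > 0" "ennreal (t * snd j powr d) \<le> emeasure M (E \<inter> ball (fst j) (snd j))"
        by (auto simp: S_def)
      \<comment> \<open>The growth of \<open>N\<close> is at hand only on balls charged by
        \<open>M\<close>; the enlarged ball contains mass of \<open>E\<close>.\<close>
      have "0 < emeasure M (ball (fst j) (5 * snd j))"
      proof -
        have "0 < ennreal (t * snd j powr d)" using j \<open>t > 0\<close> by simp
        also note j(2)
        also have "emeasure M (E \<inter> ball (fst j) (snd j)) \<le> emeasure M (ball (fst j) (5 * snd j))"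
          using assms(1) j by (intro emeasure_mono) auto
        finally show ?thesis .
      qed
      then have "emeasure N (ball (fst j) (5 * snd j)) \<le> ennreal (K * (5 * snd j) powr (d - \<beta>))"
        using j by (intro N) auto
      have "(\<integral>\<^sup>+ x. ennreal ((5 * snd j) powr \<beta>) * indicator (ball (fst j) (5 * snd j)) x \<partial>N)
          = ennreal ((5 * snd j) powr \<beta>) * emeasure N (ball (fst j) (5 * snd j))"
        using assms(2) by (intro nn_integral_cmult_indicator) auto
      also have "\<dots> \<le> ennreal ((5 * snd j) powr \<beta>) * ennreal (K * (5 * snd j) powr (d - \<beta>))"
        by (intro mult_left_mono) (fact, simp)
      also have "\<dots> = ennreal (K * (5 * snd j) powr (\<beta> + (d - \<beta>)))"
        unfolding powr_add using assms by (subst ennreal_mult[symmetric]) (auto simp: mult_ac)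
      also have "\<dots> = ennreal (K * 5 powr d / t) * ennreal (t * snd j powr d)"
        using assms j by (subst ennreal_mult[symmetric]) (auto simp: powr_mult)
      also have "\<dots> \<le> ennreal (K * 5 powr d / t) * emeasure M (E \<inter> ball (fst j) (snd j))"
        using j by (intro mult_left_mono) auto
      finally show "(\<integral>\<^sup>+ x. ennreal ((5 * snd j) powr \<beta>) * indicator (ball (fst j) (5 * snd j)) x \<partial>N) \<le> \<dots>" .
    qed
    also have "\<dots> = ennreal (K * 5 powr d / t) * (\<integral>\<^sup>+ j. emeasure M (E \<inter> ball (fst j) (snd j)) \<partial>count_space C)"
      by (rule nn_integral_cmult) auto
    also have "(\<integral>\<^sup>+ j. emeasure M (E \<inter> ball (fst j) (snd j)) \<partial>count_space C) = emeasure M (\<Union>j\<in>C. E \<inter> ball (fst j) (snd j))"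
    proof (rule emeasure_UN_countable[symmetric])
      show "disjoint_family_on (\<lambda>j. E \<inter> ball (fst j) (snd j)) C"
        using C(3) ball_subset_cball unfolding disjoint_family_on_def pairwise_def disjnt_def by blast
    qed (use C(1) E assms(1) in auto)
    also have "\<dots> \<le> emeasure M E"
      using E assms(1) by (intro emeasure_mono) auto
    finally show "(\<integral>\<^sup>+ x. g x \<partial>N) \<le> ennreal (K * 5 powr d / t) * emeasure M E"
      by (simp add: mult_left_mono)
  next
    fix x \<rho> assume \<rho>: "\<rho> > 0" "ennreal (t * \<rho> powr d) < emeasure M (E \<inter> ball x \<rho>)"
    then have "(x, \<rho>) \<in> S" by (simp add: S_def)
    with C(4) obtain j where j: "j \<in> C" "cball x \<rho> \<subseteq> ball (fst j) (5 * snd j)"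
      by force
    \<comment> \<open>This gives both that \<open>x\<close> lies in the enlarged ball and that
      \<open>\<rho>\<close> is at most the enlarged radius.\<close>
    then have "dist x (fst j) + \<rho> < 5 * snd j"
      using \<rho>(1) by (simp add: cball_subset_ball_iff)
    then have "x \<in> ball (fst j) (5 * snd j)" "\<rho> \<le> 5 * snd j"
      using \<rho>(1) zero_le_dist[of x "fst j"] unfolding mem_ball dist_commute[of x] by linarith+
    then have "ennreal (\<rho> powr \<beta>) \<le> ennreal ((5 * snd j) powr \<beta>) * indicator (ball (fst j) (5 * snd j)) x"
      using \<rho>(1) assms(3) by (simp add: powr_mono2)
    also have "\<dots> \<le> g x"
      unfolding g_def using nn_integral_ge_point[OF j(1), of "\<lambda>j. ennreal ((5 * snd j) powr \<beta>) * indicator (ball (fst j) (5 * snd j)) x"] .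
    finally show "ennreal (\<rho> powr \<beta>) \<le> g x" .
  qed
qed

lemma nn_potential_indicator_null:
  fixes M :: "'a::euclidean_space measure"
  assumes "sets M = sets borel" "E \<in> sets borel" "\<And>\<rho>. \<rho> > 0 \<Longrightarrow> emeasure M (E \<inter> ball x \<rho>) = 0"
  shows "nn_potential d \<alpha> M (indicator E) x = 0"
proof -
  have "E \<inter> ball x (real (Suc n)) \<in> null_sets M" for n
    using assms by (intro null_setsI) auto
  then have "(\<Union>n. E \<inter> ball x (real (Suc n))) \<in> null_sets M"
    by (rule null_sets_UN)
  moreover have "(\<Union>n. E \<inter> ball x (real (Suc n))) = E"
  proof -
    have "\<exists>n. y \<in> ball x (real (Suc n))" for y
    proof -
      obtain n where "dist x y < real n" using reals_Archimedean2 by blast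
      then show ?thesis by (intro exI[of _ n]) simp
    qed
    then show ?thesis by auto
  qed
  ultimately have "AE y in M. y \<notin> E"
    using AE_not_in by metis
  then have "nn_potential d \<alpha> M (indicator E) x = (\<integral>\<^sup>+ y. 0 \<partial>M)"
    unfolding nn_potential_def by (intro nn_integral_cong_AE) auto
  then show ?thesis by simp
qed

text \<open>A Borel function \<open>G\<close> above the p-th power of the potential is built from
  the functions of \<open>density_level_majorant\<close> at dyadic densities. Where \<open>G\<close>
  is small, all balls around the point carry little of \<open>E\<close>, and
  \<open>nn_potential_indicator_le\<close> bounds the potential.\<close>

lemma strong_type_majorant:
  fixes M N :: "'a::euclidean_space measure"
  assumes "sets M = sets borel" "sets N = sets borel" "0 < \<alpha>" "\<alpha> < d" "1 < p" "0 < K" "0 < K'"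
    and M: "\<And>x \<rho>. \<rho> > 0 \<Longrightarrow> emeasure M (ball x \<rho>) \<le> ennreal (K * \<rho> powr d)"
    and N: "\<And>x \<rho>. \<rho> > 0 \<Longrightarrow> emeasure M (ball x \<rho>) > 0 \<Longrightarrow> emeasure N (ball x \<rho>) \<le> ennreal (K' * \<rho> powr (d - \<alpha> * p))"
  obtains C where "C > 0" "\<And>E. E \<in> sets borel \<Longrightarrow> emeasure M E < \<infinity> \<Longrightarrow>
    \<exists>G\<in>borel_measurable borel. (\<forall>x. nn_potential d \<alpha> M (indicator E) x \<le> epowr (G x) (1 / p)) \<and>
      (\<integral>\<^sup>+ x. G x \<partial>N) \<le> ennreal C * emeasure M E"
proof -
  \<comment> \<open>Any value strictly between 1 and \<open>p\<close> would do:
    \<open>1 < \<theta>\<close> sums the density levels, \<open>\<theta> < p\<close> gives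
    \<open>\<alpha> < \<gamma>\<close>.\<close>
  define \<theta> where "\<theta> = (1 + p) / 2"
  have \<theta>: "1 < \<theta>" "\<theta> < p" using \<open>1 < p\<close> by (auto simp: \<theta>_def)
  \<comment> \<open>With this exponent
    \<open>\<delta> powr \<theta> * \<rho> powr (\<alpha> * p) \<le> h\<close> says that
    \<open>\<delta> * \<rho> powr \<gamma> \<le> h powr (1 / \<theta>)\<close>, a bound of the form
    asked by \<open>nn_potential_indicator_le\<close>.\<close>
  define \<gamma> where "\<gamma> = \<alpha> * p / \<theta>"
  have \<gamma>: "\<alpha> < \<gamma>" "\<alpha> / \<gamma> = \<theta> / p" "\<gamma> * \<theta> = \<alpha> * p"
    using \<theta> assms by (auto simp: \<gamma>_def field_simps)
  have \<alpha>p: "0 < \<alpha> * p" and "0 < d" using assms by auto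
  define B where "B = 2 powr (d - \<alpha>) * K / (1 - 2 powr (- \<alpha>)) + 2 powr (d - \<gamma>) / (1 - 2 powr (\<alpha> - \<gamma>))"
  have "2 powr (- \<alpha>) < (1::real)" "2 powr (\<alpha> - \<gamma>) < (1::real)"
    using assms \<gamma> powr_less_mono[of "-\<alpha>" 0 2] powr_less_mono[of "\<alpha> - \<gamma>" 0 2] by auto
  then have B: "B > 0"
    unfolding B_def using assms by (intro add_pos_pos divide_pos_pos mult_pos_pos) auto
  \<comment> \<open>Level \<open>i\<close> consists of the densities above \<open>s i\<close> and at
    most \<open>K / 2 ^ i\<close>; the weight \<open>w i\<close> is the \<theta>-th power of the
    upper end.\<close>
  define w where "w i = (K / 2 ^ i) powr \<theta>" for i :: nat
  define s where "s i = K / 2 ^ Suc i" for i :: nat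
  define C0 where "C0 = K' * 5 powr d * 2 * K powr (\<theta> - 1) / (1 - 2 powr (1 - \<theta>))"
  have \<theta>1: "2 powr (1 - \<theta>) < (1::real)"
    using \<theta> powr_less_mono[of "1 - \<theta>" 0 2] by auto
  have C0: "C0 > 0"
    unfolding C0_def using assms \<theta>1 by (intro divide_pos_pos mult_pos_pos) auto
  show ?thesis
  proof (rule that)
    show "B powr p * C0 > 0" using B C0 by simp
  next
    fix E :: "'a set" assume E: "E \<in> sets borel" "emeasure M E < \<infinity>"
    have s: "s i > 0" for i using assms by (simp add: s_def)
    have "\<exists>g. g \<in> borel_measurable borel \<and> (\<integral>\<^sup>+ x. g x \<partial>N) \<le> ennreal (K' * 5 powr d / s i) * emeasure M E \<and>
      (\<forall>x \<rho>. \<rho> > 0 \<longrightarrow> ennreal (s i * \<rho> powr d) < emeasure M (E \<inter> ball x \<rho>) \<longrightarrow> ennreal (\<rho> powr (\<alpha> * p)) \<le> g x)" for i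
      by (rule density_level_majorant[OF assms(1,2) \<alpha>p \<open>0 < d\<close> \<open>0 < K'\<close> s N E, of i]) (assumption, assumption, blast)
    then obtain g where g [measurable]: "\<And>i. g i \<in> borel_measurable borel"
      and int_g: "\<And>i. (\<integral>\<^sup>+ x. g i x \<partial>N) \<le> ennreal (K' * 5 powr d / s i) * emeasure M E"
      and g_ge: "\<And>i x \<rho>. \<rho> > 0 \<Longrightarrow> ennreal (s i * \<rho> powr d) < emeasure M (E \<inter> ball x \<rho>) \<Longrightarrow> ennreal (\<rho> powr (\<alpha> * p)) \<le> g i x"
      by metis
    define H where "H x = (\<Sum>i. ennreal (w i) * g i x)" for x
    have H [measurable]: "H \<in> borel_measurable borel" unfolding H_def by measurable
    have "(\<integral>\<^sup>+ x. H x \<partial>N) = (\<Sum>i. ennreal (w i) * (\<integral>\<^sup>+ x. g i x \<partial>N))"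
      unfolding H_def using g assms(2) by (simp add: nn_integral_suminf nn_integral_cmult cong: measurable_cong_sets)
    also have "\<dots> \<le> (\<Sum>i. ennreal (K' * 5 powr d * 2 * K powr (\<theta> - 1) * (2 powr (1 - \<theta>)) ^ i) * emeasure M E)"
    proof (intro suminf_le summableI)
      fix i
      \<comment> \<open>The factor \<open>1 / s i\<close> grows like \<open>2 ^ i\<close>, while
        \<open>w i\<close> decays like the \<theta>-th power of \<open>1 / 2 ^ i\<close>; since
        \<open>1 < \<theta>\<close>, the product is geometric with ratio below 1.\<close>
      have "w i * (K' * 5 powr d / s i) = K' * 5 powr d * 2 * K powr (\<theta> - 1) * (2 powr (1 - \<theta>)) ^ i"
      proof -
        have aux: "k * k1 / (P * q) * (k' * f / (k / (2 * P))) = k' * f * 2 * k1 * z"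
          if "0 < k" "0 < P" "z * q = 1" for k P q z k1 k' f :: real
        proof -
          have "q \<noteq> 0" using that(3) by auto
          then have "z = 1 / q" using that(3) by (simp add: eq_divide_eq)
          then show ?thesis using that(1,2) by simp
        qed
        have "(2 ^ i) powr \<theta> = (2::real) ^ i * (2 ^ i) powr (\<theta> - 1)"
          using powr_add[of "2 ^ i :: real" 1 "\<theta> - 1"] by simp
        moreover have 1: "(2 powr (1 - \<theta>)) ^ i * (2 ^ i) powr (\<theta> - 1) = (1::real)"
        proof -
          have "(2 ^ i) powr (\<theta> - 1) = (2::real) powr (real i * (\<theta> - 1))"
            by (simp add: powr_powr flip: powr_realpow)
          moreover have "(2 powr (1 - \<theta>)) ^ i = (2::real) powr (real i * (1 - \<theta>))"
            by (simp add: powr_power mult.commute)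
          ultimately show ?thesis
            by (simp add: right_diff_distrib flip: powr_add)
        qed
        moreover have "K powr \<theta> = K * K powr (\<theta> - 1)"
          using powr_add[of K 1 "\<theta> - 1"] assms by simp
        ultimately have "(K / 2 ^ i) powr \<theta> = K * K powr (\<theta> - 1) / (2 ^ i * (2 ^ i) powr (\<theta> - 1))"
          using assms by (simp add: powr_divide)
        then show ?thesis
          unfolding w_def s_def power_Suc using assms 1 by (simp only: aux zero_less_power zero_less_numeral)
      qed
      then have "ennreal (w i) * ennreal (K' * 5 powr d / s i) = ennreal (K' * 5 powr d * 2 * K powr (\<theta> - 1) * (2 powr (1 - \<theta>)) ^ i)"
        using s[of i] assms by (subst ennreal_mult[symmetric]) (auto simp: w_def)
      moreover have "ennreal (w i) * (\<integral>\<^sup>+ x. g i x \<partial>N) \<le> ennreal (w i) * (ennreal (K' * 5 powr d / s i) * emeasure M E)"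
        by (intro mult_left_mono int_g) auto
      ultimately show "ennreal (w i) * (\<integral>\<^sup>+ x. g i x \<partial>N)
          \<le> ennreal (K' * 5 powr d * 2 * K powr (\<theta> - 1) * (2 powr (1 - \<theta>)) ^ i) * emeasure M E"
        by (simp add: mult.assoc[symmetric])
    qed
    also have "\<dots> = ennreal C0 * emeasure M E"
      unfolding ennreal_suminf_multc C0_def using \<theta>1 assms
      by (subst suminf_ennreal_geometric) auto
    finally have int_H: "(\<integral>\<^sup>+ x. H x \<partial>N) \<le> ennreal C0 * emeasure M E" .
    \<comment> \<open>The level containing the density \<delta> of the ball contributes at least
      \<open>\<delta> powr \<theta> * \<rho> powr (\<alpha> * p)\<close> to
      \<open>H x\<close>.\<close>
    have H_ge: "emeasure M (E \<inter> ball x \<rho>) \<le> ennreal (h powr (1 / \<theta>) * \<rho> powr (d - \<gamma>))"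
      if "\<rho> > 0" "H x \<le> ennreal h" "h > 0" for x \<rho> h
    proof (cases "emeasure M (E \<inter> ball x \<rho>) = 0")
      case False
      have "emeasure M (E \<inter> ball x \<rho>) \<le> emeasure M (ball x \<rho>)"
        using assms(1) by (intro emeasure_mono) auto
      also have "\<dots> \<le> ennreal (K * \<rho> powr d)" using M[OF \<open>\<rho> > 0\<close>] .
      finally have le: "emeasure M (E \<inter> ball x \<rho>) \<le> ennreal (K * \<rho> powr d)" .
      then obtain e where e: "emeasure M (E \<inter> ball x \<rho>) = ennreal e" "e \<ge> 0"
        by (metis ennreal_cases ennreal_neq_top top_unique)
      have e': "0 < e" "e \<le> K * \<rho> powr d"
        using False le e assms by (auto simp: order_less_le)
      define \<delta> where "\<delta> = e / \<rho> powr d"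
      have \<delta>: "0 < \<delta>" "\<delta> \<le> K" "e = \<delta> * \<rho> powr d"
        using e' \<open>\<rho> > 0\<close> by (auto simp: \<delta>_def field_simps)
      obtain k :: int where k: "2 powr of_int k \<le> K / \<delta>" "K / \<delta> < 2 powr (of_int k + 1)"
        using ex_dyadic_floor[of "K / \<delta>"] \<delta> assms by auto
      \<comment> \<open>The growth of \<open>M\<close> keeps the density at most \<open>K\<close>,
        hence levels with natural index are enough.\<close>
      have "0 \<le> k"
      proof (rule ccontr)
        assume "\<not> 0 \<le> k"
        then have "2 powr (of_int k + 1) \<le> (2 powr 0 :: real)"
          by (intro powr_mono) auto
        moreover have "1 \<le> K / \<delta>"
          using \<delta> by simp
        ultimately show False
          using k(2) by simp
      qed
      define i where "i = nat k"
      have i: "real_of_int k = real i" using \<open>0 \<le> k\<close> by (simp add: i_def)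
      have "2 powr of_int k = (2::real) ^ i" "2 powr (of_int k + 1) = (2::real) ^ Suc i"
        unfolding i by (simp_all add: powr_add powr_realpow)
      then have "2 ^ i \<le> K / \<delta>" "K / \<delta> < 2 ^ Suc i"
        using k by simp_all
      then have i1: "\<delta> \<le> K / 2 ^ i" "s i < \<delta>"
        using \<delta>(1) unfolding s_def by (simp_all add: pos_le_divide_eq pos_divide_less_eq mult.commute)
      have "ennreal (\<rho> powr (\<alpha> * p)) \<le> g i x"
        using i1(2) \<open>\<rho> > 0\<close> s[of i] by (intro g_ge) (auto simp: e(1) \<delta>(3) ennreal_less_iff)
      then have "ennreal (w i) * ennreal (\<rho> powr (\<alpha> * p)) \<le> ennreal (w i) * g i x"
        by (intro mult_left_mono) auto
      also have "\<dots> \<le> H x"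
        unfolding H_def by (rule ennreal_le_suminf)
      also have "\<dots> \<le> ennreal h" by fact
      finally have "w i * \<rho> powr (\<alpha> * p) \<le> h"
        using \<open>h > 0\<close> by (simp add: w_def flip: ennreal_mult)
      moreover have "\<delta> powr \<theta> \<le> w i"
        unfolding w_def using \<delta> i1 \<theta> by (intro powr_mono2) auto
      ultimately have "\<delta> powr \<theta> * \<rho> powr (\<alpha> * p) \<le> h"
        by (metis mult_right_mono order_trans powr_ge_zero)
      then have "(\<delta> * \<rho> powr \<gamma>) powr \<theta> \<le> h"
        using \<gamma>(3) \<delta> by (simp add: powr_mult powr_powr)
      then have "((\<delta> * \<rho> powr \<gamma>) powr \<theta>) powr (1 / \<theta>) \<le> h powr (1 / \<theta>)"
        using \<theta> by (intro powr_mono2) auto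
      then have "\<delta> * \<rho> powr \<gamma> \<le> h powr (1 / \<theta>)"
        using \<theta> \<delta> by (simp add: powr_powr)
      then have "\<delta> * \<rho> powr \<gamma> * \<rho> powr (d - \<gamma>) \<le> h powr (1 / \<theta>) * \<rho> powr (d - \<gamma>)"
        by (intro mult_right_mono) auto
      then show ?thesis
        unfolding e(1) \<delta>(3) by (simp add: mult.assoc ennreal_leI flip: powr_add)
    qed auto
    have pot: "nn_potential d \<alpha> M (indicator E) x \<le> ennreal (B * h powr (1 / p))" if "H x \<le> ennreal h" "h > 0" for x h
    proof -
      have "nn_potential d \<alpha> M (indicator E) x \<le> ennreal (B * (h powr (1 / \<theta>)) powr (\<alpha> / \<gamma>))"
        unfolding B_def
      proof (rule nn_potential_indicator_le)
        fix \<rho> :: real assume "\<rho> > 0"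
        have "emeasure M (E \<inter> ball x \<rho>) \<le> emeasure M (ball x \<rho>)"
          using assms(1) by (intro emeasure_mono) auto
        also have "\<dots> \<le> ennreal (K * \<rho> powr d)" using M[OF \<open>\<rho> > 0\<close>] .
        finally show "emeasure M (E \<inter> ball x \<rho>) \<le> ennreal (K * \<rho> powr d)" .
        show "emeasure M (E \<inter> ball x \<rho>) \<le> ennreal (h powr (1 / \<theta>) * \<rho> powr (d - \<gamma>))"
          using H_ge \<open>\<rho> > 0\<close> that by blast
      qed (use assms \<gamma> E that in auto)
      then show ?thesis
        unfolding \<gamma>(2) using \<theta> by (simp add: powr_powr)
    qed
    have "nn_potential d \<alpha> M (indicator E) x \<le> epowr (ennreal (B powr p) * H x) (1 / p)" for x
    proof (cases "H x")
      case (real h)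
      show ?thesis
      proof (cases "h = 0")
        case True
        \<comment> \<open>\<open>pot\<close> asks for a positive bound on \<open>H x\<close>. If
          \<open>H x = 0\<close>, every positive number is one, and letting it tend to 0 removes the
          mass of \<open>E\<close> from all balls around \<open>x\<close>.\<close>
        have "emeasure M (E \<inter> ball x \<rho>) = 0" if "\<rho> > 0" for \<rho>
        proof -
          have "emeasure M (E \<inter> ball x \<rho>) \<le> 0 + ennreal \<epsilon>" if "\<epsilon> > 0" for \<epsilon> :: real
          proof -
            define \<eta> where "\<eta> = \<epsilon> / \<rho> powr (d - \<gamma>)"
            have \<eta>: "\<eta> > 0" "\<eta> * \<rho> powr (d - \<gamma>) = \<epsilon>"
              using \<open>\<rho> > 0\<close> \<open>\<epsilon> > 0\<close> by (simp_all add: \<eta>_def)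
            have "emeasure M (E \<inter> ball x \<rho>) \<le> ennreal ((\<eta> powr \<theta>) powr (1 / \<theta>) * \<rho> powr (d - \<gamma>))"
              by (rule H_ge) (use \<open>\<rho> > 0\<close> True real \<eta>(1) in auto)
            also have "(\<eta> powr \<theta>) powr (1 / \<theta>) = \<eta>"
              using \<theta> \<eta>(1) by (simp add: powr_powr)
            finally show ?thesis
              by (simp add: \<eta>(2))
          qed
          then have "emeasure M (E \<inter> ball x \<rho>) \<le> 0"
            by (rule ennreal_le_epsilon)
          then show ?thesis by simp
        qed
        then show ?thesis
          using nn_potential_indicator_null[OF assms(1) E(1)] by simp
      next
        case False
        then have "h > 0" using real by simp
        then have "epowr (ennreal (B powr p) * H x) (1 / p) = ennreal (B * h powr (1 / p))"
          using B \<open>1 < p\<close> real by (simp add: epowr_ennreal powr_mult powr_powr flip: ennreal_mult)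
        then show ?thesis using pot \<open>h > 0\<close> real by simp
      qed
    next
      case top
      then show ?thesis using B by (simp add: ennreal_mult_top)
    qed
    moreover have "(\<integral>\<^sup>+ x. ennreal (B powr p) * H x \<partial>N) \<le> ennreal (B powr p * C0) * emeasure M E"
    proof -
      have "(\<integral>\<^sup>+ x. ennreal (B powr p) * H x \<partial>N) = ennreal (B powr p) * (\<integral>\<^sup>+ x. H x \<partial>N)"
        using assms(2) H by (intro nn_integral_cmult) (simp cong: measurable_cong_sets)
      also have "\<dots> \<le> ennreal (B powr p) * (ennreal C0 * emeasure M E)"
        by (intro mult_left_mono int_H) auto
      also have "\<dots> = ennreal (B powr p * C0) * emeasure M E"
        using C0 by (subst ennreal_mult) (auto simp only: mult.assoc powr_ge_zero less_imp_le)
      finally show ?thesis .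
    qed
    ultimately show "\<exists>G\<in>borel_measurable borel. (\<forall>x. nn_potential d \<alpha> M (indicator E) x \<le> epowr (G x) (1 / p)) \<and>
      (\<integral>\<^sup>+ x. G x \<partial>N) \<le> ennreal (B powr p * C0) * emeasure M E"
      by (intro bexI[of _ "\<lambda>x. ennreal (B powr p) * H x"] conjI allI) measurable
  qed
qed

section \<open>Rearrangements\<close>

lemma borel_measurable_antimono_ennreal:
  fixes f :: "real \<Rightarrow> ennreal"
  assumes "antimono f"
  shows "f \<in> borel_measurable borel"
proof (rule borel_measurableI_greater)
  fix y
  have "is_interval {x. y < f x}"
    unfolding is_interval_1 using assms by (auto dest: antimonoD intro: less_le_trans)
  then show "{x \<in> space borel. y < f x} \<in> sets borel"
    by (simp add: real_interval_borel_measurable)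
qed

lemma dist_fun_antimono: "f \<in> borel_measurable M \<Longrightarrow> l \<le> l' \<Longrightarrow> dist_fun M f l' \<le> dist_fun M f l"
  unfolding dist_fun_def by (intro emeasure_mono) auto

lemma antimono_rearr: "antimono (rearr M f)"
  unfolding rearr_def by (intro antimonoI Inf_superset_mono) (auto intro: order_trans ennreal_leI)

lemma borel_measurable_rearr [measurable]: "rearr M f \<in> borel_measurable borel"
  by (rule borel_measurable_antimono_ennreal[OF antimono_rearr])

text \<open>Together with \<open>less_dist_fun_of_less_rearr\<close> this expresses that
  \<open>rearr\<close> and \<open>dist_fun\<close> are generalised inverses of each other.\<close>

lemma le_rearr:
  assumes "f \<in> borel_measurable M" "ennreal s < dist_fun M f l"
  shows "l \<le> rearr M f s"
  unfolding rearr_def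
proof (rule Inf_greatest)
  fix l' assume "l' \<in> {l. 0 < l \<and> dist_fun M f l \<le> ennreal s}"
  then have "\<not> l' \<le> l"
    using dist_fun_antimono[OF assms(1), of l' l] assms(2) by auto
  then show "l \<le> l'" by simp
qed

lemma less_dist_fun_of_less_rearr:
  assumes "l < rearr M f s" "0 < l"
  shows "ennreal s < dist_fun M f l"
  using assms unfolding rearr_def by (metis (mono_tags, lifting) Inf_lower linorder_not_le mem_Collect_eq)

text \<open>Where \<open>u\<close> exceeds \<open>l + c\<close>, \<open>g\<close> exceeds
  \<open>l\<close>. Measurability is asked of \<open>g\<close> alone because a power of the
  potential will be put for \<open>u\<close>.\<close>

lemma rearr_le_add_const:
  assumes u: "\<And>x. x \<in> space M \<Longrightarrow> u x \<le> g x + c" and g: "g \<in> borel_measurable M"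
  shows "rearr M u s \<le> rearr M g s + c"
proof (cases "c = \<infinity>")
  case False
  have "rearr M u s - c \<le> rearr M g s"
    unfolding rearr_def[of M g]
  proof (rule Inf_greatest)
    fix l assume "l \<in> {l. 0 < l \<and> dist_fun M g l \<le> ennreal s}"
    then have l: "0 < l" "dist_fun M g l \<le> ennreal s" by auto
    have "dist_fun M u (l + c) \<le> dist_fun M g l"
      unfolding dist_fun_def
    proof (rule emeasure_mono)
      show "{x \<in> space M. l + c < u x} \<subseteq> {x \<in> space M. l < g x}"
      proof safe
        fix x assume "x \<in> space M" "l + c < u x"
        then show "l < g x"
          using u[of x] add_right_mono[of "g x" l c] by (meson linorder_not_le order_trans)
      qed
    qed (use g in simp)
    then have "rearr M u s \<le> l + c"
      unfolding rearr_def using l by (intro Inf_lower) (auto intro: order_trans add_pos_nonneg)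
    then show "rearr M u s - c \<le> l"
      using False by (simp add: ennreal_minus_le_iff add.commute)
  qed
  then show ?thesis
    using False by (simp add: ennreal_minus_le_iff add.commute)
qed simp

text \<open>Layer cake for a single value. It also computes the length of \<open>ivl b\<close>,
  infinite \<open>b\<close> included.\<close>

lemma nn_integral_indicator_less:
  "(\<integral>\<^sup>+ l. indicator {l. 0 < l \<and> ennreal l < x} l \<partial>lborel) = x"
proof (cases x)
  case (real r)
  then have "{l. 0 < l \<and> ennreal l < x} = {0<..<r}"
    by (auto simp: ennreal_less_iff)
  then show ?thesis using real by simp
next
  case top
  then have "{l. 0 < l \<and> ennreal l < x} = {0<..}" by auto
  moreover have "emeasure lborel {0::real<..} = \<infinity>"
  proof -
    have "of_nat n \<le> emeasure lborel {0::real<..}" for n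
    proof -
      have "emeasure lborel {0<..<real n} \<le> emeasure lborel {0::real<..}"
        by (intro emeasure_mono) auto
      then show ?thesis by (simp add: ennreal_of_nat_eq_real_of_nat)
    qed
    then have "(SUP n. of_nat n) \<le> emeasure lborel {0::real<..}"
      by (intro SUP_least)
    then show ?thesis
      by (simp add: ennreal_SUP_of_nat_eq_top top_unique)
  qed
  ultimately show ?thesis using top by simp
qed

text \<open>Layer cake writes both integrals as areas, and Fubini exchanges the variables;
  \<open>l < rearr M f s\<close> implies \<open>s < dist_fun M f l\<close>.\<close>

lemma nn_integral_rearr_le:
  assumes "sigma_finite_measure M" and f [measurable]: "f \<in> borel_measurable M"
  shows "(\<integral>\<^sup>+ s \<in> {0<..}. rearr M f s \<partial>lborel) \<le> (\<integral>\<^sup>+ x. f x \<partial>M)"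
proof -
  interpret M: sigma_finite_measure M by fact
  interpret LM: pair_sigma_finite lborel M ..
  define D where "D l = dist_fun M f (ennreal l)" for l
  have "antimono D"
    unfolding D_def by (intro antimonoI dist_fun_antimono f ennreal_leI)
  then have D [measurable]: "D \<in> borel_measurable borel"
    by (rule borel_measurable_antimono_ennreal)
  have "(\<integral>\<^sup>+ s \<in> {0<..}. rearr M f s \<partial>lborel)
      = (\<integral>\<^sup>+ s. (\<integral>\<^sup>+ l. indicator {l. 0 < l \<and> ennreal l < rearr M f s} l * indicator {0<..} s \<partial>lborel) \<partial>lborel)"
    by (subst nn_integral_multc) (simp_all add: nn_integral_indicator_less)
  also have "\<dots> \<le> (\<integral>\<^sup>+ s. (\<integral>\<^sup>+ l. (if 0 < l \<and> 0 < s \<and> ennreal s < D l then 1 else 0) \<partial>lborel) \<partial>lborel)"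
    by (intro nn_integral_mono) (auto simp: D_def intro: less_dist_fun_of_less_rearr split: split_indicator)
  also have "\<dots> = (\<integral>\<^sup>+ l. (\<integral>\<^sup>+ s. (if 0 < l \<and> 0 < s \<and> ennreal s < D l then 1 else 0) \<partial>lborel) \<partial>lborel)"
    by (rule lborel_pair.Fubini') measurable
  also have "\<dots> = (\<integral>\<^sup>+ l. D l * indicator {0<..} l \<partial>lborel)"
  proof (intro nn_integral_cong)
    fix l :: real
    have "(\<integral>\<^sup>+ s. (if 0 < l \<and> 0 < s \<and> ennreal s < D l then 1 else 0) \<partial>lborel)
        = (\<integral>\<^sup>+ s. indicator {s. 0 < s \<and> ennreal s < D l} s * indicator {0<..} l \<partial>lborel)"
      by (intro nn_integral_cong) (auto split: split_indicator)
    then show "(\<integral>\<^sup>+ s. (if 0 < l \<and> 0 < s \<and> ennreal s < D l then 1 else 0) \<partial>lborel) = D l * indicator {0<..} l"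
      by (subst (asm) nn_integral_multc) (simp_all add: nn_integral_indicator_less)
  qed
  also have "\<dots> = (\<integral>\<^sup>+ l. (\<integral>\<^sup>+ x. (if 0 < l \<and> ennreal l < f x then 1 else 0) \<partial>M) \<partial>lborel)"
  proof (intro nn_integral_cong)
    fix l :: real
    have "D l * indicator {0<..} l = (\<integral>\<^sup>+ x. indicator {x \<in> space M. ennreal l < f x} x * indicator {0<..} l \<partial>M)"
      by (subst nn_integral_multc) (simp_all add: D_def dist_fun_def)
    also have "\<dots> = (\<integral>\<^sup>+ x. (if 0 < l \<and> ennreal l < f x then 1 else 0) \<partial>M)"
      by (intro nn_integral_cong) (auto split: split_indicator)
    finally show "D l * indicator {0<..} l = \<dots>" .
  qed
  also have "\<dots> = (\<integral>\<^sup>+ x. (\<integral>\<^sup>+ l. (if 0 < l \<and> ennreal l < f x then 1 else 0) \<partial>lborel) \<partial>M)"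
    by (rule LM.Fubini'[symmetric]) measurable
  also have "\<dots> = (\<integral>\<^sup>+ x. f x \<partial>M)"
  proof (intro nn_integral_cong)
    fix x
    have "(\<integral>\<^sup>+ l. (if 0 < l \<and> ennreal l < f x then 1 else 0) \<partial>lborel) = (\<integral>\<^sup>+ l. indicator {l. 0 < l \<and> ennreal l < f x} l \<partial>lborel)"
      by (intro nn_integral_cong) (auto split: split_indicator)
    then show "(\<integral>\<^sup>+ l. (if 0 < l \<and> ennreal l < f x then 1 else 0) \<partial>lborel) = f x"
      by (simp add: nn_integral_indicator_less)
  qed
  finally show ?thesis .
qed

lemma rearr_indicator:
  assumes "E \<in> sets M" "emeasure M E = ennreal a" "0 \<le> a" "0 < t"
  shows "rearr M (indicator E) t = indicator {0<..<a} t"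
proof (cases "t < a")
  case True
  have "dist_fun M (indicator E) l = ennreal a" if "l < 1" for l
  proof -
    have "{x \<in> space M. l < indicator E x} = E"
      using that sets.sets_into_space[OF assms(1)] by (auto split: split_indicator_asm split_indicator)
    then show ?thesis using assms by (simp add: dist_fun_def)
  qed
  then have "l \<le> rearr M (indicator E) t" if "l < 1" for l
    using that True assms by (intro le_rearr) (auto simp: ennreal_less_iff)
  then have "1 \<le> rearr M (indicator E) t"
    by (rule dense_le)
  moreover have "rearr M (indicator E) t \<le> 1"
    unfolding rearr_def
    by (rule Inf_lower) (auto simp: dist_fun_def indicator_def not_less[symmetric])
  ultimately show ?thesis using True assms by simp
next
  case False
  have "rearr M (indicator E) t \<le> l" if "0 < l" for l
    unfolding rearr_def
  proof (intro Inf_lower CollectI conjI that)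
    have "dist_fun M (indicator E) l \<le> emeasure M E"
      unfolding dist_fun_def using assms by (intro emeasure_mono) (auto split: split_indicator_asm)
    then show "dist_fun M (indicator E) l \<le> ennreal t"
      using False assms by (auto intro: order_trans ennreal_leI)
  qed
  then have "rearr M (indicator E) t \<le> 0"
    by (rule dense_ge)
  then show ?thesis using False by simp
qed

text \<open>The convex power lies above its tangent at \<open>\<tau>\<close>; Young's inequality
  gives this form of the statement.\<close>

lemma powr_tangent:
  fixes y \<tau> p :: real
  assumes "0 \<le> y" "0 < \<tau>" "1 \<le> p"
  shows "p * y * \<tau> powr (p - 1) \<le> y powr p + (p - 1) * \<tau> powr p"
proof (cases "y = 0")
  case False
  have "(y powr p) powr (1 / p) * (\<tau> powr p) powr (1 - 1 / p) \<le> (1 / p) * y powr p + (1 - 1 / p) * \<tau> powr p"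
    using assms by (intro Youngs_inequality_0) (auto simp: False)
  then have "p * (y * \<tau> powr (p - 1)) \<le> p * ((1 / p) * y powr p + (1 - 1 / p) * \<tau> powr p)"
    using assms by (intro mult_left_mono) (auto simp: powr_powr right_diff_distrib)
  then show ?thesis
    using assms by (simp add: algebra_simps)
qed (use assms in simp)

text \<open>Hoelder's inequality for weighted sums, obtained from \<open>powr_tangent\<close> at the
  weighted mean \<open>\<tau> = T / S\<close>.\<close>

lemma powr_sum_le:
  fixes w y :: "'b \<Rightarrow> real"
  assumes "finite J" "1 \<le> p" "\<And>i. i \<in> J \<Longrightarrow> 0 \<le> w i" "\<And>i. i \<in> J \<Longrightarrow> 0 \<le> y i"
  shows "(\<Sum>i\<in>J. w i * y i) powr p \<le> (\<Sum>i\<in>J. w i) powr (p - 1) * (\<Sum>i\<in>J. w i * y i powr p)"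
proof (cases "(\<Sum>i\<in>J. w i * y i) = 0")
  case False
  define T where "T = (\<Sum>i\<in>J. w i * y i)"
  define S where "S = (\<Sum>i\<in>J. w i)"
  have T: "T > 0"
    using False assms by (simp add: T_def order_less_le sum_nonneg)
  have "S \<noteq> 0"
    using False assms by (auto simp: S_def sum_nonneg_eq_0_iff)
  then have S: "S > 0"
    using assms by (simp add: S_def order_less_le sum_nonneg)
  define \<tau> where "\<tau> = T / S"
  have \<tau>: "\<tau> > 0" "T = \<tau> * S" using T S by (auto simp: \<tau>_def)
  have "(\<Sum>i\<in>J. w i * (p * y i * \<tau> powr (p - 1))) \<le> (\<Sum>i\<in>J. w i * (y i powr p + (p - 1) * \<tau> powr p))"
    using assms \<tau> by (intro sum_mono mult_left_mono powr_tangent) auto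
  also have "(\<Sum>i\<in>J. w i * (p * y i * \<tau> powr (p - 1))) = p * \<tau> powr (p - 1) * T"
    by (simp add: T_def sum_distrib_left mult_ac)
  also have "(\<Sum>i\<in>J. w i * (y i powr p + (p - 1) * \<tau> powr p)) = (\<Sum>i\<in>J. w i * y i powr p) + (p - 1) * \<tau> powr p * S"
    by (simp add: S_def sum_distrib_left sum_distrib_right sum.distrib distrib_left mult_ac)
  also have "p * \<tau> powr (p - 1) * T = p * (\<tau> powr p * S)"
    using powr_add[of \<tau> "p - 1" 1] \<tau> by simp
  finally have "\<tau> powr p * S \<le> (\<Sum>i\<in>J. w i * y i powr p)"
    by (simp add: algebra_simps)
  then have "S powr (p - 1) * (\<tau> powr p * S) \<le> S powr (p - 1) * (\<Sum>i\<in>J. w i * y i powr p)"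
    by (intro mult_left_mono) auto
  moreover have "S powr (p - 1) * (\<tau> powr p * S) = T powr p"
    using powr_add[of S "p - 1" 1] \<tau> S by (simp add: powr_mult)
  ultimately show ?thesis
    unfolding T_def S_def by simp
qed (use assms in \<open>simp add: sum_nonneg\<close>)

text \<open>This takes the place of Minkowski's inequality: the p-th power of a weighted series
  becomes a weighted series of p-th powers, which can be integrated term by term. Series equal to 0
  or infinity are treated apart, the rest follows from finite sums.\<close>

lemma epowr_suminf_le:
  fixes w y :: "nat \<Rightarrow> ennreal"
  assumes p: "1 < p"
  shows "epowr (\<Sum>i. w i * y i) p \<le> epowr (\<Sum>i. w i) (p - 1) * (\<Sum>i. w i * epowr (y i) p)"
proof (cases "(\<Sum>i. w i) = 0 \<or> (\<Sum>i. w i * epowr (y i) p) = 0")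
  case True
  then have "w i * y i = 0" for i
    using p epowr_le_iff[of p "y i" 0] by (auto simp: suminf_eq_zero_iff)
  then show ?thesis by (simp only: suminf_zero epowr_0) simp
next
  case nz: False
  show ?thesis
  proof (cases "(\<Sum>i. w i) = top \<or> (\<Sum>i. w i * epowr (y i) p) = top")
    case True
    have "epowr (\<Sum>i. w i) (p - 1) \<noteq> 0"
      using nz p epowr_le_iff[of "p - 1" "\<Sum>i. w i" 0] by auto
    with True nz have "epowr (\<Sum>i. w i) (p - 1) * (\<Sum>i. w i * epowr (y i) p) = top"
      by (auto simp: ennreal_mult_eq_top_iff)
    then show ?thesis by simp
  next
    case False
    have w: "w i < top" for i
      using False ennreal_le_suminf[of w i] by (auto simp: less_top[symmetric] top_unique)
    have wy: "w i * epowr (y i) p < top" for i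
      using False ennreal_le_suminf[of "\<lambda>i. w i * epowr (y i) p" i] by (auto simp: less_top[symmetric] top_unique)
    define w' where "w' i = enn2real (w i)" for i
    \<comment> \<open>Where the weight vanishes \<open>y i\<close> may be infinite; the value 0
      there does not change the products.\<close>
    define y' where "y' i = (if w i = 0 then 0 else enn2real (y i))" for i
    have w': "w i = ennreal (w' i)" "0 \<le> w' i" for i
      using w by (simp_all add: w'_def)
    have y': "w i * y i = ennreal (w' i * y' i)" "w i * epowr (y i) p = ennreal (w' i * y' i powr p)" "0 \<le> y' i" for i
    proof -
      have "y i < top" if "w i \<noteq> 0"
        using wy[of i] that by (cases "y i = top") (auto simp: ennreal_mult_top less_top)
      then have y: "y i = ennreal (y' i)" if "w i \<noteq> 0" using that by (simp add: y'_def)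
      show y0: "0 \<le> y' i" by (simp add: y'_def)
      show "w i * y i = ennreal (w' i * y' i)"
      proof (cases "w i = 0")
        case False
        show ?thesis
          unfolding y[OF False] w'(1)[of i] using w'(2)[of i] y0 by (rule ennreal_mult[symmetric])
      qed (simp add: w'_def)
      show "w i * epowr (y i) p = ennreal (w' i * y' i powr p)"
      proof (cases "w i = 0")
        case False
        show ?thesis
          unfolding y[OF False] w'(1)[of i] epowr_ennreal[OF y0] using w'(2)[of i] powr_ge_zero by (rule ennreal_mult[symmetric])
      qed (simp add: w'_def)
    qed
    have "(\<Sum>i<n. w i * y i) \<le> epowr (epowr (\<Sum>i. w i) (p - 1) * (\<Sum>i. w i * epowr (y i) p)) (1 / p)" for n
    proof -
      have "epowr (\<Sum>i<n. w i * y i) p = ennreal ((\<Sum>i<n. w' i * y' i) powr p)"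
        using w' y' by (simp add: sum_ennreal epowr_ennreal sum_nonneg)
      also have "\<dots> \<le> ennreal ((\<Sum>i<n. w' i) powr (p - 1) * (\<Sum>i<n. w' i * y' i powr p))"
        using p w' y' by (intro ennreal_leI powr_sum_le) auto
      also have "\<dots> = epowr (\<Sum>i<n. w i) (p - 1) * (\<Sum>i<n. w i * epowr (y i) p)"
      proof -
        have "(\<Sum>i<n. w i) = ennreal (\<Sum>i<n. w' i)"
          unfolding w'(1) using w'(2) by (intro sum_ennreal)
        moreover have "(\<Sum>i<n. w i * epowr (y i) p) = ennreal (\<Sum>i<n. w' i * y' i powr p)"
          unfolding y'(2) using w'(2) y'(3) by (intro sum_ennreal) simp
        ultimately show ?thesis
          using w'(2) y'(3) by (simp add: epowr_ennreal sum_nonneg ennreal_mult)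
      qed
      also have "\<dots> \<le> epowr (\<Sum>i. w i) (p - 1) * (\<Sum>i. w i * epowr (y i) p)"
        using p by (intro mult_mono epowr_mono sum_le_suminf) auto
      finally show ?thesis
        using p by (simp add: epowr_le_iff)
    qed
    then have "(\<Sum>i. w i * y i) \<le> epowr (epowr (\<Sum>i. w i) (p - 1) * (\<Sum>i. w i * epowr (y i) p)) (1 / p)"
      by (intro suminf_le_const) auto
    then show ?thesis
      using p by (simp add: epowr_le_iff)
  qed
qed

section \<open>Rearrangement-invariant norms\<close>

lemma ri_norm_mono:
  "ri_norm M N \<Longrightarrow> f \<in> borel_measurable M \<Longrightarrow> g \<in> borel_measurable M \<Longrightarrow> (AE x in M. f x \<le> g x) \<Longrightarrow> N f \<le> N g"
  unfolding ri_norm_def by blast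

lemma ri_norm_cong:
  assumes "ri_norm M N" "f \<in> borel_measurable M" "g \<in> borel_measurable M" "AE x in M. f x = g x"
  shows "N f = N g"
  using assms(4) by (intro antisym ri_norm_mono[OF assms(1)] assms(2,3)) (auto elim: eventually_mono)

lemma ri_norm_cmult:
  "ri_norm M N \<Longrightarrow> f \<in> borel_measurable M \<Longrightarrow> 0 \<le> c \<Longrightarrow> N (\<lambda>x. ennreal c * f x) = ennreal c * N f"
  unfolding ri_norm_def by blast

lemma ri_norm_add:
  "ri_norm M N \<Longrightarrow> f \<in> borel_measurable M \<Longrightarrow> g \<in> borel_measurable M \<Longrightarrow> N (\<lambda>x. f x + g x) \<le> N f + N g"
  unfolding ri_norm_def by blast

lemma ri_norm_eq_0_iff:
  "ri_norm M N \<Longrightarrow> f \<in> borel_measurable M \<Longrightarrow> N f = 0 \<longleftrightarrow> (AE x in M. f x = 0)"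
  unfolding ri_norm_def by blast

lemma ri_norm_Fatou:
  "ri_norm M N \<Longrightarrow> f \<in> borel_measurable M \<Longrightarrow> (\<And>j::nat. F j \<in> borel_measurable M) \<Longrightarrow>
    (AE x in M. incseq (\<lambda>j. F j x) \<and> (\<lambda>j. F j x) \<longlonglongrightarrow> f x) \<Longrightarrow> (\<lambda>j. N (F j)) \<longlonglongrightarrow> N f"
  unfolding ri_norm_def by blast

lemma ri_norm_indicator:
  "ri_norm M N \<Longrightarrow> E \<in> sets M \<Longrightarrow> emeasure M E < \<infinity> \<Longrightarrow> N (indicator E) < \<infinity>"
  unfolding ri_norm_def by blast

lemma ri_norm_local:
  "ri_norm M N \<Longrightarrow> E \<in> sets M \<Longrightarrow> emeasure M E < \<infinity> \<Longrightarrow>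
    \<exists>C>0. \<forall>f\<in>borel_measurable M. (\<integral>\<^sup>+ x \<in> E. f x \<partial>M) \<le> ennreal C * N f"
  unfolding ri_norm_def by blast

lemma ri_norm_equimeasurable:
  "ri_norm M N \<Longrightarrow> f \<in> borel_measurable M \<Longrightarrow> g \<in> borel_measurable M \<Longrightarrow> dist_fun M f = dist_fun M g \<Longrightarrow> N f = N g"
  unfolding ri_norm_def by blast

text \<open>The Fatou property carries the triangle inequality from partial sums to series.\<close>

lemma ri_norm_suminf:
  fixes F :: "nat \<Rightarrow> 'a \<Rightarrow> ennreal"
  assumes N: "ri_norm M N" and F [measurable]: "\<And>j. F j \<in> borel_measurable M"
  shows "N (\<lambda>x. \<Sum>j. F j x) \<le> (\<Sum>j. N (F j))"
proof (rule LIMSEQ_le_const2)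
  show "(\<lambda>n. N (\<lambda>x. \<Sum>j<n. F j x)) \<longlonglongrightarrow> N (\<lambda>x. \<Sum>j. F j x)"
  proof (rule ri_norm_Fatou[OF N])
    show "AE x in M. incseq (\<lambda>n. \<Sum>j<n. F j x) \<and> (\<lambda>n. \<Sum>j<n. F j x) \<longlonglongrightarrow> (\<Sum>j. F j x)"
      by (intro AE_I2 conjI incseq_SucI summable_LIMSEQ) (auto simp: add_increasing2)
  qed measurable
  have "N (\<lambda>x. \<Sum>j<n. F j x) \<le> (\<Sum>j<n. N (F j))" for n
  proof (induction n)
    case 0
    show ?case using ri_norm_eq_0_iff[OF N, of "\<lambda>x. 0"] by simp
  next
    case (Suc n)
    have "N (\<lambda>x. \<Sum>j<Suc n. F j x) \<le> N (\<lambda>x. \<Sum>j<n. F j x) + N (F n)"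
      unfolding sum.lessThan_Suc by (rule ri_norm_add[OF N]) measurable
    also have "\<dots> \<le> (\<Sum>j<n. N (F j)) + N (F n)"
      using Suc by (rule add_right_mono)
    finally show ?case by simp
  qed
  then have "N (\<lambda>x. \<Sum>j<n. F j x) \<le> (\<Sum>j. N (F j))" for n
    by (rule order_trans) (intro sum_le_suminf, auto)
  then show "\<exists>m. \<forall>n\<ge>m. N (\<lambda>x. \<Sum>j<n. F j x) \<le> (\<Sum>j. N (F j))"
    by blast
qed

text \<open>The norm controls the integral over \<open>E\<close>, and a function with finite
  integral is finite almost everywhere.\<close>

lemma ri_norm_finite_AE:
  assumes N: "ri_norm M N" and f [measurable]: "f \<in> borel_measurable M" and "N f < \<infinity>"
    and E: "E \<in> sets M" "emeasure M E < \<infinity>"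
  shows "AE x in M. x \<in> E \<longrightarrow> f x < \<infinity>"
proof -
  note [measurable] = E(1)
  obtain C where C: "C > 0" "(\<integral>\<^sup>+ x \<in> E. f x \<partial>M) \<le> ennreal C * N f"
    using ri_norm_local[OF N E] f by blast
  then have "(\<integral>\<^sup>+ x \<in> E. f x \<partial>M) \<noteq> \<infinity>"
    using \<open>N f < \<infinity>\<close> by (auto simp: top_unique ennreal_mult_eq_top_iff)
  then have "AE x in M. f x * indicator E x \<noteq> \<infinity>"
    by (intro nn_integral_noteq_infinite) measurable
  then show ?thesis
    by eventually_elim (auto simp: less_top)
qed

section \<open>Lebesgue measure on the interval \<open>ivl b\<close>\<close>

lemma space_lborel_ivl: "space (lborel_ivl b) = ivl b"
  by (simp add: lborel_ivl_def space_restrict_space)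

lemma sets_ivl [measurable]: "ivl b \<in> sets borel"
proof -
  have "is_interval (ivl b)"
    unfolding is_interval_1 ivl_def by (auto intro: le_less_trans ennreal_leI)
  then show ?thesis by (rule real_interval_borel_measurable)
qed

lemma measurable_lborel_ivl: "f \<in> borel_measurable borel \<Longrightarrow> f \<in> borel_measurable (lborel_ivl b)"
  unfolding lborel_ivl_def by (intro measurable_restrict_space1) simp

lemma sets_lborel_ivl: "A \<subseteq> ivl b \<Longrightarrow> A \<in> sets borel \<Longrightarrow> A \<in> sets (lborel_ivl b)"
  unfolding lborel_ivl_def by (auto simp: sets_restrict_space)

lemma emeasure_lborel_ivl: "A \<subseteq> ivl b \<Longrightarrow> emeasure (lborel_ivl b) A = emeasure lborel A"
  unfolding lborel_ivl_def by (rule emeasure_restrict_space) auto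

lemma emeasure_ivl: "emeasure lborel (ivl b) = b"
proof -
  have "emeasure lborel (ivl b) = (\<integral>\<^sup>+ l. indicator {l. 0 < l \<and> ennreal l < b} l \<partial>lborel)"
    by (simp add: ivl_def[symmetric])
  then show ?thesis
    by (simp only: nn_integral_indicator_less)
qed

lemma ivl_subset: "0 \<le> a \<Longrightarrow> ennreal a \<le> b \<Longrightarrow> {0<..<a} \<subseteq> ivl b"
  unfolding ivl_def by (auto intro: less_le_trans[OF ennreal_lessI, rotated 2])

text \<open>\<open>R_op\<close> of a characteristic function, glued to the constant that makes it continuous and bounded
  near \<open>0\<close>.\<close>

definition profile :: "real \<Rightarrow> real \<Rightarrow> real \<Rightarrow> real \<Rightarrow> real" where
  "profile p q a t = min ((a / t) powr (1 / p)) (a powr (1 / q))"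

lemma borel_measurable_profile [measurable]: "profile p q a \<in> borel_measurable borel"
  unfolding profile_def by measurable

section \<open>From characteristic functions to series of them\<close>

lemma nn_potential_suminf:
  fixes M :: "'a::euclidean_space measure"
  assumes "sets M = sets borel" "\<And>j. v j \<in> borel_measurable borel" "\<And>y. u y \<le> (\<Sum>j. v j y :: ennreal)"
  shows "nn_potential d \<alpha> M u x \<le> (\<Sum>j. nn_potential d \<alpha> M (v j) x)"
proof -
  have [measurable]: "v j \<in> borel_measurable M" "kernel d \<alpha> x \<in> borel_measurable M" for j
    using assms(2) borel_measurable_kernel unfolding measurable_cong_sets[OF assms(1) refl] by auto
  have "nn_potential d \<alpha> M u x \<le> (\<integral>\<^sup>+ y. (\<Sum>j. kernel d \<alpha> x y * v j y) \<partial>M)"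
    unfolding nn_potential_def using assms(3) by (intro nn_integral_mono) (simp add: mult_left_mono)
  also have "\<dots> = (\<Sum>j. nn_potential d \<alpha> M (v j) x)"
    unfolding nn_potential_def by (intro nn_integral_suminf) measurable
  finally show ?thesis .
qed

lemma nn_potential_cmult:
  fixes M :: "'a::euclidean_space measure"
  assumes "sets M = sets borel" "v \<in> borel_measurable borel"
  shows "nn_potential d \<alpha> M (\<lambda>y. c * v y) x = c * nn_potential d \<alpha> M v x"
proof -
  have [measurable]: "v \<in> borel_measurable M" "kernel d \<alpha> x \<in> borel_measurable M"
    using assms(2) borel_measurable_kernel unfolding measurable_cong_sets[OF assms(1) refl] by auto
  have "nn_potential d \<alpha> M (\<lambda>y. c * v y) x = (\<integral>\<^sup>+ y. c * (kernel d \<alpha> x y * v y) \<partial>M)"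
    unfolding nn_potential_def by (simp only: mult.left_commute)
  also have "\<dots> = c * nn_potential d \<alpha> M v x"
    unfolding nn_potential_def by (intro nn_integral_cmult) measurable
  finally show ?thesis .
qed

text \<open>For fixed \<open>t\<close> each piece of \<open>u\<close> goes to \<open>L\<^sup>p(N)\<close> or to \<open>L\<^sup>\<infinity>\<close>, whichever bound is better.\<close>

lemma potential_split:
  fixes M N :: "'a::euclidean_space measure" and E :: "nat \<Rightarrow> 'a set" and a c :: "nat \<Rightarrow> real"
  assumes sets: "sets M = sets borel" "sets N = sets borel" and p: "1 < p" and C: "0 < C1" "0 < C2" and t: "0 < t"
    and strong: "\<And>E. E \<in> sets borel \<Longrightarrow> emeasure M E < \<infinity> \<Longrightarrow>
      \<exists>G\<in>borel_measurable borel. (\<forall>x. nn_potential d \<alpha> M (indicator E) x \<le> epowr (G x) (1 / p)) \<and>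
        (\<integral>\<^sup>+ x. G x \<partial>N) \<le> ennreal C1 * emeasure M E"
    and sup: "\<And>E b x. E \<in> sets borel \<Longrightarrow> 0 \<le> b \<Longrightarrow> emeasure M E = ennreal b \<Longrightarrow>
      nn_potential d \<alpha> M (indicator E) x \<le> ennreal (C2 * b powr (1 / q))"
    and E: "\<And>j. E j \<in> sets borel" "\<And>j. emeasure M (E j) = ennreal (a j)" "\<And>j. 0 \<le> a j" and c: "\<And>j. 0 \<le> c j"
    and u: "\<And>y. u y \<le> (\<Sum>j. ennreal (c j) * indicator (E j) y)"
  obtains g h where "g \<in> borel_measurable borel" "\<And>x. nn_potential d \<alpha> M u x \<le> g x + h"
    "(\<integral>\<^sup>+ x. epowr (g x) p \<partial>N) \<le> ennreal (C1 * t) * epowr (\<Sum>j. ennreal (c j * profile p q (a j) t)) p"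
    "h \<le> ennreal C2 * (\<Sum>j. ennreal (c j * profile p q (a j) t))"
proof -
  let ?A = "\<Sum>j. ennreal (c j * profile p q (a j) t)"
  have "\<exists>G\<in>borel_measurable borel. (\<forall>x. nn_potential d \<alpha> M (indicator (E j)) x \<le> epowr (G x) (1 / p)) \<and>
        (\<integral>\<^sup>+ x. G x \<partial>N) \<le> ennreal C1 * emeasure M (E j)" for j
    by (rule strong[OF E(1)]) (simp add: E(2))
  then obtain G where G [measurable]: "\<And>j. G j \<in> borel_measurable borel"
    and G_ge: "\<And>j x. nn_potential d \<alpha> M (indicator (E j)) x \<le> epowr (G j x) (1 / p)"
    and int_G: "\<And>j. (\<integral>\<^sup>+ x. G j x \<partial>N) \<le> ennreal C1 * emeasure M (E j)"
    by metis
  \<comment> \<open>The pieces for which the Lp bound is the better one; \<open>0 < a j\<close>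
    allows division by \<open>a j\<close>.\<close>
  define J where "J j \<longleftrightarrow> 0 < a j \<and> (a j / t) powr (1 / p) \<le> a j powr (1 / q)" for j
  define w where "w j = (if J j then ennreal (c j * (a j / t) powr (1 / p)) else 0)" for j
  \<comment> \<open>Normalised so that for every \<open>j\<close> in \<open>J\<close> the p-th power
    of \<open>y j\<close> has integral at most \<open>C1 * t\<close> over \<open>N\<close>; the
    weight \<open>w j\<close> carries the size of the piece.\<close>
  define y where "y j x = epowr (ennreal (t / a j) * G j x) (1 / p)" for j x
  define g where "g x = (\<Sum>j. w j * y j x)" for x
  define h where "h = (\<Sum>j. if J j then 0 else ennreal (c j) * ennreal (C2 * a j powr (1 / q)))"
  have [measurable]: "y j \<in> borel_measurable borel" for j
    unfolding y_def by measurable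
  have g_meas: "g \<in> borel_measurable borel"
    unfolding g_def by measurable
  have w_le: "w j \<le> ennreal (c j * profile p q (a j) t)" for j
    unfolding w_def J_def profile_def by simp
  show ?thesis
  proof (rule that[OF g_meas])
    fix x
    have "nn_potential d \<alpha> M u x \<le> (\<Sum>j. nn_potential d \<alpha> M (\<lambda>y. ennreal (c j) * indicator (E j) y) x)"
      using E(1) u by (intro nn_potential_suminf[OF sets(1)]) auto
    also have "\<dots> = (\<Sum>j. ennreal (c j) * nn_potential d \<alpha> M (indicator (E j)) x)"
      using E(1) by (simp add: nn_potential_cmult[OF sets(1)])
    also have "\<dots> \<le> (\<Sum>j. w j * y j x + (if J j then 0 else ennreal (c j) * ennreal (C2 * a j powr (1 / q))))"
    proof (intro suminf_le summableI)
      fix j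
      show "ennreal (c j) * nn_potential d \<alpha> M (indicator (E j)) x
          \<le> w j * y j x + (if J j then 0 else ennreal (c j) * ennreal (C2 * a j powr (1 / q)))"
      proof (cases "J j")
        case True
        then have "a j > 0" by (simp add: J_def)
        have "w j * y j x = ennreal (c j) * (epowr (ennreal (a j / t)) (1 / p) * y j x)"
          using True c \<open>a j > 0\<close> t by (simp add: w_def epowr_ennreal ennreal_mult mult.assoc)
        also have "epowr (ennreal (a j / t)) (1 / p) * y j x = epowr (ennreal (a j / t) * (ennreal (t / a j) * G j x)) (1 / p)"
          unfolding y_def using p by (simp add: epowr_mult)
        also have "ennreal (a j / t) * (ennreal (t / a j) * G j x) = G j x"
          using \<open>a j > 0\<close> t by (simp add: mult.assoc[symmetric] ennreal_mult[symmetric])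
        finally have "w j * y j x = ennreal (c j) * epowr (G j x) (1 / p)" .
        then show ?thesis
          using True G_ge by (simp add: mult_left_mono)
      next
        case False
        then show ?thesis
          using sup[OF E(1,3,2)] by (simp add: mult_left_mono w_def)
      qed
    qed
    also have "\<dots> = g x + h"
      unfolding g_def h_def by (rule suminf_add[symmetric]) auto
    finally show "nn_potential d \<alpha> M u x \<le> g x + h" .
  next
    \<comment> \<open>Since the normalised pieces share one bound, Hoelder's inequality with weights
      \<open>w j\<close> leaves \<open>C1 * t\<close> times the p-th power of the sum of the
      weights.\<close>
    have "(\<integral>\<^sup>+ x. epowr (g x) p \<partial>N) \<le> (\<integral>\<^sup>+ x. epowr (\<Sum>j. w j) (p - 1) * (\<Sum>j. w j * epowr (y j x) p) \<partial>N)"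
      unfolding g_def by (intro nn_integral_mono epowr_suminf_le p)
    also have "\<dots> = epowr (\<Sum>j. w j) (p - 1) * (\<integral>\<^sup>+ x. (\<Sum>j. w j * epowr (y j x) p) \<partial>N)"
      unfolding nn_integral_cmult[symmetric] by (rule nn_integral_cmult) (simp add: measurable_cong_sets[OF sets(2) refl])
    also have "(\<integral>\<^sup>+ x. (\<Sum>j. w j * epowr (y j x) p) \<partial>N) = (\<Sum>j. w j * (\<integral>\<^sup>+ x. epowr (y j x) p \<partial>N))"
      by (subst nn_integral_suminf) (auto simp: measurable_cong_sets[OF sets(2) refl] nn_integral_cmult)
    also have "\<dots> \<le> (\<Sum>j. w j * ennreal (C1 * t))"
    proof (intro suminf_le summableI)
      fix j
      show "w j * (\<integral>\<^sup>+ x. epowr (y j x) p \<partial>N) \<le> w j * ennreal (C1 * t)"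
      proof (cases "J j")
        case True
        then have "a j > 0" by (simp add: J_def)
        have "(\<integral>\<^sup>+ x. epowr (y j x) p \<partial>N) = ennreal (t / a j) * (\<integral>\<^sup>+ x. G j x \<partial>N)"
          using p unfolding y_def by (simp add: epowr_epowr nn_integral_cmult measurable_cong_sets[OF sets(2) refl])
        also have "\<dots> \<le> ennreal (t / a j) * (ennreal C1 * ennreal (a j))"
          using int_G[of j] unfolding E(2) by (intro mult_left_mono) auto
        also have "\<dots> = ennreal (C1 * t)"
          using \<open>a j > 0\<close> t C by (simp flip: ennreal_mult)
        finally show ?thesis by (intro mult_left_mono) auto
      qed (simp add: w_def)
    qed
    also have "\<dots> = (\<Sum>j. w j) * ennreal (C1 * t)"
      by simp
    finally have "(\<integral>\<^sup>+ x. epowr (g x) p \<partial>N) \<le> epowr (\<Sum>j. w j) (p - 1) * ((\<Sum>j. w j) * ennreal (C1 * t))"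
      by (simp add: mult_left_mono)
    also have "\<dots> \<le> epowr ?A (p - 1) * (?A * ennreal (C1 * t))"
      using p w_le by (intro mult_mono epowr_mono suminf_le summableI) auto
    also have "\<dots> = ennreal (C1 * t) * epowr ?A p"
    proof -
      have "epowr z (p - 1) * z = epowr z p" for z
      proof (cases z)
        case (real r)
        then show ?thesis
          using powr_add[of r "p - 1" 1] by (simp add: epowr_ennreal flip: ennreal_mult)
      next
        case top
        then show ?thesis by (simp add: ennreal_top_mult)
      qed
      from this[of ?A] show ?thesis
        by (subst mult.assoc[symmetric]) (simp only: mult.commute)
    qed
    finally show "(\<integral>\<^sup>+ x. epowr (g x) p \<partial>N) \<le> ennreal (C1 * t) * epowr ?A p" .
  next
    have "h \<le> (\<Sum>j. ennreal C2 * ennreal (c j * profile p q (a j) t))"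
      unfolding h_def
    proof (intro suminf_le summableI)
      fix j
      \<comment> \<open>Outside \<open>J\<close> either \<open>a j = 0\<close>, and both sides
        vanish, or the minimum in the profile is its constant branch.\<close>
      have *: "a j powr (1 / q) \<le> profile p q (a j) t" if "\<not> J j"
        using that E(3)[of j] by (auto simp: J_def profile_def)
      then show "(if J j then 0 else ennreal (c j) * ennreal (C2 * a j powr (1 / q))) \<le> ennreal C2 * ennreal (c j * profile p q (a j) t)"
        (is "?l \<le> ?r")
      proof (cases "J j")
        case False
        have "?l = ennreal (C2 * (c j * a j powr (1 / q)))"
          using False c C by (simp add: mult.left_commute flip: ennreal_mult)
        also have "\<dots> \<le> ennreal (C2 * (c j * profile p q (a j) t))"
          using * False c C by (intro ennreal_leI mult_left_mono) auto
        also have "\<dots> = ?r"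
          using C c[of j] E(3)[of j] by (intro ennreal_mult) (auto simp: profile_def)
        finally show ?thesis .
      qed simp
    qed
    then show "h \<le> ennreal C2 * ?A" by simp
  qed
qed

lemma epowr_add_le_inverse:
  assumes "1 \<le> p"
  shows "epowr (x + y) (1 / p) \<le> 2 * (epowr x (1 / p) + epowr y (1 / p))"
proof -
  have "epowr (x + y) (1 / p) \<le> ennreal (2 powr (1 / p)) * (epowr x (1 / p) + epowr y (1 / p))"
    using assms by (intro epowr_add_le) simp
  also have "\<dots> \<le> ennreal 2 * (epowr x (1 / p) + epowr y (1 / p))"
    using assms powr_mono[of "1 / p" 1 2] by (intro mult_right_mono ennreal_leI) auto
  finally show ?thesis by simp
qed

text \<open>The constant \<open>h\<close> passes through the average over \<open>(0,t)\<close>, and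
  the average of the rest is at most the full integral divided by \<open>t\<close>. The factor
  \<open>t\<close> in the hypothesis on \<open>g\<close> cancels \<open>1 / t\<close>.\<close>

lemma max_rearr_potential_le:
  fixes N :: "'a::euclidean_space measure"
  assumes "sigma_finite_measure N" "sets N = sets borel" "1 < p" "0 < t" "0 < C1" "0 < C2"
    and g: "g \<in> borel_measurable borel" and F: "\<And>x. F x \<le> g x + h"
    and int_g: "(\<integral>\<^sup>+ x. epowr (g x) p \<partial>N) \<le> ennreal (C1 * t) * epowr A p" and h: "h \<le> ennreal C2 * A"
  shows "epowr (max_rearr N (\<lambda>x. epowr (F x) p) t) (1 / p) \<le> ennreal (4 * (C1 powr (1 / p) + C2)) * A"
proof -
  have [measurable]: "g \<in> borel_measurable N"
    using g unfolding measurable_cong_sets[OF assms(2) refl] .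
  let ?g = "\<lambda>x. ennreal (2 powr p) * epowr (g x) p" and ?h = "ennreal (2 powr p) * epowr h p"
  have le: "epowr (F x) p \<le> ?g x + ?h" for x
  proof -
    have "epowr (F x) p \<le> epowr (g x + h) p"
      using F \<open>1 < p\<close> by (intro epowr_mono) auto
    also have "\<dots> \<le> ennreal (2 powr p) * (epowr (g x) p + epowr h p)"
      using \<open>1 < p\<close> by (intro epowr_add_le) auto
    finally show ?thesis by (simp add: distrib_left)
  qed
  have "(\<integral>\<^sup>+ s \<in> {0<..<t}. rearr N (\<lambda>x. epowr (F x) p) s \<partial>lborel)
      \<le> (\<integral>\<^sup>+ s. rearr N ?g s * indicator {0<..} s + ?h * indicator {0<..<t} s \<partial>lborel)"
    using rearr_le_add_const[of N "\<lambda>x. epowr (F x) p" ?g ?h, OF le] by (intro nn_integral_mono) (auto split: split_indicator)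
  also have "\<dots> = (\<integral>\<^sup>+ s \<in> {0<..}. rearr N ?g s \<partial>lborel) + ?h * ennreal t"
    using \<open>0 < t\<close> by (subst nn_integral_add) (auto simp: nn_integral_cmult_indicator)
  also have "\<dots> \<le> (\<integral>\<^sup>+ x. ?g x \<partial>N) + ?h * ennreal t"
    by (intro add_right_mono nn_integral_rearr_le assms) measurable
  also have "(\<integral>\<^sup>+ x. ?g x \<partial>N) = ennreal (2 powr p) * (\<integral>\<^sup>+ x. epowr (g x) p \<partial>N)"
    by (intro nn_integral_cmult) measurable
  also have "\<dots> + ?h * ennreal t \<le> ennreal (2 powr p) * (ennreal (C1 * t) * epowr A p) + ennreal (2 powr p) * epowr (ennreal C2 * A) p * ennreal t"
    using int_g h \<open>1 < p\<close> by (intro add_mono mult_left_mono mult_right_mono epowr_mono) auto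
  also have "\<dots> = ennreal t * (epowr (ennreal (2 * C1 powr (1 / p)) * A) p + epowr (ennreal (2 * C2) * A) p)"
    using assms epowr_ennreal[of 2 p]
    by (simp add: epowr_mult epowr_ennreal powr_mult powr_powr ennreal_mult distrib_left mult_ac)
  finally have "max_rearr N (\<lambda>x. epowr (F x) p) t
      \<le> ennreal (1 / t) * (ennreal t * (epowr (ennreal (2 * C1 powr (1 / p)) * A) p + epowr (ennreal (2 * C2) * A) p))"
    unfolding max_rearr_def by (intro mult_left_mono) auto
  also have "\<dots> = epowr (ennreal (2 * C1 powr (1 / p)) * A) p + epowr (ennreal (2 * C2) * A) p"
    using \<open>0 < t\<close> by (simp add: mult.assoc[symmetric] ennreal_mult[symmetric])
  finally have "epowr (max_rearr N (\<lambda>x. epowr (F x) p) t) (1 / p)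
      \<le> epowr (epowr (ennreal (2 * C1 powr (1 / p)) * A) p + epowr (ennreal (2 * C2) * A) p) (1 / p)"
    using \<open>1 < p\<close> by (intro epowr_mono) auto
  also have "\<dots> \<le> 2 * (epowr (epowr (ennreal (2 * C1 powr (1 / p)) * A) p) (1 / p) + epowr (epowr (ennreal (2 * C2) * A) p) (1 / p))"
    using \<open>1 < p\<close> by (intro epowr_add_le_inverse) auto
  also have "\<dots> = 2 * (ennreal (2 * C1 powr (1 / p)) * A + ennreal (2 * C2) * A)"
    using \<open>1 < p\<close> by (simp add: epowr_epowr)
  also have "\<dots> = ennreal 2 * (ennreal (2 * C1 powr (1 / p)) + ennreal (2 * C2)) * A"
    by (simp add: distrib_right mult.assoc)
  also have "ennreal 2 * (ennreal (2 * C1 powr (1 / p)) + ennreal (2 * C2)) = ennreal (2 * (2 * C1 powr (1 / p) + 2 * C2))"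
  proof -
    have "ennreal 2 * (ennreal u + ennreal v) = ennreal (2 * (u + v))" if "0 \<le> u" "0 \<le> v" for u v
      unfolding ennreal_plus[OF that, symmetric] using that by (intro ennreal_mult[symmetric]) auto
    then show ?thesis using assms by simp
  qed
  also have "2 * (2 * C1 powr (1 / p) + 2 * C2) = 4 * (C1 powr (1 / p) + C2)"
    by simp
  finally show ?thesis .
qed

text \<open>One finite value \<open>A\<close> of the majorant is enough: it makes \<open>h\<close>
  finite and gives \<open>g\<close> a finite p-th moment.\<close>

lemma potential_finite_AE:
  fixes N :: "'a::euclidean_space measure"
  assumes "sets N = sets borel" "0 < p" and g: "g \<in> borel_measurable borel" and F: "\<And>x. F x \<le> g x + h"
    and int_g: "(\<integral>\<^sup>+ x. epowr (g x) p \<partial>N) \<le> ennreal c1 * epowr A p" and h: "h \<le> ennreal c2 * A" and A: "A < \<infinity>"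
  shows "AE x in N. F x < \<infinity>"
proof -
  have [measurable]: "g \<in> borel_measurable N"
    using g unfolding measurable_cong_sets[OF assms(1) refl] .
  have "h < \<infinity>"
    using h A by (auto simp: ennreal_mult_less_top intro: le_less_trans)
  have "epowr A p < \<infinity>"
    using A epowr_eq_top_iff[of A p] by (simp add: top.not_eq_extremum[symmetric])
  then have "ennreal c1 * epowr A p < \<infinity>"
    by (simp add: ennreal_mult_less_top)
  with int_g have "(\<integral>\<^sup>+ x. epowr (g x) p \<partial>N) \<noteq> \<infinity>"
    by (auto simp: top_unique)
  then have "AE x in N. epowr (g x) p \<noteq> \<infinity>"
    by (intro nn_integral_noteq_infinite) measurable
  then show ?thesis
  proof eventually_elim
    case (elim x)
    then have "g x + h < \<infinity>"
      using \<open>h < \<infinity>\<close> by (auto simp: less_top[symmetric])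
    then show ?case
      using F by (rule le_less_trans[rotated])
  qed
qed

section \<open>Lower bounds for the norms of characteristic functions\<close>

lemma nnabs_indicator: "nnabs (indicator E) = (indicator E :: 'a \<Rightarrow> ennreal)"
  by (auto simp: nnabs_def fun_eq_iff split: split_indicator)

text \<open>If \<open>g + h = 1\<close> on \<open>E\<close>, one of the two has modulus at least 1/2
  on a subset with at least half the measure of \<open>E\<close>. The entries of the minimum bound
  the norm of \<open>g\<close> or of \<open>h\<close> in the respective case.\<close>

lemma sum_norm_indicator_ge:
  assumes E: "E \<in> sets M" "emeasure M E = ennreal a" and "0 < a" "1 < p" "0 < q"
  shows "ennreal (min ((a / 2) powr (1 / p) / 2) ((a / 4) powr (1 / q) / 2))
    \<le> sum_norm M (Lp_norm M p) (weak_Lq_norm M q) (indicator E)"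
  unfolding sum_norm_def
proof (intro INF_greatest, clarify)
  fix g h :: "'a \<Rightarrow> real"
  assume g [measurable]: "g \<in> borel_measurable M" and h [measurable]: "h \<in> borel_measurable M"
    and gh: "\<forall>x\<in>space M. indicator E x = g x + h x"
  note [measurable] = E(1)
  define A1 where "A1 = {x \<in> space M. x \<in> E \<and> 1 / 2 \<le> \<bar>g x\<bar>}"
  define A2 where "A2 = {x \<in> space M. x \<in> E \<and> 1 / 2 \<le> \<bar>h x\<bar>}"
  have [measurable]: "A1 \<in> sets M" "A2 \<in> sets M"
    unfolding A1_def A2_def by measurable
  have "E \<subseteq> A1 \<union> A2"
  proof
    fix x assume "x \<in> E"
    then have "x \<in> space M" using sets.sets_into_space[OF E(1)] by auto
    then have "g x + h x = 1" using gh \<open>x \<in> E\<close> by auto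
    then have "1 / 2 \<le> \<bar>g x\<bar> \<or> 1 / 2 \<le> \<bar>h x\<bar>" by arith
    then show "x \<in> A1 \<union> A2"
      using \<open>x \<in> E\<close> \<open>x \<in> space M\<close> by (auto simp: A1_def A2_def)
  qed
  then have "emeasure M E \<le> emeasure M (A1 \<union> A2)"
    by (intro emeasure_mono) auto
  also have "\<dots> \<le> emeasure M A1 + emeasure M A2"
    by (intro emeasure_subadditive) auto
  finally have le: "ennreal a \<le> emeasure M A1 + emeasure M A2"
    by (simp add: E(2))
  have "ennreal (a / 2) \<le> emeasure M A1 \<or> ennreal (a / 2) \<le> emeasure M A2"
  proof (rule ccontr)
    assume "\<not> ?thesis"
    then have "emeasure M A1 + emeasure M A2 < ennreal (a / 2) + ennreal (a / 2)"
      by (intro add_strict_mono) auto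
    also have "\<dots> = ennreal a" using \<open>0 < a\<close> by (simp flip: ennreal_plus)
    finally show False using le by simp
  qed
  then show "ennreal (min ((a / 2) powr (1 / p) / 2) ((a / 4) powr (1 / q) / 2))
      \<le> Lp_norm M p (nnabs g) + weak_Lq_norm M q (nnabs h)"
  proof
    assume A1: "ennreal (a / 2) \<le> emeasure M A1"
    have "ennreal ((1 / 2) powr p) * ennreal (a / 2) \<le> ennreal ((1 / 2) powr p) * emeasure M A1"
      by (intro mult_left_mono A1) simp
    also have "\<dots> = (\<integral>\<^sup>+ x. ennreal ((1 / 2) powr p) * indicator A1 x \<partial>M)"
      by (rule nn_integral_cmult_indicator[symmetric]) simp
    also have "\<dots> \<le> (\<integral>\<^sup>+ x. epowr (nnabs g x) p \<partial>M)"
      using \<open>1 < p\<close> by (intro nn_integral_mono) (auto simp: A1_def nnabs_def epowr_ennreal intro!: powr_mono2 split: split_indicator)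
    finally have "epowr (ennreal ((1 / 2) powr p) * ennreal (a / 2)) (1 / p) \<le> Lp_norm M p (nnabs g)"
      unfolding Lp_norm_def using \<open>1 < p\<close> by (intro epowr_mono) auto
    also have "epowr (ennreal ((1 / 2) powr p) * ennreal (a / 2)) (1 / p) = ennreal ((a / 2) powr (1 / p) / 2)"
    proof -
      have "epowr (ennreal ((1 / 2) powr p)) (1 / p) = ennreal (1 / 2)"
        using \<open>1 < p\<close> by (simp only: epowr_ennreal powr_ge_zero powr_powr) simp
      moreover have "epowr (ennreal (a / 2)) (1 / p) = ennreal ((a / 2) powr (1 / p))"
        using \<open>0 < a\<close> by (simp add: epowr_ennreal)
      ultimately have "epowr (ennreal ((1 / 2) powr p) * ennreal (a / 2)) (1 / p) = ennreal (1 / 2) * ennreal ((a / 2) powr (1 / p))"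
        using \<open>1 < p\<close> by (subst epowr_mult) simp_all
      also have "\<dots> = ennreal (1 / 2 * (a / 2) powr (1 / p))"
        by (intro ennreal_mult[symmetric]) auto
      finally show ?thesis by simp
    qed
    finally have "ennreal (min ((a / 2) powr (1 / p) / 2) ((a / 4) powr (1 / q) / 2)) \<le> Lp_norm M p (nnabs g)"
      by (rule order_trans[rotated]) (intro ennreal_leI, simp)
    then show ?thesis by (rule add_increasing2[rotated]) simp
  next
    assume A2: "ennreal (a / 2) \<le> emeasure M A2"
    have [measurable]: "nnabs h \<in> borel_measurable M"
      unfolding nnabs_def by measurable
    \<comment> \<open>The argument \<open>a / 4\<close> lies strictly below \<open>a / 2\<close>, as
      the strict inequality in \<open>le_rearr\<close> demands.\<close>
    have "l \<le> rearr M (nnabs h) (a / 4)" if "l < ennreal (1 / 2)" for l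
    proof (rule le_rearr)
      have "ennreal (a / 4) < ennreal (a / 2)" using \<open>0 < a\<close> by (simp add: ennreal_less_iff)
      also note A2
      also have "emeasure M A2 \<le> dist_fun M (nnabs h) l"
        unfolding dist_fun_def
      proof (intro emeasure_mono subsetI CollectI conjI)
        fix x assume "x \<in> A2"
        then have "x \<in> space M" "1 / 2 \<le> \<bar>h x\<bar>" by (auto simp: A2_def)
        then show "x \<in> space M" "l < nnabs h x"
          unfolding nnabs_def by (auto simp only: intro!: less_le_trans[OF that] ennreal_leI)
      qed measurable
      finally show "ennreal (a / 4) < dist_fun M (nnabs h) l" .
    qed measurable
    then have "ennreal (1 / 2) \<le> rearr M (nnabs h) (a / 4)"
      by (rule dense_le)
    then have "ennreal ((a / 4) powr (1 / q)) * ennreal (1 / 2) \<le> ennreal ((a / 4) powr (1 / q)) * rearr M (nnabs h) (a / 4)"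
      by (intro mult_left_mono) auto
    also have "\<dots> \<le> weak_Lq_norm M q (nnabs h)"
      unfolding weak_Lq_norm_def using \<open>0 < a\<close> by (intro SUP_upper) simp
    finally have "ennreal ((a / 4) powr (1 / q) / 2) \<le> weak_Lq_norm M q (nnabs h)"
      by (subst (asm) ennreal_mult[symmetric]) auto
    then have "ennreal (min ((a / 2) powr (1 / p) / 2) ((a / 4) powr (1 / q) / 2)) \<le> weak_Lq_norm M q (nnabs h)"
      by (rule order_trans[rotated]) (intro ennreal_leI, simp)
    then show ?thesis by (rule add_increasing[rotated]) simp
  qed
qed

text \<open>As \<open>1 / q < 1 / p\<close>, for \<open>a0 \<le> a\<close> both entries of the
  minimum in \<open>sum_norm_indicator_ge\<close> are at least a multiple of
  \<open>a powr (1 / q)\<close>. This serves for sets of large measure: when the target measure is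
  finite, and to make the fundamental function unbounded.\<close>

lemma powr_le_norm_indicator:
  assumes "\<forall>f\<in>borel_measurable M. sum_norm M (Lp_norm M p) (weak_Lq_norm M q) f \<le> ennreal C * X (nnabs f)"
    and "0 < C" "0 < a0" "1 < p" "p < q"
  obtains C' where "0 < C'" "\<And>E a. E \<in> sets M \<Longrightarrow> emeasure M E = ennreal a \<Longrightarrow> a0 \<le> a \<Longrightarrow>
    ennreal (a powr (1 / q)) \<le> ennreal C' * X (indicator E)"
proof -
  define \<kappa> where "\<kappa> = min ((1 / 2) powr (1 / p) * a0 powr (1 / p - 1 / q) / 2) ((1 / 4) powr (1 / q) / 2)"
  have \<kappa>: "\<kappa> > 0" using assms by (simp add: \<kappa>_def)
  have "ennreal (a powr (1 / q)) \<le> ennreal (C / \<kappa>) * X (indicator E)"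
    if E: "E \<in> sets M" "emeasure M E = ennreal a" and "a0 \<le> a" for E a
  proof -
    have "a > 0" using that assms by simp
    have "a0 powr (1 / p - 1 / q) \<le> a powr (1 / p - 1 / q)"
      using assms \<open>a0 \<le> a\<close> by (intro powr_mono2) (auto simp: field_simps)
    then have "a0 powr (1 / p - 1 / q) * a powr (1 / q) \<le> a powr (1 / p - 1 / q) * a powr (1 / q)"
      by (intro mult_right_mono) auto
    also have "\<dots> = a powr (1 / p)"
      by (simp flip: powr_add)
    finally have "(1 / 2) powr (1 / p) * (a0 powr (1 / p - 1 / q) * a powr (1 / q)) / 2 \<le> (1 / 2) powr (1 / p) * a powr (1 / p) / 2"
      by (intro divide_right_mono mult_left_mono) auto
    also have "\<dots> = (a / 2) powr (1 / p) / 2"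
      using powr_mult[of "1 / 2" a "1 / p"] \<open>a > 0\<close> by simp
    finally have 1: "(1 / 2) powr (1 / p) * a0 powr (1 / p - 1 / q) / 2 * a powr (1 / q) \<le> (a / 2) powr (1 / p) / 2"
      by (simp add: mult.assoc)
    have 2: "(1 / 4) powr (1 / q) / 2 * a powr (1 / q) = (a / 4) powr (1 / q) / 2"
      using powr_mult[of "1 / 4" a "1 / q"] \<open>a > 0\<close> by simp
    have "\<kappa> * a powr (1 / q) \<le> min ((a / 2) powr (1 / p) / 2) ((a / 4) powr (1 / q) / 2)"
    proof (rule min.boundedI)
      have "\<kappa> * a powr (1 / q) \<le> (1 / 2) powr (1 / p) * a0 powr (1 / p - 1 / q) / 2 * a powr (1 / q)"
        unfolding \<kappa>_def by (intro mult_right_mono) auto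
      with 1 show "\<kappa> * a powr (1 / q) \<le> (a / 2) powr (1 / p) / 2" by linarith
      have "\<kappa> * a powr (1 / q) \<le> (1 / 4) powr (1 / q) / 2 * a powr (1 / q)"
        unfolding \<kappa>_def by (intro mult_right_mono) auto
      with 2 show "\<kappa> * a powr (1 / q) \<le> (a / 4) powr (1 / q) / 2" by linarith
    qed
    then have "ennreal (\<kappa> * a powr (1 / q)) \<le> ennreal (min ((a / 2) powr (1 / p) / 2) ((a / 4) powr (1 / q) / 2))"
      by (rule ennreal_leI)
    also have "\<dots> \<le> sum_norm M (Lp_norm M p) (weak_Lq_norm M q) (indicator E)"
      using E \<open>a > 0\<close> assms by (intro sum_norm_indicator_ge) auto
    also have "\<dots> \<le> ennreal C * X (nnabs (indicator E))"
      using E by (intro assms(1)[rule_format] borel_measurable_indicator)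
    finally have "ennreal (1 / \<kappa>) * ennreal (\<kappa> * a powr (1 / q)) \<le> ennreal (1 / \<kappa>) * (ennreal C * X (indicator E))"
      unfolding nnabs_indicator by (intro mult_left_mono) auto
    also have "ennreal (1 / \<kappa>) * ennreal (\<kappa> * a powr (1 / q)) = ennreal (a powr (1 / q))"
      using \<kappa> by (simp flip: ennreal_mult)
    also have "ennreal (1 / \<kappa>) * (ennreal C * X (indicator E)) = ennreal (C / \<kappa>) * X (indicator E)"
      using \<kappa> assms(2) by (simp add: mult.assoc[symmetric] ennreal_mult[symmetric])
    finally show ?thesis .
  qed
  moreover have "C / \<kappa> > 0" using \<kappa> assms by simp
  ultimately show ?thesis by (intro that) auto
qed

lemma norm_indicator_eq_fundamental:
  assumes "ri_representation M X Xbar" and E: "E \<in> sets M" "emeasure M E = ennreal a" and "0 \<le> a"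
  shows "X (indicator E) = fundamental Xbar a"
proof -
  have N: "ri_norm (lborel_ivl (emeasure M (space M))) Xbar"
    and eq: "X (indicator E) = Xbar (rearr M (indicator E))"
    using assms by (auto simp: ri_representation_def)
  have "AE t in lborel_ivl (emeasure M (space M)). rearr M (indicator E) t = indicator {0<..<a} t"
    using rearr_indicator[OF E \<open>0 \<le> a\<close>] by (intro AE_I2) (auto simp: space_lborel_ivl ivl_def)
  then show ?thesis
    unfolding eq fundamental_def by (intro ri_norm_cong[OF N]) (auto intro: measurable_lborel_ivl)
qed

section \<open>The norm of a profile in the target space\<close>

lemma R_op_indicator:
  assumes "0 \<le> a" "ennreal a \<le> b" "0 < t" "0 < p"
  shows "R_op p q (extend0 (ivl b) (indicator {0<..<a})) t = ennreal ((min (t powr (q / (q - p))) a / t) powr (1 / p))"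
proof -
  let ?T = "t powr (q / (q - p))"
  have "extend0 (ivl b) (indicator {0<..<a}) = indicator {0<..<a}"
    using ivl_subset[OF assms(1,2)] by (auto simp: extend0_def fun_eq_iff split: split_indicator)
  then have e: "nnabs (extend0 (ivl b) (indicator {0<..<a})) = indicator {0<..<a}"
    by (simp add: nnabs_indicator)
  have sub: "{0<..<a} \<subseteq> ivl \<infinity>"
    by (auto simp: ivl_def)
  have r: "rearr (lborel_ivl \<infinity>) (indicator {0<..<a}) s = indicator {0<..<a} s" if "0 < s" for s
    using assms that sub by (intro rearr_indicator sets_lborel_ivl) (auto simp: emeasure_lborel_ivl)
  have "(\<integral>\<^sup>+ s \<in> {0<..<?T}. epowr (rearr (lborel_ivl \<infinity>) (indicator {0<..<a}) s) p \<partial>lborel)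
      = (\<integral>\<^sup>+ s. indicator {0<..<min ?T a} s \<partial>lborel)"
    by (intro nn_integral_cong) (auto simp: r[unfolded infinity_ennreal_def] split: split_indicator)
  also have "\<dots> = ennreal (min ?T a)"
    using assms by simp
  finally show ?thesis
    unfolding R_op_def e using assms by (simp add: epowr_ennreal flip: ennreal_mult)
qed

text \<open>Beyond \<open>T = a powr (1 / r)\<close> the profile is the image \<open>g\<close> of a
  characteristic function under \<open>R_op\<close>. Its constant part on \<open>(0,T)\<close> is
  moved by rearrangement invariance to \<open>(T,2 * T)\<close>, where \<open>g\<close> is at least
  half the constant. If \<open>(0,b)\<close> is too short for this, then \<open>b\<close> is finite
  and \<open>a\<close> is bounded below, so the inclusion of the space of \<open>X\<close>
  applies.\<close>

lemma profile_norm_le: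
  fixes M :: "'a measure" and Xbar Ybar :: "(real \<Rightarrow> ennreal) \<Rightarrow> ennreal"
  assumes p: "1 < p" "p < q" and X: "ri_representation M X Xbar" and Y: "ri_norm (lborel_ivl b) Ybar"
    and R: "bounded_operator (lborel_ivl (emeasure M (space M))) Xbar Ybar (\<lambda>g. R_op p q (extend0 (ivl (emeasure M (space M))) g))"
    and sub: "\<exists>C>0. \<forall>f\<in>borel_measurable M. sum_norm M (Lp_norm M p) (weak_Lq_norm M q) f \<le> ennreal C * X (nnabs f)"
    and "0 < b"
  obtains C where "0 < C" "\<And>E a. E \<in> sets M \<Longrightarrow> emeasure M E = ennreal a \<Longrightarrow> 0 < a \<Longrightarrow>
    Ybar (\<lambda>t. ennreal (profile p q a t)) \<le> ennreal C * X (indicator E)"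
proof -
  let ?b = "emeasure M (space M)"
  have NX: "ri_norm M X" using X by (simp add: ri_representation_def)
  obtain C1 where C1: "C1 > 0" "\<And>g. g \<in> borel_measurable (lborel_ivl ?b) \<Longrightarrow> Xbar (nnabs g) < \<infinity> \<Longrightarrow>
      Ybar (R_op p q (extend0 (ivl ?b) g)) \<le> ennreal C1 * Xbar (nnabs g)"
    using R by (auto simp: bounded_operator_def)
  obtain C2 where C2: "C2 > 0" "\<forall>f\<in>borel_measurable M. sum_norm M (Lp_norm M p) (weak_Lq_norm M q) f \<le> ennreal C2 * X (nnabs f)"
    using sub by blast
  define r where "r = q / (q - p)"
  have r: "r > 0" using p by (simp add: r_def)
  \<comment> \<open>This identity makes the two branches of the profile meet at
    \<open>a powr (1 / r)\<close>.\<close>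
  have r1: "(1 - 1 / r) / p = 1 / q"
    using p by (simp add: r_def field_simps)
  \<comment> \<open>The case of a short interval: for \<open>b = ennreal c\<close> the number
    \<open>a\<close> is at least \<open>(c / 2) powr r\<close>, and
    \<open>powr_le_norm_indicator\<close> applies with this lower bound. For infinite
    \<open>b\<close> the case is empty.\<close>
  have finite_b: "\<exists>C>0. \<forall>E a. E \<in> sets M \<longrightarrow> emeasure M E = ennreal a \<longrightarrow> 0 < a \<longrightarrow> b < ennreal (2 * a powr (1 / r)) \<longrightarrow>
      ennreal (a powr (1 / q)) * Ybar (indicator (ivl b)) \<le> ennreal C * X (indicator E)"
  proof (cases "b < \<infinity>")
    case True
    then obtain c where c: "b = ennreal c" "c > 0"
      using \<open>0 < b\<close> by (cases b) auto
    have "Ybar (indicator (ivl b)) < \<infinity>"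
      using True by (intro ri_norm_indicator[OF Y]) (auto simp: sets_lborel_ivl sets_ivl emeasure_lborel_ivl emeasure_ivl)
    then obtain k where k: "Ybar (indicator (ivl b)) = ennreal k" "0 \<le> k"
      by (cases "Ybar (indicator (ivl b))") auto
    obtain C3 where C3: "0 < C3" "\<And>E a. E \<in> sets M \<Longrightarrow> emeasure M E = ennreal a \<Longrightarrow> (c / 2) powr r \<le> a \<Longrightarrow>
        ennreal (a powr (1 / q)) \<le> ennreal C3 * X (indicator E)"
      by (rule powr_le_norm_indicator[OF C2(2,1) _ p, of "(c / 2) powr r"]) (use c in auto)
    show ?thesis
    proof (intro exI[of _ "C3 * (k + 1)"] conjI allI impI)
      fix E a assume E: "E \<in> sets M" "emeasure M E = ennreal a" and "0 < a" and "b < ennreal (2 * a powr (1 / r))"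
      then have "c / 2 \<le> a powr (1 / r)"
        using c by (simp add: ennreal_less_iff)
      then have "(c / 2) powr r \<le> (a powr (1 / r)) powr r"
        using c r by (intro powr_mono2) auto
      then have "(c / 2) powr r \<le> a"
        using r \<open>0 < a\<close> by (simp add: powr_powr)
      from C3(2)[OF E this] have "ennreal (a powr (1 / q)) * ennreal k \<le> (ennreal C3 * X (indicator E)) * ennreal (k + 1)"
        using k by (intro mult_mono) (auto intro: ennreal_leI)
      then show "ennreal (a powr (1 / q)) * Ybar (indicator (ivl b)) \<le> ennreal (C3 * (k + 1)) * X (indicator E)"
        using k C3(1) by (simp add: ennreal_mult mult_ac)
    qed (use C3 k in simp)
  next
    case False
    then have "b = top" by (simp add: less_top[symmetric])
    then show ?thesis by (intro exI[of _ 1]) auto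
  qed
  then obtain C4 where C4: "C4 > 0" "\<And>E a. E \<in> sets M \<Longrightarrow> emeasure M E = ennreal a \<Longrightarrow> 0 < a \<Longrightarrow> b < ennreal (2 * a powr (1 / r)) \<Longrightarrow>
      ennreal (a powr (1 / q)) * Ybar (indicator (ivl b)) \<le> ennreal C4 * X (indicator E)"
    by blast
  have "Ybar (\<lambda>t. ennreal (profile p q a t)) \<le> ennreal (3 * C1 + C4) * X (indicator E)"
    if E: "E \<in> sets M" "emeasure M E = ennreal a" and "0 < a" for E a
  proof -
    define T where "T = a powr (1 / r)"
    have T: "T > 0" "T powr r = a" "(a / T) powr (1 / p) = a powr (1 / q)"
    proof -
      show "T > 0" "T powr r = a" using \<open>0 < a\<close> r by (simp_all add: T_def powr_powr)
      have "a / T = a powr (1 - 1 / r)"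
        using \<open>0 < a\<close> by (simp add: T_def powr_diff)
      then show "(a / T) powr (1 / p) = a powr (1 / q)"
        using r1 by (simp add: powr_powr)
    qed
    define g where "g t = ennreal ((min (t powr r) a / t) powr (1 / p))" for t
    have ivl_pos: "0 < t" if "t \<in> ivl b" for t
      using that by (simp add: ivl_def)
    have meas_ivl: "f \<in> borel_measurable borel \<Longrightarrow> f \<in> borel_measurable (lborel_ivl b)" for f :: "real \<Rightarrow> ennreal"
      by (rule measurable_lborel_ivl)
    have g: "g \<in> borel_measurable (lborel_ivl b)"
      unfolding g_def by (rule meas_ivl) measurable
    have Xa: "X (indicator E) = Xbar (indicator {0<..<a})"
      using norm_indicator_eq_fundamental[OF X E] \<open>0 < a\<close> by (simp add: fundamental_def)
    have a_le: "ennreal a \<le> ?b"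
      unfolding E(2)[symmetric] using E(1) by (intro emeasure_mono sets.sets_into_space) auto
    have fin: "Xbar (nnabs (indicator {0<..<a})) < \<infinity>"
      unfolding nnabs_indicator Xa[symmetric] using E by (intro ri_norm_indicator[OF NX]) auto
    have Rg: "R_op p q (extend0 (ivl ?b) (indicator {0<..<a})) t = g t" if "0 < t" for t
      using R_op_indicator[OF _ a_le that, of p q] \<open>0 < a\<close> p by (simp add: g_def r_def)
    have "R_op p q (extend0 (ivl ?b) (indicator {0<..<a})) \<in> borel_measurable (lborel_ivl b)"
      using g by (rule measurable_cong[THEN iffD2, rotated]) (use ivl_pos in \<open>auto simp: space_lborel_ivl Rg\<close>)
    then have "Ybar g = Ybar (R_op p q (extend0 (ivl ?b) (indicator {0<..<a})))"
      using g by (intro ri_norm_cong[OF Y]) (use ivl_pos in \<open>auto simp: space_lborel_ivl Rg intro!: AE_I2\<close>)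
    also have "\<dots> \<le> ennreal C1 * Xbar (nnabs (indicator {0<..<a}))"
      using fin by (intro C1(2) measurable_lborel_ivl) auto
    finally have Yg: "Ybar g \<le> ennreal C1 * X (indicator E)"
      by (simp add: nnabs_indicator Xa)
    have big: "g t = ennreal ((a / t) powr (1 / p))" if "T \<le> t" for t
      using that T r powr_mono2[of r T t] by (simp add: g_def min_absorb2)
    have split: "ennreal (profile p q a t) \<le> g t + ennreal (a powr (1 / q)) * indicator {0<..<T} t" if "0 < t" for t
    proof (cases "T \<le> t")
      case True
      then show ?thesis by (simp add: big profile_def ennreal_leI)
    next
      case False
      then show ?thesis using that by (auto simp: profile_def intro!: add_increasing ennreal_leI)
    qed
    have ind: "ennreal (a powr (1 / q)) * Ybar (indicator {0<..<T}) \<le> ennreal (2 * C1 + C4) * X (indicator E)"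
    proof (cases "b < ennreal (2 * T)")
      case True
      have "Ybar (indicator {0<..<T}) \<le> Ybar (indicator (ivl b))"
        by (intro ri_norm_mono[OF Y] meas_ivl AE_I2) (auto simp: space_lborel_ivl sets_ivl split: split_indicator)
      then have "ennreal (a powr (1 / q)) * Ybar (indicator {0<..<T}) \<le> ennreal (a powr (1 / q)) * Ybar (indicator (ivl b))"
        by (intro mult_left_mono) auto
      also have "\<dots> \<le> ennreal C4 * X (indicator E)"
        using C4(2)[OF E \<open>0 < a\<close>] True by (simp add: T_def)
      also have "\<dots> \<le> ennreal (2 * C1 + C4) * X (indicator E)"
        using C1(1) by (intro mult_right_mono ennreal_leI) auto
      finally show ?thesis .
    next
      case False
      then have "{0<..<2 * T} \<subseteq> ivl b"
        using T(1) by (intro ivl_subset) auto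
      then have subs: "{0<..<T} \<subseteq> ivl b" "{T<..<2 * T} \<subseteq> ivl b"
        using T(1) by (auto simp: subset_iff)
      \<comment> \<open>The distribution function of an indicator is the length of its set below
        level 1 and 0 from level 1 on, and both sets have length \<open>T\<close>.\<close>
      have "dist_fun (lborel_ivl b) (indicator {0<..<T}) l = dist_fun (lborel_ivl b) (indicator {T<..<2 * T}) l" for l
      proof -
        have "{x \<in> ivl b. l < (indicator A x :: ennreal)} = (if l < 1 then A else {})" if "A \<subseteq> ivl b" for A
          using that by (auto split: split_indicator_asm split_indicator)
        then show ?thesis
          unfolding dist_fun_def space_lborel_ivl using subs T(1) by (simp add: emeasure_lborel_ivl)
      qed
      then have "Ybar (indicator {0<..<T}) = Ybar (indicator {T<..<2 * T})"
        by (intro ri_norm_equimeasurable[OF Y] meas_ivl) auto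
      then have "ennreal (a powr (1 / q)) * Ybar (indicator {0<..<T}) = Ybar (\<lambda>t. ennreal (a powr (1 / q)) * indicator {T<..<2 * T} t)"
        by (subst ri_norm_cmult[OF Y]) (auto intro: meas_ivl)
      also have "\<dots> \<le> Ybar (\<lambda>t. ennreal 2 * g t)"
      proof (intro ri_norm_mono[OF Y] AE_I2)
        show "(\<lambda>t. ennreal 2 * g t) \<in> borel_measurable (lborel_ivl b)" using g by measurable
        show "(\<lambda>t. ennreal (a powr (1 / q)) * indicator {T<..<2 * T} t) \<in> borel_measurable (lborel_ivl b)"
          by (rule meas_ivl) measurable
        fix t
        have "a powr (1 / q) \<le> 2 * (a / t) powr (1 / p)" if "T < t" "t < 2 * T"
        proof -
          have "a / T \<le> 2 * (a / t)"
            using that T \<open>0 < a\<close> by (simp add: field_simps)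
          then have "(a / T) powr (1 / p) \<le> (2 * (a / t)) powr (1 / p)"
            using that T \<open>0 < a\<close> p by (intro powr_mono2) auto
          also have "\<dots> = 2 powr (1 / p) * (a / t) powr (1 / p)"
            by (rule powr_mult)
          also have "\<dots> \<le> 2 * (a / t) powr (1 / p)"
            using powr_mono[of "1 / p" 1 2] p by (intro mult_right_mono) auto
          finally show ?thesis by (simp add: T(3))
        qed
        then show "ennreal (a powr (1 / q)) * indicator {T<..<2 * T} t \<le> ennreal 2 * g t"
          by (auto simp: big ennreal_mult[symmetric] intro!: ennreal_leI split: split_indicator simp del: ennreal_numeral)
      qed
      also have "\<dots> = ennreal 2 * Ybar g"
        using g by (intro ri_norm_cmult[OF Y]) auto
      also have "\<dots> \<le> ennreal 2 * (ennreal C1 * X (indicator E))"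
        by (intro mult_left_mono Yg) auto
      also have "\<dots> = ennreal (2 * C1) * X (indicator E)"
        using C1(1) by (subst ennreal_mult) (auto simp: mult.assoc)
      also have "\<dots> \<le> ennreal (2 * C1 + C4) * X (indicator E)"
        using C4(1) by (intro mult_right_mono ennreal_leI) auto
      finally show ?thesis .
    qed
    have "Ybar (\<lambda>t. ennreal (profile p q a t)) \<le> Ybar (\<lambda>t. g t + ennreal (a powr (1 / q)) * indicator {0<..<T} t)"
    proof (intro ri_norm_mono[OF Y] AE_I2)
      show "(\<lambda>t. ennreal (profile p q a t)) \<in> borel_measurable (lborel_ivl b)"
        by (rule meas_ivl) measurable
      have "(\<lambda>t. ennreal (a powr (1 / q)) * indicator {0<..<T} t) \<in> borel_measurable (lborel_ivl b)"
        by (rule meas_ivl) measurable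
      with g show "(\<lambda>t. g t + ennreal (a powr (1 / q)) * indicator {0<..<T} t) \<in> borel_measurable (lborel_ivl b)"
        by measurable
    qed (auto simp: space_lborel_ivl ivl_def intro: split)
    also have "\<dots> \<le> Ybar g + Ybar (\<lambda>t. ennreal (a powr (1 / q)) * indicator {0<..<T} t)"
      by (intro ri_norm_add[OF Y] g meas_ivl) simp
    also have "Ybar (\<lambda>t. ennreal (a powr (1 / q)) * indicator {0<..<T} t) = ennreal (a powr (1 / q)) * Ybar (indicator {0<..<T})"
      by (intro ri_norm_cmult[OF Y] meas_ivl) auto
    also have "Ybar g + \<dots> \<le> ennreal C1 * X (indicator E) + ennreal (2 * C1 + C4) * X (indicator E)"
      by (intro add_mono Yg ind)
    also have "\<dots> = ennreal (3 * C1 + C4) * X (indicator E)"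
      using C1(1) C4(1) by (simp add: distrib_right[symmetric] ennreal_plus[symmetric] del: ennreal_plus)
    finally show ?thesis .
  qed
  moreover have "3 * C1 + C4 > 0" using C1 C4 by simp
  ultimately show ?thesis by (intro that) auto
qed

section \<open>The Lorentz endpoint space\<close>

lemma concave_on_slope_le:
  fixes f :: "real \<Rightarrow> real"
  assumes f: "concave_on I f" and I: "x \<in> I" "y \<in> I" and t: "x < t" "t < y"
  shows "(f y - f x) / (y - x) \<le> (f t - f x) / (t - x)"
    and "(f y - f t) / (y - t) \<le> (f y - f x) / (y - x)"
proof -
  have c: "convex_on I (\<lambda>x. - f x)" using f by (simp add: concave_on_def)
  have e: "(- f u - - f v) / (u - v) = - ((f v - f u) / (v - u))" for u v
    by (subst minus_diff_eq[symmetric, of v u], subst divide_minus_right) simp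
  show "(f y - f x) / (y - x) \<le> (f t - f x) / (t - x)" "(f y - f t) / (y - t) \<le> (f y - f x) / (y - x)"
    using convex_on_slope_le[OF c I t] unfolding e by simp_all
qed

text \<open>The supremum \<open>R\<close> of the slopes to the right is decreasing, hence continuous
  off a countable set, and where it is continuous it is the derivative of \<open>f\<close>. At
  points where \<open>f\<close> is not differentiable \<open>deriv\<close> has no meaningful value,
  which is why a countable set is excepted.\<close>

lemma countable_concave_on_slope_not_le_deriv:
  fixes f :: "real \<Rightarrow> real"
  assumes f: "concave_on I f" and "open I"
  shows "countable {s \<in> I. \<exists>v\<in>I. s < v \<and> deriv f s < (f v - f s) / (v - s)}"
proof -
  define S where "S x y = (f y - f x) / (y - x)" for x y
  have S_sym: "S x y = S y x" for x y
    unfolding S_def using minus_divide_divide[of "f y - f x" "y - x"] by simp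
  have S1: "S x y \<le> S x t" and S2: "S t y \<le> S x y" if "x \<in> I" "y \<in> I" "x < t" "t < y" for x y t
    using concave_on_slope_le[OF f that] by (simp_all add: S_def)
  define R where "R s = (SUP v\<in>{v \<in> I. s < v}. S s v)" for s
  have left: "\<exists>u\<in>I. u < s" and right: "\<exists>v\<in>I. s < v" if s: "s \<in> I" for s
  proof -
    obtain e where "e > 0" "ball s e \<subseteq> I"
      using \<open>open I\<close>[unfolded open_contains_ball, rule_format, OF s] by blast
    moreover have "s - e / 2 \<in> ball s e" "s + e / 2 \<in> ball s e"
      using \<open>e > 0\<close> by (simp_all add: dist_real_def)
    ultimately have "s - e / 2 \<in> I" "s + e / 2 \<in> I" "s - e / 2 < s" "s < s + e / 2"
      using \<open>e > 0\<close> by auto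
    then show "\<exists>u\<in>I. u < s" "\<exists>v\<in>I. s < v"
      by blast+
  qed
  have S12: "S s v \<le> S u s" if "u \<in> I" "v \<in> I" "u < s" "s < v" for u s v
    using S1[OF that] S2[OF that] by linarith
  have le_R: "S s v \<le> R s" if "s \<in> I" "v \<in> I" "s < v" for s v
  proof -
    obtain u where "u \<in> I" "u < s" using left[OF \<open>s \<in> I\<close>] by blast
    then have "bdd_above (S s ` {v \<in> I. s < v})"
      using S12 by (intro bdd_aboveI2[of _ _ "S u s"]) auto
    then show ?thesis
      unfolding R_def using that by (intro cSUP_upper) auto
  qed
  have R_le: "R s \<le> S u s" if "s \<in> I" "u \<in> I" "u < s" for s u
    unfolding R_def using right[OF \<open>s \<in> I\<close>] S12 that by (intro cSUP_least) auto
  have "mono_on I (\<lambda>s. - R s)"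
  proof (rule mono_onI)
    fix r s assume "r \<in> I" "s \<in> I" "r \<le> s"
    then show "- R r \<le> - R s"
      using R_le[of s r] le_R[of r s] by (cases "r = s") auto
  qed
  then have "countable {s \<in> I. \<not> isCont (\<lambda>s. - R s) s}"
    by (rule mono_on_ctble_discont_open[OF \<open>open I\<close>])
  note ctble = this
  have le: "S s v \<le> deriv f s" if "s \<in> I" "isCont (\<lambda>s. - R s) s" "v \<in> I" "s < v" for s v
  proof -
    have cont: "(R \<longlongrightarrow> R s) (at s)"
      using that(2) by (simp add: isCont_def tendsto_minus_cancel_left)
    have I: "\<forall>\<^sub>F y in at s. y \<in> I \<and> y \<noteq> s"
      unfolding eventually_at_filter using eventually_nhds_in_open[OF \<open>open I\<close> \<open>s \<in> I\<close>]
      by (rule eventually_mono) simp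
    \<comment> \<open>The slope between \<open>s\<close> and \<open>y\<close> lies between the
      values of \<open>R\<close> at the two ends; the minimum and the maximum cover both positions
      of \<open>y\<close>.\<close>
    have bounds: "min (R y) (R s) \<le> S s y \<and> S s y \<le> max (R y) (R s)" if "y \<in> I" "y \<noteq> s" for y
    proof (cases "s < y")
      case True
      then show ?thesis
        using le_R[of s y] R_le[of y s] that \<open>s \<in> I\<close> by auto
    next
      case False
      then have "y < s" using that by simp
      then show ?thesis
        using le_R[of y s] R_le[of s y] that \<open>s \<in> I\<close> S_sym[of s y] by auto
    qed
    have "(S s \<longlongrightarrow> R s) (at s)"
    proof (rule tendsto_sandwich)
      show "((\<lambda>y. min (R y) (R s)) \<longlongrightarrow> R s) (at s)" "((\<lambda>y. max (R y) (R s)) \<longlongrightarrow> R s) (at s)"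
        using tendsto_min[OF cont tendsto_const[of "R s"]] tendsto_max[OF cont tendsto_const[of "R s"]] by simp_all
      show "\<forall>\<^sub>F y in at s. min (R y) (R s) \<le> S s y" "\<forall>\<^sub>F y in at s. S s y \<le> max (R y) (R s)"
        using I bounds by (auto elim!: eventually_mono)
    qed
    then have "(f has_real_derivative R s) (at s)"
      unfolding has_field_derivative_iff S_def .
    then have "deriv f s = R s" by (rule DERIV_imp_deriv)
    then show ?thesis using le_R that by simp
  qed
  show ?thesis
  proof (rule countable_subset[OF _ ctble], safe)
    fix s v assume "s \<in> I" "v \<in> I" "s < v" "deriv f s < (f v - f s) / (v - s)" "isCont (\<lambda>s. - R s) s"
    then show False using le[of s v] by (simp add: S_def)
  qed
qed

text \<open>The integral of the quotient telescopes to \<open>1 / h\<close> times the integral of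
  \<open>f\<close> over \<open>(a,a + h)\<close> minus that over \<open>(0,h)\<close>. By
  monotonicity the former is at least \<open>h * f a\<close>, the latter at most
  \<open>h * f h\<close>. Sums replace differences because the values lie in
  \<open>[0,\<infinity>]\<close>.\<close>

lemma nn_integral_difference_quotient_ge:
  fixes f :: "real \<Rightarrow> real"
  assumes mono: "mono f" and nonneg: "\<And>x. 0 \<le> f x" and "0 < a" "0 < h"
  shows "ennreal (f a) \<le> ennreal (f h) + (\<integral>\<^sup>+ s \<in> {0<..<a}. ennreal ((f (s + h) - f s) / h) \<partial>lborel)"
proof -
  have [measurable]: "f \<in> borel_measurable borel" using mono by (rule borel_measurable_mono)
  let ?I = "\<lambda>A. \<integral>\<^sup>+ s \<in> A. ennreal (f s) \<partial>lborel"
  let ?Q = "\<integral>\<^sup>+ s \<in> {0<..<a}. ennreal ((f (s + h) - f s) / h) \<partial>lborel"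
  have "?I {0<..<a} \<le> (\<integral>\<^sup>+ s \<in> {0<..<a}. ennreal (f a) \<partial>lborel)"
    using mono by (intro nn_integral_mono) (auto simp: monoD intro!: ennreal_leI split: split_indicator)
  also have "\<dots> < top"
    using \<open>0 < a\<close> by (simp add: nn_integral_cmult_indicator ennreal_mult_less_top)
  finally have fin: "?I {0<..<a} \<noteq> top" by simp
  \<comment> \<open>Translation by \<open>h\<close>: the integral over \<open>(h,a + h)\<close> is
    the one over \<open>(0,a)\<close> plus the increments.\<close>
  have "?I {h<..<a + h} = (\<integral>\<^sup>+ s. ennreal (f (h + 1 * s)) * indicator {h<..<a + h} (h + 1 * s) \<partial>lborel)"
    by (subst nn_integral_real_affine[where c = 1 and t = h]) simp_all
  also have "\<dots> = (\<integral>\<^sup>+ s. ennreal (f s) * indicator {0<..<a} s + ennreal h * (ennreal ((f (s + h) - f s) / h) * indicator {0<..<a} s) \<partial>lborel)"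
  proof (intro nn_integral_cong)
    fix s
    have "f s \<le> f (s + h)" using mono \<open>0 < h\<close> by (auto intro: monoD)
    then have "ennreal (f s) + ennreal h * ennreal ((f (s + h) - f s) / h) = ennreal (f (s + h))"
      using \<open>0 < h\<close> nonneg by (simp flip: ennreal_mult ennreal_plus)
    then show "ennreal (f (h + 1 * s)) * indicator {h<..<a + h} (h + 1 * s)
        = ennreal (f s) * indicator {0<..<a} s + ennreal h * (ennreal ((f (s + h) - f s) / h) * indicator {0<..<a} s)"
      by (simp add: add.commute split: split_indicator)
  qed
  also have "\<dots> = ?I {0<..<a} + ennreal h * ?Q"
    by (simp add: nn_integral_add nn_integral_cmult)
  finally have shift: "?I {h<..<a + h} = ?I {0<..<a} + ennreal h * ?Q" .
  have "?I {0<..<a} + ennreal h * ennreal (f a) = (\<integral>\<^sup>+ s. ennreal (f s) * indicator {0<..<a} s + ennreal (f a) * indicator {a<..<a + h} s \<partial>lborel)"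
    using \<open>0 < h\<close> by (simp add: nn_integral_add nn_integral_cmult_indicator mult.commute)
  \<comment> \<open>The comparison is made pointwise, so that overlapping and disjoint positions of
    \<open>(0,a)\<close> and \<open>(h,a + h)\<close> are treated at once.\<close>
  also have "\<dots> \<le> (\<integral>\<^sup>+ s. ennreal (f h) * indicator {0<..h} s + ennreal (f s) * indicator {h<..<a + h} s \<partial>lborel)"
  proof (intro nn_integral_mono)
    fix s
    consider "s \<le> 0" | "0 < s" "s < a" "s \<le> h" | "0 < s" "s < a" "h < s" | "a \<le> s" "s \<le> h" | "a \<le> s" "h < s" "s < a + h" | "a + h \<le> s"
      by linarith
    then show "ennreal (f s) * indicator {0<..<a} s + ennreal (f a) * indicator {a<..<a + h} s
        \<le> ennreal (f h) * indicator {0<..h} s + ennreal (f s) * indicator {h<..<a + h} s"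
      using \<open>0 < a\<close> \<open>0 < h\<close> by cases (auto split: split_indicator intro!: ennreal_leI monoD[OF mono])
  qed
  also have "\<dots> = ennreal h * ennreal (f h) + ?I {h<..<a + h}"
    using \<open>0 < h\<close> by (simp add: nn_integral_add nn_integral_cmult_indicator mult.commute)
  also have "\<dots> = ?I {0<..<a} + ennreal h * (ennreal (f h) + ?Q)"
    unfolding shift by (simp add: distrib_left ac_simps)
  finally have "ennreal h * ennreal (f a) \<le> ennreal h * (ennreal (f h) + ?Q)"
    using fin by (simp add: ennreal_add_left_cancel_le)
  then have ineq: "ennreal (1 / h) * (ennreal h * ennreal (f a)) \<le> ennreal (1 / h) * (ennreal h * (ennreal (f h) + ?Q))"
    by (rule mult_left_mono) simp
  have cancel: "ennreal (1 / h) * (ennreal h * x) = x" for x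
    using \<open>0 < h\<close> by (simp add: mult.assoc[symmetric] ennreal_mult[symmetric])
  show ?thesis using ineq unfolding cancel .
qed

lemma sum_powr_int_le:
  fixes F :: "int set"
  assumes "finite F" "\<And>k. k \<in> F \<Longrightarrow> k \<le> m"
  shows "(\<Sum>k\<in>F. (2::real) powr of_int k) \<le> 2 * 2 powr of_int m"
  using assms
proof (induction F arbitrary: m rule: finite_linorder_max_induct)
  case (insert b F)
  have "(\<Sum>k\<in>F. (2::real) powr of_int k) \<le> 2 * 2 powr of_int (b - 1)"
    using insert.hyps by (intro insert.IH) fastforce
  also have "\<dots> = 2 powr of_int b" by (simp add: powr_diff)
  finally have "(\<Sum>k\<in>insert b F. (2::real) powr of_int k) \<le> 2 * 2 powr of_int b"
    using insert by (subst sum.insert) auto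
  also have "\<dots> \<le> 2 * 2 powr of_int m"
    using insert by (simp add: powr_mono)
  finally show ?case .
qed simp

text \<open>Distinct powers of 2 add up to at most twice the largest one. The bound \<open>B\<close>
  will be the essential supremum or a value of the rearrangement.\<close>

lemma suminf_dyadic_le:
  fixes e :: "nat \<Rightarrow> int"
  assumes "inj e" and B: "\<And>k. P k \<Longrightarrow> ennreal (2 powr of_int k) \<le> B"
  shows "(\<Sum>j. ennreal (2 powr of_int (e j)) * (if P (e j) then 1 else 0)) \<le> 2 * B"
proof (rule suminf_le_const)
  fix n
  define F where "F = {k \<in> e ` {..<n}. P k}"
  have "(\<Sum>j<n. ennreal (2 powr of_int (e j)) * (if P (e j) then 1 else 0)) = (\<Sum>k\<in>e ` {..<n}. ennreal (2 powr of_int k) * (if P k then 1 else 0))"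
    using \<open>inj e\<close> by (subst sum.reindex) (auto intro: inj_on_subset)
  also have "\<dots> = (\<Sum>k\<in>F. ennreal (2 powr of_int k))"
    unfolding F_def by (intro sum.mono_neutral_cong_right) auto
  also have "\<dots> = ennreal (\<Sum>k\<in>F. 2 powr of_int k)"
    by (intro sum_ennreal) simp
  also have "\<dots> \<le> 2 * B"
  proof (cases "F = {}")
    case False
    have F: "finite F" by (simp add: F_def)
    have "ennreal (\<Sum>k\<in>F. 2 powr of_int k) \<le> ennreal (2 * 2 powr of_int (Max F))"
      using F by (intro ennreal_leI sum_powr_int_le) auto
    also have "\<dots> = 2 * ennreal (2 powr of_int (Max F))"
      by (simp add: ennreal_mult)
    also have "\<dots> \<le> 2 * B"
      using Max_in[OF F False] by (intro mult_left_mono B) (auto simp: F_def)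
    finally show ?thesis .
  qed simp
  finally show "(\<Sum>j<n. ennreal (2 powr of_int (e j)) * (if P (e j) then 1 else 0)) \<le> 2 * B" .
qed simp

section \<open>The fundamental function\<close>

lemma fundamental_mono:
  assumes "ri_norm (lborel_ivl b) N" "s \<le> t"
  shows "fundamental N s \<le> fundamental N t"
  unfolding fundamental_def using assms(2)
  by (intro ri_norm_mono[OF assms(1)] measurable_lborel_ivl AE_I2) (auto split: split_indicator)

lemma fundamental_finite:
  assumes N: "ri_norm (lborel_ivl b) N"
  shows "fundamental N t < \<infinity>"
proof -
  have "fundamental N t = N (indicator ({0<..<t} \<inter> ivl b))"
    unfolding fundamental_def
    by (intro ri_norm_cong[OF N] measurable_lborel_ivl AE_I2) (auto simp: space_lborel_ivl sets_ivl split: split_indicator)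
  also have "\<dots> < \<infinity>"
  proof (rule ri_norm_indicator[OF N])
    show "{0<..<t} \<inter> ivl b \<in> sets (lborel_ivl b)"
      by (intro sets_lborel_ivl) (auto simp: sets_ivl)
    have "emeasure (lborel_ivl b) ({0<..<t} \<inter> ivl b) = emeasure lborel ({0<..<t} \<inter> ivl b)"
      by (intro emeasure_lborel_ivl) auto
    also have "\<dots> \<le> emeasure lborel {0<..<t}"
      by (intro emeasure_mono) auto
    also have "\<dots> < \<infinity>"
      by (cases "0 \<le> t") auto
    finally show "emeasure (lborel_ivl b) ({0<..<t} \<inter> ivl b) < \<infinity>" .
  qed
  finally show ?thesis .
qed

text \<open>\<open>Lim\<close> is meaningful only once convergence is known; it follows from
  monotonicity, the limit being the infimum over positive arguments.\<close>

lemma fundamental_Lim: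
  assumes N: "ri_norm (lborel_ivl b) N"
  shows "(fundamental N \<longlongrightarrow> Lim (at_right 0) (fundamental N)) (at_right 0)"
proof -
  define L where "L = (INF t\<in>{0<..}. fundamental N t)"
  have "(fundamental N \<longlongrightarrow> L) (at_right 0)"
  proof (rule order_tendstoI)
    fix y assume "y < L"
    then have "y < fundamental N t" if "0 < t" for t
      using that unfolding L_def by (auto intro: less_le_trans INF_lower)
    then show "\<forall>\<^sub>F t in at_right 0. y < fundamental N t"
      by (auto simp: eventually_at_right_field intro: exI[of _ 1])
  next
    fix y assume "L < y"
    then obtain t where "0 < t" "fundamental N t < y"
      unfolding L_def by (auto simp: INF_less_iff)
    then show "\<forall>\<^sub>F t in at_right 0. fundamental N t < y"
      unfolding eventually_at_right_field
    proof (intro exI[of _ t] conjI allI impI)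
      fix u assume "0 < u" "u < t"
      then have "fundamental N u \<le> fundamental N t"
        by (intro fundamental_mono[OF N]) simp
      then show "fundamental N u < y"
        using \<open>fundamental N t < y\<close> by (rule le_less_trans)
    qed (rule \<open>0 < t\<close>)
  qed
  then show ?thesis
    using tendsto_Lim[of "at_right 0" "fundamental N" L] by simp
qed

text \<open>Left continuity of the fundamental function, from the Fatou property. It serves at the
  right end of the interval, where concavity on the open interval says nothing.\<close>

lemma fundamental_le_if_below:
  assumes N: "ri_norm (lborel_ivl b) N" and "0 < a" and le: "\<And>a'. 0 < a' \<Longrightarrow> a' < a \<Longrightarrow> fundamental N a' \<le> B"
  shows "fundamental N a \<le> B"
proof -
  \<comment> \<open>Increases to \<open>a\<close>; the denominators start at 2, so that already the
    first term is positive.\<close>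
  define u where "u n = a * (1 - inverse (real (Suc n + 1)))" for n
  have u: "0 < u n" "u n < a" for n
  proof -
    have "0 < inverse (real (Suc n + 1))" "inverse (real (Suc n + 1)) < 1"
      by (simp_all add: inverse_less_1_iff)
    then show "0 < u n" "u n < a"
      unfolding u_def using \<open>0 < a\<close> by (simp_all only: mult_less_cancel_left_pos[of a _ 1, simplified] zero_less_mult_iff) simp_all
  qed
  have "u \<longlonglongrightarrow> a * (1 - 0)"
    unfolding u_def using LIMSEQ_Suc[OF LIMSEQ_inverse_real_of_nat] by (intro tendsto_intros) simp
  then have u_lim: "u \<longlonglongrightarrow> a" by simp
  have u_mono: "u n \<le> u (Suc n)" for n
    unfolding u_def using \<open>0 < a\<close> by (intro mult_left_mono) (auto simp: field_simps)
  have "(\<lambda>n. N (indicator {0<..<u n})) \<longlonglongrightarrow> N (indicator {0<..<a})"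
  proof (intro ri_norm_Fatou[OF N] measurable_lborel_ivl AE_I2 conjI)
    fix x :: real
    show "incseq (\<lambda>n. indicator {0<..<u n} x :: ennreal)"
      using u_mono by (intro incseq_SucI) (auto split: split_indicator intro: less_le_trans)
    show "(\<lambda>n. indicator {0<..<u n} x :: ennreal) \<longlonglongrightarrow> indicator {0<..<a} x"
    proof (cases "x < a")
      case True
      then have "\<forall>\<^sub>F n in sequentially. x < u n"
        using order_tendstoD(1)[OF u_lim] by blast
      then have "\<forall>\<^sub>F n in sequentially. indicator {0<..<u n} x = (indicator {0<..<a} x :: ennreal)"
        by eventually_elim (use True in \<open>auto split: split_indicator\<close>)
      then show ?thesis by (rule tendsto_eventually)
    next
      case False
      then have "indicator {0<..<u n} x = (0 :: ennreal)" for n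
        using u(2)[of n] by (auto split: split_indicator)
      then show ?thesis using False by simp
    qed
  qed simp_all
  then show ?thesis
    unfolding fundamental_def[symmetric] using le u by (intro LIMSEQ_le_const2) auto
qed

text \<open>\<open>D\<close> is the supremum of the difference quotients with steps
  \<open>1 / Suc n\<close>. It is visibly Borel, concavity puts it below the derivative almost
  everywhere, and \<open>nn_integral_difference_quotient_ge\<close> with steps tending to 0 gives
  the bound.\<close>

lemma fundamental_le_integral_deriv:
  assumes N: "ri_norm (lborel_ivl b) N" and conc: "concave_on (ivl b) (\<lambda>t. enn2real (fundamental N t))"
  obtains D where "D \<in> borel_measurable borel"
    "AE s in lborel. s \<in> ivl b \<longrightarrow> D s \<le> ennreal (deriv (\<lambda>t. enn2real (fundamental N t)) s)"
    "\<forall>a>0. ennreal a \<le> b \<longrightarrow>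
      fundamental N a \<le> Lim (at_right 0) (fundamental N) + (\<integral>\<^sup>+ s \<in> {0<..<a}. D s \<partial>lborel)"
proof -
  define \<phi> where "\<phi> t = enn2real (fundamental N t)" for t
  have \<phi>: "fundamental N t = ennreal (\<phi> t)" "0 \<le> \<phi> t" for t
    using fundamental_finite[OF N, of t] by (simp_all add: \<phi>_def)
  have mono: "mono \<phi>"
    unfolding \<phi>_def using fundamental_mono[OF N] fundamental_finite[OF N]
    by (intro monoI enn2real_mono) auto
  have [measurable]: "\<phi> \<in> borel_measurable borel" using mono by (rule borel_measurable_mono)
  define h where "h n = 1 / real (Suc n)" for n
  have h: "0 < h n" for n by (simp add: h_def)
  \<comment> \<open>Steps that leave the interval count as 0, because concavity gives no slope bound
    across its right end.\<close>
  define D where "D s = (SUP n. if s + h n \<in> ivl b then ennreal ((\<phi> (s + h n) - \<phi> s) / h n) else 0)" for s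
  have open_ivl: "open (ivl b)"
  proof -
    have "ivl b = {0<..} \<inter> ennreal -` {..<b}"
      by (auto simp: ivl_def)
    also have "open \<dots>"
      by (intro open_Int open_vimage continuous_on_ennreal) auto
    finally show ?thesis .
  qed
  show ?thesis
  proof (rule that[of D])
    show "D \<in> borel_measurable borel"
      unfolding D_def by measurable
    have "AE s in lborel. s \<notin> {s \<in> ivl b. \<exists>v\<in>ivl b. s < v \<and> deriv \<phi> s < (\<phi> v - \<phi> s) / (v - s)}"
      using countable_concave_on_slope_not_le_deriv[OF conc[folded \<phi>_def] open_ivl]
      by (intro AE_not_in countable_imp_null_set_lborel)
    then show "AE s in lborel. s \<in> ivl b \<longrightarrow> D s \<le> ennreal (deriv (\<lambda>t. enn2real (fundamental N t)) s)"
      unfolding \<phi>_def[symmetric]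
    proof eventually_elim
      case (elim s)
      have "(\<phi> (s + h n) - \<phi> s) / h n \<le> deriv \<phi> s" if "s \<in> ivl b" "s + h n \<in> ivl b" for n
        using elim that h[of n] by (force simp: not_less)
      then have "(if s + h n \<in> ivl b then ennreal ((\<phi> (s + h n) - \<phi> s) / h n) else 0) \<le> ennreal (deriv \<phi> s)" if "s \<in> ivl b" for n
        using that by (simp add: ennreal_leI)
      then show ?case
        unfolding D_def by (intro impI SUP_least)
    qed
    let ?L = "Lim (at_right 0) (fundamental N)"
    have below: "fundamental N a \<le> ?L + (\<integral>\<^sup>+ s \<in> {0<..<a}. D s \<partial>lborel)" if a: "0 < a" "ennreal a < b" for a
    proof -
      let ?J = "\<integral>\<^sup>+ s \<in> {0<..<a}. D s \<partial>lborel"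
      have "a \<in> ivl b" using a by (simp add: ivl_def)
      then obtain \<epsilon> where \<epsilon>: "\<epsilon> > 0" "ball a \<epsilon> \<subseteq> ivl b"
        using open_ivl unfolding open_contains_ball by blast
      have ge: "fundamental N a \<le> fundamental N t + ?J" if "0 < t" for t
      proof -
        \<comment> \<open>A step below \<open>t\<close> allows passing from \<open>h n\<close> to
          \<open>t\<close> by monotonicity, and a step below \<epsilon> keeps \<open>s + h n\<close>
          inside the interval for all positive \<open>s < a\<close>.\<close>
        obtain n where n: "h n < min t \<epsilon>"
          unfolding h_def using nat_approx_posE[of "min t \<epsilon>"] \<open>0 < t\<close> \<open>\<epsilon> > 0\<close> by auto
        have "a + h n \<in> ivl b"
          using \<epsilon>(2) n h[of n] by (auto simp: dist_real_def)
        then have *: "s + h n \<in> ivl b" if "0 < s" "s < a" for s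
        proof -
          have "ennreal (s + h n) \<le> ennreal (a + h n)"
            using that by (intro ennreal_leI) simp
          also have "\<dots> < b"
            using \<open>a + h n \<in> ivl b\<close> by (simp only: ivl_def mem_Collect_eq)
          finally show ?thesis
            using that h[of n] by (simp only: ivl_def mem_Collect_eq) simp
        qed
        have "fundamental N a \<le> ennreal (\<phi> (h n)) + (\<integral>\<^sup>+ s \<in> {0<..<a}. ennreal ((\<phi> (s + h n) - \<phi> s) / h n) \<partial>lborel)"
          unfolding \<phi>(1) using mono \<phi>(2) a(1) h by (rule nn_integral_difference_quotient_ge)
        also have "\<dots> \<le> fundamental N t + ?J"
        proof (intro add_mono nn_integral_mono)
          show "ennreal (\<phi> (h n)) \<le> fundamental N t"
            unfolding \<phi>(1)[symmetric] using n by (intro fundamental_mono[OF N]) simp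
          fix s
          show "ennreal ((\<phi> (s + h n) - \<phi> s) / h n) * indicator {0<..<a} s \<le> D s * indicator {0<..<a} s"
          proof (cases "s \<in> {0<..<a}")
            case True
            then have "ennreal ((\<phi> (s + h n) - \<phi> s) / h n) = (if s + h n \<in> ivl b then ennreal ((\<phi> (s + h n) - \<phi> s) / h n) else 0)"
              using * by simp
            also have "\<dots> \<le> D s"
              unfolding D_def by (rule SUP_upper) simp
            finally show ?thesis by (rule mult_right_mono) simp
          qed simp
        qed
        finally show ?thesis .
      qed
      have "((\<lambda>t. fundamental N t + ?J) \<longlongrightarrow> ?L + ?J) (at_right 0)"
        by (intro tendsto_intros fundamental_Lim[OF N])
      moreover have "\<forall>\<^sub>F t in at_right 0. fundamental N a \<le> fundamental N t + ?J"
        using ge by (auto simp: eventually_at_right_field intro: exI[of _ 1])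
      ultimately show ?thesis
        by (rule tendsto_lowerbound) simp
    qed
    \<comment> \<open>The value at the right end \<open>a = b\<close> is reached from below by left
      continuity.\<close>
    have "fundamental N a \<le> ?L + (\<integral>\<^sup>+ s \<in> {0<..<a}. D s \<partial>lborel)" if a: "0 < a" "ennreal a \<le> b" for a
    proof (rule fundamental_le_if_below[OF N \<open>0 < a\<close>])
      fix a' assume a': "0 < a'" "a' < a"
      then have "fundamental N a' \<le> ?L + (\<integral>\<^sup>+ s \<in> {0<..<a'}. D s \<partial>lborel)"
      proof (intro below)
        have "ennreal a' < ennreal a" using a' by (intro ennreal_lessI) auto
        then show "ennreal a' < b" using a(2) by (rule less_le_trans)
      qed
      also have "\<dots> \<le> ?L + (\<integral>\<^sup>+ s \<in> {0<..<a}. D s \<partial>lborel)"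
        using a' by (intro add_left_mono nn_integral_mono) (auto split: split_indicator)
      finally show "fundamental N a' \<le> \<dots>" .
    qed
    then show "\<forall>a>0. ennreal a \<le> b \<longrightarrow> fundamental N a \<le> ?L + (\<integral>\<^sup>+ s \<in> {0<..<a}. D s \<partial>lborel)"
      by blast
  qed
qed

text \<open>The fundamental function at the measure of each level set is bounded by its limit at 0
  and an integral of \<open>D\<close>. After summation over the levels under the integral,
  \<open>suminf_dyadic_le\<close> recovers twice the essential supremum and twice the
  rearrangement.\<close>

lemma Lambda_norm_level_sets:
  fixes M :: "'a measure" and f :: "'a \<Rightarrow> ennreal" and e :: "nat \<Rightarrow> int"
  assumes X: "ri_representation M X Xbar"
    and conc: "concave_on (ivl (emeasure M (space M))) (\<lambda>t. enn2real (fundamental Xbar t))"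
    and unb: "\<And>B. emeasure M (space M) = \<infinity> \<Longrightarrow> \<exists>a>0. ennreal B \<le> fundamental Xbar a"
    and f [measurable]: "f \<in> borel_measurable M" and fin: "Lambda_norm M Xbar f < \<infinity>" and e: "inj e"
  defines "E \<equiv> \<lambda>k::int. {x \<in> space M. ennreal (2 powr of_int k) < f x}"
  shows "emeasure M (E k) < \<infinity>"
    and "(\<Sum>j. ennreal (2 powr of_int (e j)) * X (indicator (E (e j)))) \<le> 2 * Lambda_norm M Xbar f"
proof -
  let ?b = "emeasure M (space M)" and ?L = "Lim (at_right 0) (fundamental Xbar)"
  have N: "ri_norm (lborel_ivl ?b) Xbar" and NX: "ri_norm M X"
    using X by (auto simp: ri_representation_def)
  have E [measurable]: "E k \<in> sets M" for k
    unfolding E_def by measurable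
  have E_le: "emeasure M (E k) \<le> ?b" for k
    using sets.sets_into_space[OF E] by (intro emeasure_mono) auto
  obtain D where D [measurable]: "D \<in> borel_measurable borel"
    and D_le: "AE s in lborel. s \<in> ivl ?b \<longrightarrow> D s \<le> ennreal (deriv (\<lambda>t. enn2real (fundamental Xbar t)) s)"
    and fund: "\<forall>a>0. ennreal a \<le> ?b \<longrightarrow> fundamental Xbar a \<le> ?L + (\<integral>\<^sup>+ s \<in> {0<..<a}. D s \<partial>lborel)"
    by (rule fundamental_le_integral_deriv[OF N conc])
  \<comment> \<open>The Lorentz norm with \<open>D\<close> in place of the derivative: the integrand
    becomes measurable and the value does not exceed the norm.\<close>
  define Q where "Q = esssup M f * ?L + (\<integral>\<^sup>+ s \<in> ivl ?b. (rearr M f s * D s) \<partial>lborel)"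
  have Q: "Q \<le> Lambda_norm M Xbar f"
    unfolding Q_def Lambda_norm_def
    by (intro add_left_mono nn_integral_mono_AE, use D_le in eventually_elim) (auto split: split_indicator intro: mult_left_mono)
  have rearr_ge: "ennreal (2 powr of_int k) \<le> rearr M f s" if "ennreal s < emeasure M (E k)" for k s
    using that by (intro le_rearr f) (simp add: dist_fun_def E_def)
  have esssup_ge: "ennreal (2 powr of_int k) \<le> esssup M f" if "0 < emeasure M (E k)" for k
  proof (rule ccontr)
    assume "\<not> ?thesis"
    moreover have "AE x in M. f x \<le> esssup M f" by (rule esssup_AE)
    ultimately have "AE x in M. x \<notin> E k"
      by (auto simp: E_def not_le elim!: eventually_mono)
    then have "emeasure M (E k) = 0"
      using AE_iff_null_sets[OF E[of k]] by auto
    then show False using that by simp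
  qed
  have piece: "ennreal (2 powr of_int k) * X (indicator (E k))
      \<le> ennreal (2 powr of_int k) * (if 0 < emeasure M (E k) then 1 else 0) * ?L
        + (\<integral>\<^sup>+ s \<in> ivl ?b. (ennreal (2 powr of_int k) * (if ennreal s < emeasure M (E k) then 1 else 0) * D s) \<partial>lborel)"
    if fk: "emeasure M (E k) < \<infinity>" for k
  proof (cases "emeasure M (E k) = 0")
    case True
    from AE_not_in[OF null_setsI[OF True E]]
    have "AE x in M. indicator (E k) x = (0 :: ennreal)"
      by eventually_elim simp
    then have "X (indicator (E k)) = 0"
      using ri_norm_eq_0_iff[OF NX, of "indicator (E k)"] by simp
    then show ?thesis by simp
  next
    case False
    obtain a where a: "emeasure M (E k) = ennreal a" "0 < a"
      using fk False by (cases "emeasure M (E k)") auto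
    have "X (indicator (E k)) = fundamental Xbar a"
      using a by (intro norm_indicator_eq_fundamental[OF X]) auto
    also have "\<dots> \<le> ?L + (\<integral>\<^sup>+ s \<in> {0<..<a}. D s \<partial>lborel)"
      using a E_le[of k] by (intro fund[rule_format]) auto
    finally have "ennreal (2 powr of_int k) * X (indicator (E k)) \<le> ennreal (2 powr of_int k) * ?L + ennreal (2 powr of_int k) * (\<integral>\<^sup>+ s \<in> {0<..<a}. D s \<partial>lborel)"
      unfolding distrib_left[symmetric] by (rule mult_left_mono) simp
    also have "ennreal (2 powr of_int k) * (\<integral>\<^sup>+ s \<in> {0<..<a}. D s \<partial>lborel) = (\<integral>\<^sup>+ s. ennreal (2 powr of_int k) * (D s * indicator {0<..<a} s) \<partial>lborel)"
      by (intro nn_integral_cmult[symmetric]) measurable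
    also have "\<dots> \<le> (\<integral>\<^sup>+ s \<in> ivl ?b. (ennreal (2 powr of_int k) * (if ennreal s < emeasure M (E k) then 1 else 0) * D s) \<partial>lborel)"
    proof (intro nn_integral_mono)
      fix s
      have "s \<in> ivl ?b \<and> ennreal s < emeasure M (E k)" if "0 < s" "s < a"
        using ivl_subset[of a ?b] a E_le[of k] that by (auto simp: ennreal_lessI)
      then show "ennreal (2 powr of_int k) * (D s * indicator {0<..<a} s)
          \<le> ennreal (2 powr of_int k) * (if ennreal s < emeasure M (E k) then 1 else 0) * D s * indicator (ivl ?b) s"
        by (cases "s \<in> {0<..<a}") auto
    qed
    finally show ?thesis using a by (simp add: add_left_mono)
  qed
  show finite: "emeasure M (E k) < \<infinity>" for k
  proof (rule ccontr)
    assume "\<not> ?thesis"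
    \<comment> \<open>An infinite level set keeps the rearrangement at least \<open>2 powr k\<close>
      on the whole half line, so \<open>Q\<close> would dominate \<open>2 powr k\<close> times every
      value of the unbounded fundamental function.\<close>
    then have inf: "emeasure M (E k) = \<infinity>" by (simp add: less_top[symmetric])
    then have b: "?b = \<infinity>" using E_le[of k] by (simp add: top_unique)
    have "Q < \<infinity>" using Q fin by (rule le_less_trans)
    then obtain Q' where Q': "Q = ennreal Q'" "0 \<le> Q'"
      by (cases Q) auto
    obtain a where a: "0 < a" "ennreal ((Q' + 1) / 2 powr of_int k) \<le> fundamental Xbar a"
      using unb[OF b] by blast
    have "ennreal (Q' + 1) = ennreal (2 powr of_int k) * ennreal ((Q' + 1) / 2 powr of_int k)"
      using Q'(2) by (simp flip: ennreal_mult)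
    also have "\<dots> \<le> ennreal (2 powr of_int k) * fundamental Xbar a"
      by (intro mult_left_mono a) simp
    also have "\<dots> \<le> ennreal (2 powr of_int k) * (?L + (\<integral>\<^sup>+ s \<in> {0<..<a}. D s \<partial>lborel))"
      using a(1) b by (intro mult_left_mono fund[rule_format]) auto
    also have "\<dots> = ennreal (2 powr of_int k) * ?L + (\<integral>\<^sup>+ s. ennreal (2 powr of_int k) * (D s * indicator {0<..<a} s) \<partial>lborel)"
      unfolding distrib_left by (subst nn_integral_cmult) simp_all
    also have "\<dots> \<le> Q"
      unfolding Q_def
    proof (intro add_mono nn_integral_mono mult_right_mono esssup_ge)
      fix s
      show "ennreal (2 powr of_int k) * (D s * indicator {0<..<a} s) \<le> rearr M f s * D s * indicator (ivl ?b) s"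
        using rearr_ge[of s k] inf b by (auto simp: ivl_def mult_right_mono split: split_indicator)
    qed (use inf in auto)
    finally show False using Q' by simp
  qed
  have "(\<Sum>j. ennreal (2 powr of_int (e j)) * X (indicator (E (e j))))
      \<le> (\<Sum>j. ennreal (2 powr of_int (e j)) * (if 0 < emeasure M (E (e j)) then 1 else 0) * ?L
        + (\<integral>\<^sup>+ s \<in> ivl ?b. (ennreal (2 powr of_int (e j)) * (if ennreal s < emeasure M (E (e j)) then 1 else 0) * D s) \<partial>lborel))"
    by (intro suminf_le piece finite summableI)
  also have "\<dots> = (\<Sum>j. ennreal (2 powr of_int (e j)) * (if 0 < emeasure M (E (e j)) then 1 else 0) * ?L)
      + (\<Sum>j. \<integral>\<^sup>+ s \<in> ivl ?b. (ennreal (2 powr of_int (e j)) * (if ennreal s < emeasure M (E (e j)) then 1 else 0) * D s) \<partial>lborel)"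
    by (rule suminf_add[symmetric]) auto
  also have "\<dots> \<le> 2 * (esssup M f * ?L) + 2 * (\<integral>\<^sup>+ s \<in> ivl ?b. (rearr M f s * D s) \<partial>lborel)"
  proof (rule add_mono)
    have "(\<Sum>j. ennreal (2 powr of_int (e j)) * (if 0 < emeasure M (E (e j)) then 1 else 0)) \<le> 2 * esssup M f"
      by (rule suminf_dyadic_le[OF e]) (rule esssup_ge)
    then show "(\<Sum>j. ennreal (2 powr of_int (e j)) * (if 0 < emeasure M (E (e j)) then 1 else 0) * ?L) \<le> 2 * (esssup M f * ?L)"
      unfolding ennreal_suminf_multc mult.assoc[symmetric] by (rule mult_right_mono) simp
    have "(\<Sum>j. \<integral>\<^sup>+ s \<in> ivl ?b. (ennreal (2 powr of_int (e j)) * (if ennreal s < emeasure M (E (e j)) then 1 else 0) * D s) \<partial>lborel)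
        = (\<integral>\<^sup>+ s. (\<Sum>j. ennreal (2 powr of_int (e j)) * (if ennreal s < emeasure M (E (e j)) then 1 else 0) * D s * indicator (ivl ?b) s) \<partial>lborel)"
      by (intro nn_integral_suminf[symmetric]) measurable
    also have "\<dots> \<le> (\<integral>\<^sup>+ s. 2 * (rearr M f s * D s * indicator (ivl ?b) s) \<partial>lborel)"
    proof (intro nn_integral_mono)
      fix s
      have "(\<Sum>j. ennreal (2 powr of_int (e j)) * (if ennreal s < emeasure M (E (e j)) then 1 else 0)) \<le> 2 * rearr M f s"
        by (rule suminf_dyadic_le[OF e]) (rule rearr_ge)
      then show "(\<Sum>j. ennreal (2 powr of_int (e j)) * (if ennreal s < emeasure M (E (e j)) then 1 else 0) * D s * indicator (ivl ?b) s)
          \<le> 2 * (rearr M f s * D s * indicator (ivl ?b) s)"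
        unfolding ennreal_suminf_multc mult.assoc[symmetric] by (intro mult_right_mono) simp_all
    qed
    also have "\<dots> = 2 * (\<integral>\<^sup>+ s \<in> ivl ?b. (rearr M f s * D s) \<partial>lborel)"
      by (intro nn_integral_cmult) measurable
    finally show "(\<Sum>j. \<integral>\<^sup>+ s \<in> ivl ?b. (ennreal (2 powr of_int (e j)) * (if ennreal s < emeasure M (E (e j)) then 1 else 0) * D s) \<partial>lborel) \<le> \<dots>" .
  qed
  also have "\<dots> = 2 * Q"
    by (simp add: Q_def distrib_left)
  also have "\<dots> \<le> 2 * Lambda_norm M Xbar f"
    by (intro mult_left_mono Q) simp
  finally show "(\<Sum>j. ennreal (2 powr of_int (e j)) * X (indicator (E (e j)))) \<le> 2 * Lambda_norm M Xbar f" .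
qed

section \<open>Boundedness of the potential\<close>

text \<open>The integral over \<open>(0,t)\<close> increases with \<open>t\<close>; reflecting
  \<open>t\<close> makes \<open>borel_measurable_antimono_ennreal\<close> applicable.\<close>

lemma borel_measurable_max_rearr [measurable]: "max_rearr M f \<in> borel_measurable borel"
proof -
  let ?J = "\<lambda>t. \<integral>\<^sup>+ s \<in> {0<..<t}. rearr M f s \<partial>lborel"
  have "antimono (\<lambda>t. ?J (- t))"
    by (intro antimonoI nn_integral_mono) (auto split: split_indicator)
  then have "(\<lambda>t. ?J (- t)) \<in> borel_measurable borel"
    by (rule borel_measurable_antimono_ennreal)
  then have "(\<lambda>t. ?J (- t)) \<circ> uminus \<in> borel_measurable borel"
    by (intro measurable_comp[where N = borel]) auto
  then have "?J \<in> borel_measurable borel"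
    by (simp add: comp_def)
  then show ?thesis
    unfolding max_rearr_def[abs_def] by measurable
qed

lemma ennreal_norm_riesz_integrand:
  "ennreal (norm (riesz_integrand d \<alpha> f x y)) = kernel d \<alpha> x y * nnabs f y"
proof -
  have "norm (riesz_integrand d \<alpha> f x y) = 1 / norm (x - y) powr (d - \<alpha>) * \<bar>f y\<bar>"
    by (simp add: riesz_integrand_def)
  then show ?thesis
    unfolding kernel_def nnabs_def by (simp only: ennreal_mult[symmetric] divide_nonneg_nonneg powr_ge_zero abs_ge_zero zero_le_one)
qed

text \<open>Where the integral does not converge absolutely the potential has the default value 0,
  so the bound holds everywhere.\<close>

lemma nnabs_riesz_potential_le: "nnabs (riesz_potential d \<alpha> M f) x \<le> nn_potential d \<alpha> M (nnabs f) x"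
proof (cases "integrable M (riesz_integrand d \<alpha> f x)")
  case True
  then have "ennreal (norm (\<integral>y. riesz_integrand d \<alpha> f x y \<partial>M)) \<le> (\<integral>\<^sup>+ y. ennreal (norm (riesz_integrand d \<alpha> f x y)) \<partial>M)"
    by (rule integral_norm_bound_ennreal)
  then show ?thesis
    unfolding ennreal_norm_riesz_integrand by (simp add: nnabs_def riesz_potential_def nn_potential_def)
next
  case False
  then show ?thesis
    by (simp add: nnabs_def riesz_potential_def not_integrable_integral_eq)
qed

lemma integrable_riesz_integrand:
  assumes "sets M = sets borel" "f \<in> borel_measurable M" "nn_potential d \<alpha> M (nnabs f) x < \<infinity>"
  shows "integrable M (riesz_integrand d \<alpha> f x)"
proof (rule integrableI_bounded)
  have [measurable]: "f \<in> borel_measurable borel"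
    using assms(2) unfolding measurable_cong_sets[OF assms(1) refl] .
  show "riesz_integrand d \<alpha> f x \<in> borel_measurable M"
    unfolding measurable_cong_sets[OF assms(1) refl] riesz_integrand_def by measurable
  show "(\<integral>\<^sup>+ y. ennreal (norm (riesz_integrand d \<alpha> f x y)) \<partial>M) < \<infinity>"
    using assms(3) unfolding ennreal_norm_riesz_integrand nn_potential_def .
qed

text \<open>One term is enough, the one with \<open>2 powr k < \<bar>f y\<bar>\<close> and
  \<open>\<bar>f y\<bar> \<le> 2 powr (k + 1)\<close>; this is where the factor 2 comes
  from.\<close>

lemma nnabs_le_dyadic_sum:
  fixes e :: "nat \<Rightarrow> int"
  assumes "surj e"
  shows "nnabs f y \<le> (\<Sum>j. ennreal (2 * 2 powr of_int (e j)) * indicator {x. ennreal (2 powr of_int (e j)) < nnabs f x} y)"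
    (is "_ \<le> (\<Sum>j. ?s j)")
proof (cases "f y = 0")
  case False
  then obtain k :: int where k: "2 powr of_int k < \<bar>f y\<bar>" "\<bar>f y\<bar> \<le> 2 powr (of_int k + 1)"
    using ex_dyadic_ceiling[of "\<bar>f y\<bar>"] by auto
  obtain j where j: "e j = k" using assms by (metis surjD)
  have "nnabs f y \<le> ?s j"
    using k by (auto simp: nnabs_def j powr_add mult.commute ennreal_less_iff intro!: ennreal_leI)
  also have "\<dots> \<le> (\<Sum>j. ?s j)"
    by (rule ennreal_le_suminf)
  finally show ?thesis .
qed (simp add: nnabs_def)

lemma profile_0 [simp]: "profile p q 0 t = 0"
  by (simp add: profile_def)

lemma profile_nonneg: "0 \<le> profile p q a t"
  by (simp add: profile_def)

text \<open>A multiple of the sum \<open>A\<close> of the profiles of the level sets, weighted by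
  their heights, dominates the function whose norm in \<open>Ybar\<close> is to be estimated, and
  the triangle inequality reduces that norm to single profiles. Finiteness of the norm of
  \<open>A\<close> also yields absolute convergence.\<close>

lemma riesz_bounded_of_characteristic_functions:
  fixes M N :: "'a::euclidean_space measure"
  assumes sets: "sets M = sets borel" "sets N = sets borel" and sigma: "sigma_finite_measure N"
    and p: "1 < p" and C: "0 < C1" "0 < C2" "0 < C3"
    and strong: "\<And>E. E \<in> sets borel \<Longrightarrow> emeasure M E < \<infinity> \<Longrightarrow>
      \<exists>G\<in>borel_measurable borel. (\<forall>x. nn_potential d \<alpha> M (indicator E) x \<le> epowr (G x) (1 / p)) \<and>
        (\<integral>\<^sup>+ x. G x \<partial>N) \<le> ennreal C1 * emeasure M E"
    and sup: "\<And>E b x. E \<in> sets borel \<Longrightarrow> 0 \<le> b \<Longrightarrow> emeasure M E = ennreal b \<Longrightarrow>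
      nn_potential d \<alpha> M (indicator E) x \<le> ennreal (C2 * b powr (1 / q))"
    and prof: "\<And>E a. E \<in> sets M \<Longrightarrow> emeasure M E = ennreal a \<Longrightarrow> 0 < a \<Longrightarrow>
      Ybar (\<lambda>t. ennreal (profile p q a t)) \<le> ennreal C3 * X (indicator E)"
    and Y: "ri_norm (lborel_ivl (emeasure N UNIV)) Ybar" and N0: "0 < emeasure N UNIV"
    and X: "ri_representation M X Xbar"
    and conc: "concave_on (ivl (emeasure M (space M))) (\<lambda>t. enn2real (fundamental Xbar t))"
    and unb: "\<And>B. emeasure M (space M) = \<infinity> \<Longrightarrow> \<exists>a>0. ennreal B \<le> fundamental Xbar a"
  shows "riesz_bounded d \<alpha> M (Lambda_norm M Xbar) N (angle_norm N Ybar p)"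
proof -
  let ?b = "emeasure N UNIV"
  \<comment> \<open>The first factor comes from \<open>max_rearr_potential_le\<close>;
    \<open>4 * C3\<close> combines \<open>prof\<close>, the height \<open>2 * 2 powr k\<close> of
    each piece and the doubling in \<open>Lambda_norm_level_sets\<close>.\<close>
  define C where "C = 4 * (C1 powr (1 / p) + C2) * (4 * C3)"
  have "C > 0" using C by (simp add: C_def add_pos_pos)
  have main: "(AE x in N. integrable M (riesz_integrand d \<alpha> f x)) \<and>
      angle_norm N Ybar p (nnabs (riesz_potential d \<alpha> M f)) \<le> ennreal C * Lambda_norm M Xbar (nnabs f)"
    if f: "f \<in> borel_measurable M" and fin: "Lambda_norm M Xbar (nnabs f) < \<infinity>" for f
  proof -
    have u: "nnabs f \<in> borel_measurable M"
      unfolding nnabs_def using f by measurable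
    \<comment> \<open>A bijection from the naturals to the integers turns the sum over all dyadic
      levels into a series.\<close>
    define e where "e = int_decode"
    have e: "inj e" "surj e" by (simp_all add: e_def inj_int_decode surj_int_decode)
    define E where "E k = {x. ennreal (2 powr of_int k) < nnabs f x}" for k :: int
    have spM: "space M = UNIV" using sets_eq_imp_space_eq[OF sets(1)] by simp
    have E_eq: "E k = {x \<in> space M. ennreal (2 powr of_int k) < nnabs f x}" for k
      by (simp add: E_def spM)
    have E: "E k \<in> sets M" for k
      unfolding E_eq using u by measurable
    have level: "emeasure M (E k) < \<infinity>"
      "(\<Sum>j. ennreal (2 powr of_int (e j)) * X (indicator (E (e j)))) \<le> 2 * Lambda_norm M Xbar (nnabs f)" for k
      unfolding E_eq by (rule Lambda_norm_level_sets[OF X conc unb u fin e(1)], assumption)+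
    have "\<exists>a. 0 \<le> a \<and> emeasure M (E (e j)) = ennreal a" for j
      using level(1)[of "e j"] by (cases "emeasure M (E (e j))") auto
    then obtain a where a: "\<And>j. 0 \<le> a j" "\<And>j. emeasure M (E (e j)) = ennreal (a j)"
      by metis
    define c :: "nat \<Rightarrow> real" where "c j = 2 * 2 powr of_int (e j)" for j
    have c: "0 \<le> c j" for j by (simp add: c_def)
    have dec: "nnabs f y \<le> (\<Sum>j. ennreal (c j) * indicator (E (e j)) y)" for y
      unfolding c_def E_def by (rule nnabs_le_dyadic_sum[OF e(2)])
    define A where "A t = (\<Sum>j. ennreal (c j * profile p q (a j) t))" for t
    have [measurable]: "A \<in> borel_measurable borel"
      unfolding A_def by measurable
    have A_ivl: "A \<in> borel_measurable (lborel_ivl ?b)"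
      by (rule measurable_lborel_ivl) measurable
    let ?F = "nn_potential d \<alpha> M (nnabs f)"
    have split: "\<exists>g h. g \<in> borel_measurable borel \<and> (\<forall>x. ?F x \<le> g x + h) \<and>
        (\<integral>\<^sup>+ x. epowr (g x) p \<partial>N) \<le> ennreal (C1 * t) * epowr (A t) p \<and> h \<le> ennreal C2 * A t" if t: "0 < t" for t
    proof -
      have Eb: "E (e j) \<in> sets borel" for j using E sets by simp
      show ?thesis
        unfolding A_def
        by (rule potential_split[OF sets p C(1,2) t strong sup Eb a(2,1) c dec]) (assumption | blast)+
    qed
    have "Ybar A \<le> (\<Sum>j. Ybar (\<lambda>t. ennreal (c j * profile p q (a j) t)))"
      unfolding A_def by (intro ri_norm_suminf[OF Y] measurable_lborel_ivl) measurable
    also have "\<dots> \<le> (\<Sum>j. ennreal (2 * C3) * (ennreal (2 powr of_int (e j)) * X (indicator (E (e j)))))"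
    proof (intro suminf_le summableI)
      fix j
      have "Ybar (\<lambda>t. ennreal (c j * profile p q (a j) t)) = Ybar (\<lambda>t. ennreal (c j) * ennreal (profile p q (a j) t))"
        using c profile_nonneg by (simp add: ennreal_mult)
      also have "\<dots> = ennreal (c j) * Ybar (\<lambda>t. ennreal (profile p q (a j) t))"
        by (intro ri_norm_cmult[OF Y] measurable_lborel_ivl c) measurable
      also have "\<dots> \<le> ennreal (c j) * (ennreal C3 * X (indicator (E (e j))))"
      proof (intro mult_left_mono)
        show "Ybar (\<lambda>t. ennreal (profile p q (a j) t)) \<le> ennreal C3 * X (indicator (E (e j)))"
        proof (cases "a j = 0")
          case True
          then show ?thesis
            using ri_norm_eq_0_iff[OF Y, of "\<lambda>t. 0"] by simp
        next
          case False
          then have "0 < a j" using a(1)[of j] by simp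
          then show ?thesis by (rule prof[OF E a(2)])
        qed
      qed simp
      also have "\<dots> = ennreal (2 * C3) * (ennreal (2 powr of_int (e j)) * X (indicator (E (e j))))"
      proof -
        have "ennreal (c j) * ennreal C3 = ennreal (2 * C3) * ennreal (2 powr of_int (e j))"
          unfolding c_def using C by (simp add: mult_ac flip: ennreal_mult)
        then show ?thesis by (simp only: mult.assoc[symmetric])
      qed
      finally show "Ybar (\<lambda>t. ennreal (c j * profile p q (a j) t))
          \<le> ennreal (2 * C3) * (ennreal (2 powr of_int (e j)) * X (indicator (E (e j))))" .
    qed
    also have "\<dots> = ennreal (2 * C3) * (\<Sum>j. ennreal (2 powr of_int (e j)) * X (indicator (E (e j))))"
      by (rule ennreal_suminf_cmult)
    also have "\<dots> \<le> ennreal (2 * C3) * (2 * Lambda_norm M Xbar (nnabs f))"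
      by (intro mult_left_mono level(2)) simp
    also have "\<dots> = ennreal (4 * C3) * Lambda_norm M Xbar (nnabs f)"
    proof -
      have "ennreal (2 * C3) * 2 = ennreal (4 * C3)"
        using C ennreal_mult[of "2 * C3" 2] by simp
      then show ?thesis by (simp only: mult.assoc[symmetric])
    qed
    finally have YA: "Ybar A \<le> ennreal (4 * C3) * Lambda_norm M Xbar (nnabs f)" .
    have "AE x in N. ?F x < \<infinity>"
    proof -
      \<comment> \<open>\<open>ri_norm_finite_AE\<close> speaks of sets of finite measure, hence the
        bounded piece \<open>(0,r)\<close>; a single \<open>t\<close> with \<open>A t\<close> finite
        then suffices.\<close>
      obtain r where r: "0 < r" "ennreal r \<le> ?b"
      proof (cases ?b)
        case (real r)
        then show ?thesis using N0 that[of r] by simp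
      next
        case top
        then show ?thesis using that[of 1] by simp
      qed
      then have sub: "{0<..<r} \<subseteq> ivl ?b"
        by (intro ivl_subset) auto
      then have I: "{0<..<r} \<in> sets (lborel_ivl ?b)" "emeasure (lborel_ivl ?b) {0<..<r} = ennreal r"
        using r by (auto simp: sets_lborel_ivl emeasure_lborel_ivl)
      have "Ybar A < \<infinity>"
        using YA fin by (auto intro: le_less_trans simp: ennreal_mult_less_top)
      then have ae: "AE t in lborel_ivl ?b. t \<in> {0<..<r} \<longrightarrow> A t < \<infinity>"
        using I by (intro ri_norm_finite_AE[OF Y A_ivl]) auto
      have "\<exists>t\<in>{0<..<r}. A t < \<infinity>"
      proof (rule ccontr)
        assume neg: "\<not> ?thesis"
        from ae have "AE t in lborel_ivl ?b. t \<notin> {0<..<r}"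
          by eventually_elim (use neg in blast)
        then have "emeasure (lborel_ivl ?b) {0<..<r} = 0"
          using AE_iff_null_sets[OF I(1)] by auto
        then show False using I(2) r(1) by simp
      qed
      then obtain t where t: "0 < t" "A t < \<infinity>" by auto
      obtain g h where gh: "g \<in> borel_measurable borel" "\<forall>x. ?F x \<le> g x + h"
          "(\<integral>\<^sup>+ x. epowr (g x) p \<partial>N) \<le> ennreal (C1 * t) * epowr (A t) p" "h \<le> ennreal C2 * A t"
        using split[OF t(1)] by blast
      show ?thesis
        using p by (intro potential_finite_AE[OF sets(2) _ gh(1) gh(2)[rule_format] gh(3,4) t(2)]) simp
    qed
    then have int: "AE x in N. integrable M (riesz_integrand d \<alpha> f x)"
      by eventually_elim (rule integrable_riesz_integrand[OF sets(1) f])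
    let ?S = "\<lambda>t. epowr (max_rearr N (\<lambda>x. epowr (nnabs (riesz_potential d \<alpha> M f) x) p) t) (1 / p)"
    let ?K = "4 * (C1 powr (1 / p) + C2)"
    have S_le: "?S t \<le> ennreal ?K * A t" if t: "0 < t" for t
    proof -
      obtain g h where gh: "g \<in> borel_measurable borel" "\<forall>x. ?F x \<le> g x + h"
          "(\<integral>\<^sup>+ x. epowr (g x) p \<partial>N) \<le> ennreal (C1 * t) * epowr (A t) p" "h \<le> ennreal C2 * A t"
        using split[OF t] by blast
      have "nnabs (riesz_potential d \<alpha> M f) x \<le> g x + h" for x
        using nnabs_riesz_potential_le[of d \<alpha> M f x] gh(2) by (auto intro: order_trans)
      then show ?thesis
        by (rule max_rearr_potential_le[OF sigma sets(2) p t C(1,2) gh(1) _ gh(3,4)])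
    qed
    have "angle_norm N Ybar p (nnabs (riesz_potential d \<alpha> M f)) = Ybar ?S"
      by (simp add: angle_norm_def)
    also have "\<dots> \<le> Ybar (\<lambda>t. ennreal ?K * A t)"
      using S_le by (intro ri_norm_mono[OF Y] measurable_lborel_ivl AE_I2) (auto simp: space_lborel_ivl ivl_def)
    also have "\<dots> = ennreal ?K * Ybar A"
      using C by (intro ri_norm_cmult[OF Y A_ivl]) simp
    also have "\<dots> \<le> ennreal ?K * (ennreal (4 * C3) * Lambda_norm M Xbar (nnabs f))"
      by (intro mult_left_mono YA) simp
    also have "\<dots> = ennreal C * Lambda_norm M Xbar (nnabs f)"
    proof -
      have "ennreal ?K * ennreal (4 * C3) = ennreal C"
        unfolding C_def using C by (intro ennreal_mult[symmetric]) auto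
      then show ?thesis by (simp only: mult.assoc[symmetric])
    qed
    finally show ?thesis using int by blast
  qed
  show ?thesis
    unfolding riesz_bounded_def bounded_operator_def using main \<open>C > 0\<close> by blast
qed

lemma sigma_finite_radon:
  assumes "radon_measure M"
  shows "sigma_finite_measure M"
proof
  have sets: "sets M = sets borel" and fin: "\<And>K. compact K \<Longrightarrow> emeasure M K < \<infinity>"
    using assms by (auto simp: radon_measure_def)
  have "(\<Union>n. cball 0 (real n)) = (UNIV :: 'a set)"
    by (auto simp: real_arch_simple)
  then show "\<exists>A. countable A \<and> A \<subseteq> sets M \<and> \<Union> A = space M \<and> (\<forall>a\<in>A. emeasure M a \<noteq> \<infinity>)"
    using fin sets sets_eq_imp_space_eq[OF sets]
    by (intro exI[of _ "range (\<lambda>n. cball 0 (real n))"]) (auto simp: less_top)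
qed

lemma ex_set_large_measure:
  fixes M :: "'a::euclidean_space measure"
  assumes "radon_measure M" "emeasure M UNIV = \<infinity>"
  shows "\<exists>E\<in>sets M. \<exists>a. B \<le> a \<and> emeasure M E = ennreal a"
proof -
  have sets: "sets M = sets borel" and fin: "\<And>K. compact K \<Longrightarrow> emeasure M K < \<infinity>"
    using assms by (auto simp: radon_measure_def)
  have U: "(\<Union>n. cball 0 (real n)) = (UNIV :: 'a set)"
    by (auto simp: real_arch_simple)
  have "(SUP n. emeasure M (cball 0 (real n))) = emeasure M (\<Union>n. cball 0 (real n))"
  proof (rule SUP_emeasure_incseq)
    show "range (\<lambda>n. cball 0 (real n)) \<subseteq> sets M"
      unfolding sets by auto
    show "incseq (\<lambda>n. cball (0::'a) (real n))"
      by (intro incseq_SucI subset_cball) simp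
  qed
  also have "\<dots> = \<infinity>"
    unfolding U by (rule assms(2))
  finally have "ennreal B < (SUP n. emeasure M (cball 0 (real n)))"
    by (simp only: infinity_ennreal_def ennreal_less_top)
  then obtain n where n: "ennreal B < emeasure M (cball 0 (real n))"
    unfolding less_SUP_iff by blast
  have "emeasure M (cball 0 (real n)) < \<infinity>"
    using fin by simp
  then obtain a where a: "emeasure M (cball 0 (real n)) = ennreal a" "0 \<le> a"
    by (cases "emeasure M (cball 0 (real n))") auto
  then have "B \<le> a"
    using n by (cases "0 \<le> B") (auto simp: ennreal_less_iff)
  then show ?thesis
    using a sets by (intro bexI[of _ "cball 0 (real n)"] exI[of _ a]) auto
qed

lemma AE_trivial_measure: "emeasure M (space M) = 0 \<Longrightarrow> AE x in M. P x"
  by (rule AE_I'[of "space M"]) (auto intro: null_setsI)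

text \<open>If \<open>N\<close> vanishes, the interval of its representation space is empty and
  every function on it has norm 0.\<close>

lemma riesz_bounded_trivial:
  assumes "emeasure N (space N) = 0" and Y: "ri_norm (lborel_ivl 0) Ybar"
  shows "riesz_bounded d \<alpha> M NX N (angle_norm N Ybar p)"
proof -
  have "angle_norm N Ybar p g = 0" for g
    unfolding angle_norm_def
    by (subst ri_norm_eq_0_iff[OF Y]) (auto simp: space_lborel_ivl ivl_def intro!: measurable_lborel_ivl AE_I2)
  then show ?thesis
    unfolding riesz_bounded_def bounded_operator_def using AE_trivial_measure[OF assms(1)]
    by (auto intro: exI[of _ 1])
qed

theorem theorem3p7:
  fixes d \<alpha> p l :: real
    and \<mu> \<nu> :: "(real ^ 'n) measure"
    and A :: "real ^ 'n \<Rightarrow> real ^ 'n"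
    and Q0 :: "(real ^ 'n) set"
    and D :: "nat \<Rightarrow> (real ^ 'n) set set"
    and X X1 Y :: "(real ^ 'n \<Rightarrow> ennreal) \<Rightarrow> ennreal"
    and Xbar X1bar Ybar :: "(real \<Rightarrow> ennreal) \<Rightarrow> ennreal"
  assumes "0 < d" "d \<le> real CARD('n)" "0 < \<alpha>" "\<alpha> < d" "1 < p" "p < d / \<alpha>"
    and "radon_measure \<mu>"
    and "(SUP (Q, s) \<in> {(Q, s). is_cube Q s}. emeasure \<mu> Q / ennreal (s powr d)) < \<infinity>"
    and "similarity A l" "A ` unit_cube = Q0"
    and "D ` {1..3 ^ CARD('n)} = third_translates A"
    and "radon_measure \<nu>" "nonatomic \<nu>"
    and "(SUP Q \<in> {Q \<in> (\<Union>j\<in>{1..3 ^ CARD('n)}. D j). emeasure \<mu> Q > 0}.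
            emeasure \<nu> Q / epowr (emeasure \<mu> Q) (1 - \<alpha> * p / d)) < \<infinity>"
    and "ri_representation \<mu> X Xbar"
    and "ri_representation \<nu> Y Ybar"
    and "\<exists>C>0. \<forall>f\<in>borel_measurable \<mu>.
           sum_norm \<mu> (Lp_norm \<mu> p) (weak_Lq_norm \<mu> (d / \<alpha>)) f \<le> ennreal C * X (nnabs f)"
    and "(fundamental Xbar \<longlongrightarrow> 0) (at_right 0)"
    and "bounded_operator (lborel_ivl (emeasure \<mu> UNIV)) Xbar Ybar
           (\<lambda>g. R_op p (d / \<alpha>) (extend0 (ivl (emeasure \<mu> UNIV)) g))"
    \<comment> \<open>\<open>\<Lambda>\<^sub>X\<close> is formed with any equivalent r.i. norm whose fundamental function is concave\<close>
    and "ri_representation \<mu> X1 X1bar" "equivalent_norms \<mu> X X1"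
    and "concave_on (ivl (emeasure \<mu> UNIV)) (\<lambda>t. enn2real (fundamental X1bar t))"
  shows "riesz_bounded d \<alpha> \<mu> (Lambda_norm \<mu> X1bar) \<nu> (angle_norm \<nu> Ybar p)"
proof -
  note \<mu> = \<open>radon_measure \<mu>\<close> and \<nu> = \<open>radon_measure \<nu>\<close>
  have sets: "sets \<mu> = sets borel" "sets \<nu> = sets borel"
    using \<mu> \<nu> by (auto simp: radon_measure_def)
  have space: "space \<mu> = UNIV" "space \<nu> = UNIV"
    using sets_eq_imp_space_eq[OF sets(1)] sets_eq_imp_space_eq[OF sets(2)] by auto
  define q where "q = d / \<alpha>"
  \<comment> \<open>With this exponent the hypothesis on \<open>\<nu>\<close> yields growth of order
    \<open>d * \<theta> = d - \<alpha> * p\<close> on balls.\<close>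
  define \<theta> where "\<theta> = 1 - \<alpha> * p / d"
  have q: "p < q" "1 / q = \<alpha> / d" and \<theta>: "0 < \<theta>" "d * \<theta> = d - \<alpha> * p"
    using \<open>0 < d\<close> \<open>0 < \<alpha>\<close> \<open>p < d / \<alpha>\<close> by (auto simp: q_def \<theta>_def field_simps)
  have X: "ri_norm \<mu> X" and X1: "ri_norm \<mu> X1" and Y: "ri_norm (lborel_ivl (emeasure \<nu> UNIV)) Ybar"
    using assms(15,16,20) by (auto simp: ri_representation_def space)
  show ?thesis
  \<comment> \<open>The estimate of the profiles asks for a nonempty interval, so the zero measure
    is treated apart.\<close>
  proof (cases "emeasure \<nu> UNIV = 0")
    case True
    then show ?thesis
      using Y by (intro riesz_bounded_trivial) (simp_all add: space)
  next
    case False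
    obtain K where K: "K > 0" "\<forall>Q s. is_cube Q s \<longrightarrow> emeasure \<mu> Q \<le> ennreal (K * s powr d)"
      by (rule cube_growth[OF assms(8)]) (rule that, assumption, blast)
    define K1 where "K1 = K * 2 powr d"
    have K1: "K1 > 0" using K(1) by (simp add: K1_def)
    have ball: "emeasure \<mu> (ball x \<rho>) \<le> ennreal (K1 * \<rho> powr d)" if "\<rho> > 0" for x \<rho>
      unfolding K1_def by (rule ball_growth[OF sets(1) K(1) \<open>0 < d\<close> K(2)[rule_format] that])
    have "(\<Union>j\<in>{1..3 ^ CARD('n)}. D j) = \<Union> (third_translates A)"
      using assms(11) by simp
    then have S: "(SUP Q \<in> {Q \<in> \<Union> (third_translates A). emeasure \<mu> Q > 0}.
        emeasure \<nu> Q / epowr (emeasure \<mu> Q) \<theta>) < \<infinity>"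
      using assms(14) by (simp only: \<theta>_def)
    obtain K' where K': "K' > 0" "\<forall>x \<rho>. \<rho> > 0 \<longrightarrow> emeasure \<mu> (ball x \<rho>) > 0 \<longrightarrow>
        emeasure \<nu> (ball x \<rho>) \<le> ennreal (K' * \<rho> powr (d - \<alpha> * p))"
      by (rule trace_ball_growth[OF sets K(1) \<open>0 < d\<close> \<theta>(1) K(2)[rule_format] assms(9) S, unfolded \<theta>(2)])
        (assumption, rule that, assumption, blast)
    obtain C1 where C1: "C1 > 0" "\<forall>E. E \<in> sets borel \<longrightarrow> emeasure \<mu> E < \<infinity> \<longrightarrow>
        (\<exists>G\<in>borel_measurable borel. (\<forall>x. nn_potential d \<alpha> \<mu> (indicator E) x \<le> epowr (G x) (1 / p)) \<and>
          (\<integral>\<^sup>+ x. G x \<partial>\<nu>) \<le> ennreal C1 * emeasure \<mu> E)"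
      by (rule strong_type_majorant[OF sets \<open>0 < \<alpha>\<close> \<open>\<alpha> < d\<close> \<open>1 < p\<close> K1 K'(1) ball K'(2)[rule_format]])
        (assumption, assumption, assumption, rule that, assumption, blast)
    \<comment> \<open>The constant of \<open>nn_potential_indicator_le\<close> for
      \<open>\<gamma> = d\<close>, written so that the two expressions match literally.\<close>
    define C2 where "C2 = 2 powr (d - \<alpha>) * K1 / (1 - 2 powr (- \<alpha>)) + 2 powr (d - d) / (1 - 2 powr (\<alpha> - d))"
    have "2 powr (- \<alpha>) < (1::real)" "2 powr (\<alpha> - d) < (1::real)"
      using \<open>0 < \<alpha>\<close> \<open>\<alpha> < d\<close> powr_less_mono[of "-\<alpha>" 0 2] powr_less_mono[of "\<alpha> - d" 0 2] by auto
    then have C2: "C2 > 0"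
      unfolding C2_def using K1 by (intro add_pos_pos divide_pos_pos mult_pos_pos) auto
    have sup: "nn_potential d \<alpha> \<mu> (indicator E) x \<le> ennreal (C2 * b powr (1 / q))"
      if E: "E \<in> sets borel" and b: "0 \<le> b" "emeasure \<mu> E = ennreal b" for E b x
    proof (cases "b = 0")
      case True
      \<comment> \<open>\<open>nn_potential_indicator_le\<close> asks for \<open>0 < V\<close>, so
        null sets are treated separately.\<close>
      have "emeasure \<mu> (E \<inter> ball x \<rho>) \<le> emeasure \<mu> E" for \<rho>
        using E sets by (intro emeasure_mono) auto
      then show ?thesis
        using True b nn_potential_indicator_null[OF sets(1) E] by simp
    next
      case False
      \<comment> \<open>With \<open>\<gamma> = d\<close> the number \<open>V\<close> is the measure
        of \<open>E\<close> itself, as \<open>\<rho> powr (d - d) = 1\<close>.\<close>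
      show ?thesis
        unfolding C2_def q(2)
      proof (rule nn_potential_indicator_le[OF \<open>0 < \<alpha>\<close> \<open>\<alpha> < d\<close> \<open>\<alpha> < d\<close> K1 sets(1) E])
        fix \<rho> :: real assume "\<rho> > 0"
        have "emeasure \<mu> (E \<inter> ball x \<rho>) \<le> emeasure \<mu> (ball x \<rho>)"
          using E sets by (intro emeasure_mono) auto
        also have "\<dots> \<le> ennreal (K1 * \<rho> powr d)"
          by (rule ball) fact
        finally show "emeasure \<mu> (E \<inter> ball x \<rho>) \<le> ennreal (K1 * \<rho> powr d)" .
        have "emeasure \<mu> (E \<inter> ball x \<rho>) \<le> emeasure \<mu> E"
          using E sets by (intro emeasure_mono) auto
        then show "emeasure \<mu> (E \<inter> ball x \<rho>) \<le> ennreal (b * \<rho> powr (d - d))"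
          using \<open>\<rho> > 0\<close> b by simp
      qed (use False b in simp)
    qed
    obtain C4 where C4: "C4 > 0" "\<And>f. f \<in> borel_measurable \<mu> \<Longrightarrow> X f \<le> ennreal C4 * X1 f"
      using assms(21) by (auto simp: equivalent_norms_def)
    have R: "bounded_operator (lborel_ivl (emeasure \<mu> (space \<mu>))) Xbar Ybar
        (\<lambda>g. R_op p q (extend0 (ivl (emeasure \<mu> (space \<mu>))) g))"
      using assms(19) by (simp add: space q_def)
    have sub: "\<exists>C>0. \<forall>f\<in>borel_measurable \<mu>. sum_norm \<mu> (Lp_norm \<mu> p) (weak_Lq_norm \<mu> q) f \<le> ennreal C * X (nnabs f)"
      using assms(17) by (simp add: q_def)
    have N0: "0 < emeasure \<nu> UNIV"
      using False by (simp add: zero_less_iff_neq_zero)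
    obtain C3 where C3: "C3 > 0" "\<forall>E a. E \<in> sets \<mu> \<longrightarrow> emeasure \<mu> E = ennreal a \<longrightarrow> 0 < a \<longrightarrow>
        Ybar (\<lambda>t. ennreal (profile p q a t)) \<le> ennreal C3 * X (indicator E)"
      by (rule profile_norm_le[OF \<open>1 < p\<close> q(1) assms(15) Y R sub N0]) (rule that, assumption, blast)
    obtain C5 where C5: "0 < C5" "\<forall>f\<in>borel_measurable \<mu>. sum_norm \<mu> (Lp_norm \<mu> p) (weak_Lq_norm \<mu> q) f \<le> ennreal C5 * X (nnabs f)"
      using sub by blast
    obtain C6 where C6: "0 < C6" "\<forall>E a. E \<in> sets \<mu> \<longrightarrow> emeasure \<mu> E = ennreal a \<longrightarrow> 1 \<le> a \<longrightarrow>
        ennreal (a powr (1 / q)) \<le> ennreal C6 * X (indicator E)"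
      by (rule powr_le_norm_indicator[OF C5(2,1) zero_less_one \<open>1 < p\<close> q(1)]) (rule that, assumption, blast)
    \<comment> \<open>This transfers estimates by \<open>X\<close> to the norm \<open>X1\<close>
      from which the Lorentz norm is formed.\<close>
    have X_le: "X (indicator E) \<le> ennreal C4 * X1 (indicator E)" if "E \<in> sets \<mu>" for E
      using that by (intro C4(2)) simp
    have prof: "Ybar (\<lambda>t. ennreal (profile p q a t)) \<le> ennreal (C3 * C4) * X1 (indicator E)"
      if E: "E \<in> sets \<mu>" "emeasure \<mu> E = ennreal a" "0 < a" for E a
    proof -
      have "Ybar (\<lambda>t. ennreal (profile p q a t)) \<le> ennreal C3 * X (indicator E)"
        by (rule C3(2)[rule_format, OF E])
      also have "\<dots> \<le> ennreal C3 * (ennreal C4 * X1 (indicator E))"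
        by (intro mult_left_mono X_le E) simp
      finally show ?thesis
        using C3(1) C4(1) by (simp add: ennreal_mult mult.assoc)
    qed
    \<comment> \<open>There are sets of arbitrarily large finite measure \<open>a\<close>, and the
      inclusion of the space of \<open>X\<close> makes their norms at least a multiple of
      \<open>a powr (1 / q)\<close>.\<close>
    have unb: "\<exists>a>0. ennreal B \<le> fundamental X1bar a" if "emeasure \<mu> (space \<mu>) = \<infinity>" for B
    proof -
      \<comment> \<open>\<open>max B 0\<close> keeps the base of the power nonnegative;
        \<open>C6 * C4\<close> offsets the constants of the inclusion and of the
        equivalence.\<close>
      define B' where "B' = max B 0 * (C6 * C4)"
      obtain E a where E: "E \<in> sets \<mu>" "emeasure \<mu> E = ennreal a" "max 1 (B' powr q) \<le> a"
        using ex_set_large_measure[OF \<mu>, of "max 1 (B' powr q)"] \<open>emeasure \<mu> (space \<mu>) = \<infinity>\<close> unfolding space by blast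
      have "0 \<le> B'" using C6(1) C4(1) by (simp add: B'_def)
      have "q > 0" using q \<open>1 < p\<close> by simp
      have "(B' powr q) powr (1 / q) \<le> a powr (1 / q)"
        using E(3) \<open>q > 0\<close> by (intro powr_mono2) auto
      then have "ennreal B' \<le> ennreal (a powr (1 / q))"
        using \<open>q > 0\<close> \<open>0 \<le> B'\<close> by (intro ennreal_leI) (simp add: powr_powr)
      also have "\<dots> \<le> ennreal C6 * X (indicator E)"
        using E by (intro C6(2)[rule_format]) auto
      also have "\<dots> \<le> ennreal C6 * (ennreal C4 * X1 (indicator E))"
        by (intro mult_left_mono X_le E) simp
      also have "X1 (indicator E) = fundamental X1bar a"
        using E by (intro norm_indicator_eq_fundamental[OF assms(20)]) auto
      finally have "ennreal (1 / (C6 * C4)) * ennreal B' \<le> ennreal (1 / (C6 * C4)) * (ennreal C6 * (ennreal C4 * fundamental X1bar a))"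
        by (rule mult_left_mono) simp
      also have "ennreal (1 / (C6 * C4)) * ennreal B' = ennreal (max B 0)"
        using C6(1) C4(1) by (subst ennreal_mult[symmetric]) (auto simp: B'_def)
      also have "ennreal (1 / (C6 * C4)) * (ennreal C6 * (ennreal C4 * fundamental X1bar a)) = fundamental X1bar a"
        using C6(1) C4(1) by (simp add: mult.assoc[symmetric] ennreal_mult[symmetric])
      finally have le: "ennreal (max B 0) \<le> fundamental X1bar a" .
      have "ennreal B \<le> ennreal (max B 0)"
        by (intro ennreal_leI) simp
      then have "ennreal B \<le> fundamental X1bar a"
        using le by (rule order_trans)
      then show ?thesis
        using E(3) by (intro exI[of _ a]) auto
    qed
    show ?thesis
    proof (rule riesz_bounded_of_characteristic_functions[OF sets sigma_finite_radon[OF \<nu>] \<open>1 < p\<close> C1(1) C2 _ C1(2)[rule_format] sup prof Y _ assms(20)])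
      show "0 < C3 * C4" using C3(1) C4(1) by simp
      show "0 < emeasure \<nu> UNIV" by (rule N0)
      show "concave_on (ivl (emeasure \<mu> (space \<mu>))) (\<lambda>t. enn2real (fundamental X1bar t))"
        using assms(22) by (simp add: space)
    qed (use unb in auto)
  qed
qed

end
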